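(* Let $\mathcal{T}$ be a tanglegram having exactly one cross-responsible set $X$. If $\mathcal{T}[X]$ is isomorphic to $\mathcal{K}_2$, then $\operatorname{crt}(\mathcal{T})=1$.
   Context: A rooted tree is a tree with at least two vertices and a designated root of degree $1$; leaves are non-root vertices of degree $1$; a rooted binary tree is a rooted tree in which all non-root, non-leaf vertices have degree $3$. For a set $S$ of leaves of a rooted binary tree $T$, $T[S]$ is obtained from the union of the root-to-$s$ paths ($s\in S$) by suppressing degree-$2$ vertices. A tanglegram $\mathcal{T}=(L_{\mathcal{T}},R_{\mathcal{T}},\sigma_{\mathcal{T}})$ consists of two rooted binary trees with equally many leaves and a perfect matching $\sigma_{\mathcal{T}}$ between their leaf sets. For $Z\subseteq\sigma_{\mathcal{T}}$, $\mathcal{T}[Z]$ has left tree $L_{\mathcal{T}}[S_1]$, right tree $R_{\mathcal{T}}[S_2]$ and matching $Z$, where $S_1,S_2$ are the left and right leaves covered by $Z$. Tanglegrams are isomorphic if there is a graph isomorphism mapping left root to left root and right root to right root. A plane drawing of a rooted tree is a straight-line crossing-free drawing with all leaves on a line (the leaf-line), all other vertices in one open half-plane of it, and each vertex strictly closer to the leaf-line than its proper ancestors. A layout of $\mathcal{T}$ is a straight-line drawing where both trees are drawn as plane drawings with parallel leaf-lines, both trees lie outside the strip between the leaf-lines, and matching edges are straight segments. Its crossing number is the number of unordered pairs of crossing matching edges; $\operatorname{crt}(\mathcal{T})$ is the minimum over all layouts. $\mathcal{K}_1$ is the size-$4$ tanglegram in which each tree has root adjacent to an internal vertex whose two children each have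 two leaf children, with left cherries $\{l_1,l_2\},\{l_3,l_4\}$, right cherries $\{r_1,r_2\},\{r_3,r_4\}$ and matching $l_1r_1, l_2r_3, l_3r_2, l_4r_4$. $\mathcal{K}_2$ is the size-$4$ tanglegram whose left tree is: root adjacent to $v_1$, $v_1$ has children leaf $l_1$ and $v_2$, $v_2$ has children leaf $l_2$ and $v_3$, $v_3$ has leaf children $l_3,l_4$; right tree analogously with $w_1,w_2,w_3$ and leaves $r_1$ (child of $w_1$), $r_2$ (child of $w_2$), $r_3,r_4$ (children of $w_3$); matching $l_1r_4, l_2r_2, l_3r_3, l_4r_1$. A set $Y\subseteq\sigma_{\mathcal{T}}$ is cross-responsible if $\mathcal{T}[Y]$ is isomorphic to $\mathcal{K}_1$ or $\mathcal{K}_2$. *)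

theory Defs
  imports "HOL-Analysis.Analysis"
begin

record 'v graph =
  verts :: "'v set"
  edges :: "'v set set"

definition simple_graph :: "('v, 'z) graph_scheme \<Rightarrow> bool" where
  "simple_graph G \<longleftrightarrow> finite (verts G) \<and>
     edges G \<subseteq> {{u, v} | u v. u \<in> verts G \<and> v \<in> verts G \<and> u \<noteq> v}"

definition degree :: "('v, 'z) graph_scheme \<Rightarrow> 'v \<Rightarrow> nat" where
  "degree G v = card {e \<in> edges G. v \<in> e}"

definition path_between :: "('v, 'z) graph_scheme \<Rightarrow> 'v \<Rightarrow> 'v list \<Rightarrow> 'v \<Rightarrow> bool" where
  "path_between G u p v \<longleftrightarrow>
     p \<noteq> [] \<and> hd p = u \<and> last p = v \<and> set p \<subseteq> verts G \<and> distinct p \<and>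
     successively (\<lambda>x y. {x, y} \<in> edges G) p"

definition path_edges :: "'v list \<Rightarrow> 'v set set" where
  "path_edges p = {{p ! i, p ! Suc i} | i. Suc i < length p}"

definition connected_graph :: "('v, 'z) graph_scheme \<Rightarrow> bool" where
  "connected_graph G \<longleftrightarrow> (\<forall>u \<in> verts G. \<forall>v \<in> verts G. \<exists>p. path_between G u p v)"

definition acyclic_graph :: "('v, 'z) graph_scheme \<Rightarrow> bool" where
  "acyclic_graph G \<longleftrightarrow>
     \<not> (\<exists>u p v. path_between G u p v \<and> length p \<ge> 3 \<and> {v, u} \<in> edges G)"

definition is_tree :: "('v, 'z) graph_scheme \<Rightarrow> bool" where
  "is_tree G \<longleftrightarrow> simple_graph G \<and> verts G \<noteq> {} \<and> connected_graph G \<and> acyclic_graph G"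

record 'v rtree = "'v graph" +
  root :: 'v

definition rooted_tree :: "'v rtree \<Rightarrow> bool" where
  "rooted_tree t \<longleftrightarrow>
     is_tree t \<and> card (verts t) \<ge> 2 \<and> root t \<in> verts t \<and> degree t (root t) = 1"

definition leaves :: "'v rtree \<Rightarrow> 'v set" where
  "leaves t = {v \<in> verts t. v \<noteq> root t \<and> degree t v = 1}"

definition rooted_binary_tree :: "'v rtree \<Rightarrow> bool" where
  "rooted_binary_tree t \<longleftrightarrow>
     rooted_tree t \<and> (\<forall>v \<in> verts t - {root t} - leaves t. degree t v = 3)"

definition proper_ancestor :: "'v rtree \<Rightarrow> 'v \<Rightarrow> 'v \<Rightarrow> bool" where
  "proper_ancestor t u v \<longleftrightarrow> u \<noteq> v \<and> (\<exists>p. path_between t (root t) p v \<and> u \<in> set p)"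

definition root_path_union :: "'v rtree \<Rightarrow> 'v set \<Rightarrow> 'v rtree" where
  "root_path_union t S =
     \<lparr>verts = \<Union> {set p | p. \<exists>s \<in> S. path_between t (root t) p s},
      edges = \<Union> {path_edges p | p. \<exists>s \<in> S. path_between t (root t) p s},
      root = root t\<rparr>"

text \<open>
  Suppressing all vertices of degree 2 at once: two surviving vertices become adjacent
  if and only if they are joined by a path all of whose inner vertices have degree 2.
\<close>

definition suppress :: "'v rtree \<Rightarrow> 'v rtree" where
  "suppress t =
     \<lparr>verts = {v \<in> verts t. degree t v \<noteq> 2},
      edges = {{u, v} | u v. u \<noteq> v \<and> degree t u \<noteq> 2 \<and> degree t v \<noteq> 2 \<and>
                 (\<exists>p. path_between t u p v \<and> (\<forall>w \<in> set p - {u, v}. degree t w = 2))},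
      root = root t\<rparr>"

definition induced_tree :: "'v rtree \<Rightarrow> 'v set \<Rightarrow> 'v rtree" where
  "induced_tree t S = suppress (root_path_union t S)"

record ('a, 'b) tanglegram =
  left_tree :: "'a rtree"
  right_tree :: "'b rtree"
  matching :: "('a \<times> 'b) set"

definition perfect_matching :: "('a \<times> 'b) set \<Rightarrow> 'a set \<Rightarrow> 'b set \<Rightarrow> bool" where
  "perfect_matching M A B \<longleftrightarrow> M \<subseteq> A \<times> B \<and>
     (\<forall>x \<in> A. \<exists>!y. (x, y) \<in> M) \<and> (\<forall>y \<in> B. \<exists>!x. (x, y) \<in> M)"

definition is_tanglegram :: "('a, 'b) tanglegram \<Rightarrow> bool" where
  "is_tanglegram T \<longleftrightarrow>
     rooted_binary_tree (left_tree T) \<and> rooted_binary_tree (right_tree T) \<and>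
     card (leaves (left_tree T)) = card (leaves (right_tree T)) \<and>
     perfect_matching (matching T) (leaves (left_tree T)) (leaves (right_tree T))"

definition induced_tanglegram ::
    "('a, 'b) tanglegram \<Rightarrow> ('a \<times> 'b) set \<Rightarrow> ('a, 'b) tanglegram" where
  "induced_tanglegram T Z =
     \<lparr>left_tree = induced_tree (left_tree T) (fst ` Z),
      right_tree = induced_tree (right_tree T) (snd ` Z),
      matching = Z\<rparr>"

definition tanglegram_graph :: "('a, 'b) tanglegram \<Rightarrow> ('a + 'b) graph" where
  "tanglegram_graph T =
     \<lparr>verts = Inl ` verts (left_tree T) \<union> Inr ` verts (right_tree T),
      edges = (`) Inl ` edges (left_tree T) \<union> (`) Inr ` edges (right_tree T) \<union>
              {{Inl x, Inr y} | x y. (x, y) \<in> matching T}\<rparr>"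

definition graph_iso :: "('v \<Rightarrow> 'w) \<Rightarrow> 'v graph \<Rightarrow> 'w graph \<Rightarrow> bool" where
  "graph_iso f G H \<longleftrightarrow> bij_betw f (verts G) (verts H) \<and>
     (\<forall>u \<in> verts G. \<forall>v \<in> verts G. {u, v} \<in> edges G \<longleftrightarrow> {f u, f v} \<in> edges H)"

definition tanglegram_isomorphic ::
    "('a, 'b) tanglegram \<Rightarrow> ('c, 'd) tanglegram \<Rightarrow> bool" where
  "tanglegram_isomorphic T U \<longleftrightarrow>
     (\<exists>f. graph_iso f (tanglegram_graph T) (tanglegram_graph U) \<and>
          f (Inl (root (left_tree T))) = Inl (root (left_tree U)) \<and>
          f (Inr (root (right_tree T))) = Inr (root (right_tree U)))"

datatype kvertex = Root | Inner nat | Leaf nat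

definition K1_tree :: "kvertex rtree" where
  "K1_tree =
     \<lparr>verts = {Root, Inner 1, Inner 2, Inner 3, Leaf 1, Leaf 2, Leaf 3, Leaf 4},
      edges = {{Root, Inner 1}, {Inner 1, Inner 2}, {Inner 1, Inner 3},
               {Inner 2, Leaf 1}, {Inner 2, Leaf 2}, {Inner 3, Leaf 3}, {Inner 3, Leaf 4}},
      root = Root\<rparr>"

definition K2_tree :: "kvertex rtree" where
  "K2_tree =
     \<lparr>verts = {Root, Inner 1, Inner 2, Inner 3, Leaf 1, Leaf 2, Leaf 3, Leaf 4},
      edges = {{Root, Inner 1}, {Inner 1, Leaf 1}, {Inner 1, Inner 2},
               {Inner 2, Leaf 2}, {Inner 2, Inner 3}, {Inner 3, Leaf 3}, {Inner 3, Leaf 4}},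
      root = Root\<rparr>"

definition K1 :: "(kvertex, kvertex) tanglegram" where
  "K1 = \<lparr>left_tree = K1_tree, right_tree = K1_tree,
         matching = {(Leaf 1, Leaf 1), (Leaf 2, Leaf 3), (Leaf 3, Leaf 2), (Leaf 4, Leaf 4)}\<rparr>"

definition K2 :: "(kvertex, kvertex) tanglegram" where
  "K2 = \<lparr>left_tree = K2_tree, right_tree = K2_tree,
         matching = {(Leaf 1, Leaf 4), (Leaf 2, Leaf 2), (Leaf 3, Leaf 3), (Leaf 4, Leaf 1)}\<rparr>"

definition cross_responsible :: "('a, 'b) tanglegram \<Rightarrow> ('a \<times> 'b) set \<Rightarrow> bool" where
  "cross_responsible T Y \<longleftrightarrow> Y \<subseteq> matching T \<and>
     (tanglegram_isomorphic (induced_tanglegram T Y) K1 \<or>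
      tanglegram_isomorphic (induced_tanglegram T Y) K2)"

type_synonym point = "real \<times> real"

text \<open>
  A straight-line drawing is given by the positions of the vertices; the edge \<open>e\<close> is drawn as
  \<open>convex hull (d ` e)\<close>, the closed segment between its two end points.  Every vertex of a rooted
  tree lies on an edge, so the condition on pairs of edges also keeps vertices off the edges that
  do not contain them.
\<close>

definition crossing_free :: "('v, 'z) graph_scheme \<Rightarrow> ('v \<Rightarrow> point) \<Rightarrow> bool" where
  "crossing_free G d \<longleftrightarrow> inj_on d (verts G) \<and>
     (\<forall>e \<in> edges G. \<forall>f \<in> edges G. e \<noteq> f \<longrightarrow>
        convex hull (d ` e) \<inter> convex hull (d ` f) \<subseteq> d ` (e \<inter> f))"

text \<open>
  The leaf-line is \<open>{x. n \<bullet> x = c}\<close> with unit normal \<open>n\<close> pointing into the half-plane that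
  contains the tree, so \<open>n \<bullet> x - c\<close> is the distance of a point \<open>x\<close> of that half-plane to the
  leaf-line.
\<close>

definition plane_drawing :: "'v rtree \<Rightarrow> ('v \<Rightarrow> point) \<Rightarrow> point \<Rightarrow> real \<Rightarrow> bool" where
  "plane_drawing t d n c \<longleftrightarrow> norm n = 1 \<and> crossing_free t d \<and>
     (\<forall>v \<in> leaves t. n \<bullet> d v = c) \<and>
     (\<forall>v \<in> verts t - leaves t. n \<bullet> d v > c) \<and>
     (\<forall>u \<in> verts t. \<forall>v \<in> verts t. proper_ancestor t u v \<longrightarrow> n \<bullet> d v - c < n \<bullet> d u - c)"

text \<open>
  The leaf-lines are \<open>{x. n \<bullet> x = a}\<close> (left) and \<open>{x. n \<bullet> x = b}\<close> (right) with \<open>a < b\<close>; the two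
  trees use the opposite normals \<open>- n\<close> and \<open>n\<close>, both pointing away from the strip between them.
\<close>

definition is_layout :: "('a, 'b) tanglegram \<Rightarrow> ('a \<Rightarrow> point) \<Rightarrow> ('b \<Rightarrow> point) \<Rightarrow> bool" where
  "is_layout T dL dR \<longleftrightarrow>
     (\<exists>n a b. a < b \<and> plane_drawing (left_tree T) dL (- n) (- a) \<and>
              plane_drawing (right_tree T) dR n b)"

text \<open>
  Distinct matching edges have no end point in common, neither in the graph nor in a layout, so
  their segments cross if and only if they meet.
\<close>

definition crossings ::
    "('a, 'b) tanglegram \<Rightarrow> ('a \<Rightarrow> point) \<Rightarrow> ('b \<Rightarrow> point) \<Rightarrow> ('a \<times> 'b) set set" where
  "crossings T dL dR =
     {{(x, y), (x', y')} | x y x' y'.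
        (x, y) \<in> matching T \<and> (x', y') \<in> matching T \<and> (x, y) \<noteq> (x', y') \<and>
        closed_segment (dL x) (dR y) \<inter> closed_segment (dL x') (dR y') \<noteq> {}}"

definition crt :: "('a, 'b) tanglegram \<Rightarrow> nat" where
  "crt T = (LEAST k. \<exists>dL dR. is_layout T dL dR \<and> card (crossings T dL dR) = k)"

end

theory Submission
  imports Defs "HOL-Library.Sublist"
begin

text \<open>
  Join an inner vertex \<open>v\<close> of the left tree to an inner vertex \<open>w\<close> of the right tree whenever some
  pair of matching edges is separated at \<open>v\<close> on the left and at \<open>w\<close> on the right.  A planar drawing
  of a tree amounts to a choice of the order of the two children at each inner vertex, and the pairs
  joining \<open>v\<close> to \<open>w\<close> ask for a prescribed relation between the choices at \<open>v\<close> and \<open>w\<close>.  Hence the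
  crossing number is the frustration index of a signed bipartite multigraph.

  Without \<open>K1\<close> parallel edges have equal signs and all neighbourhoods are chains.  Then the cycles are
  generated by the nested 4-cycles on \<open>v < v'\<close> and \<open>w' < w\<close>, and a negative one of these is a copy of
  \<open>K2\<close>.  If there is only one copy \<open>a1, a2, a3, a4\<close> of \<open>K2\<close>, there is exactly one negative nested
  4-cycle, and one of its edges, that of \<open>a2, a3\<close>, of \<open>a1, a2\<close> or of \<open>a2, a4\<close>, is simple and lies on no
  other nested 4-cycle.  Changing its sign balances the graph, so one crossing suffices.

  Conversely, a path of a plane drawing that joins two leaves inside a subtree cannot cross the path
  from an outer leaf to the root, which is continued to infinity.  So the leaves of a subtree are
  contiguous, and this forces a crossing among the four edges of \<open>K2\<close>.
\<close>

section \<open>Signed graphs and hierarchies\<close>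

text \<open>The combinatorial part never sees a tree as a graph: a vertex is known only through the
  labels below it and the way it separates them, the labels being the matching edges. This makes the
  two trees interchangeable, and one-sided lemmas get their mirror images for free. The price is a
  dictionary. Induced trees are defined by suppressing vertices and have to be recognised as Hasse
  diagrams of the ancestor order on the surviving vertices. An isomorphism is only a graph
  isomorphism fixing the two roots, so that it keeps the trees apart and points downwards must be
  proved by walking down from the roots. In the middle part uniqueness acts in two ways. Replacing a
  label of the copy without disturbing its shape cannot give a new label. And two positive 4-cycles
  glued along a common pair of edges give a positive one, so they can never compose to the cycle of
  the copy. The obstacle is that no edge of this cycle is always good: the edge of
  \<open>a2\<close>, \<open>a3\<close> may be the top of further nested cycles, and then another
  edge has to be shown free of them.\<close>

text \<open>
  Induction by removing an element \<open>a\<close> minimal for \<open>la\<close>.  Those neighbours of \<open>a\<close> that have a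
  further neighbour all ask for the same value at \<open>a\<close>, and the others can be adjusted freely.
\<close>

lemma potential_exists:
  fixes E :: "'v \<Rightarrow> 'w \<Rightarrow> bool" and \<sigma> :: "'v \<Rightarrow> 'w \<Rightarrow> bool" and \<mu> :: "'v \<Rightarrow> nat"
  assumes "finite A"
    and chainA: "\<And>a b b'. a \<in> A \<Longrightarrow> E a b \<Longrightarrow> E a b' \<Longrightarrow> b = b' \<or> lb b b' \<or> lb b' b"
    and chainB: "\<And>a a' b. a \<in> A \<Longrightarrow> a' \<in> A \<Longrightarrow> E a b \<Longrightarrow> E a' b \<Longrightarrow> a = a' \<or> la a a' \<or> la a' a"
    and mono: "\<And>a a'. a \<in> A \<Longrightarrow> a' \<in> A \<Longrightarrow> la a a' \<Longrightarrow> \<mu> a < \<mu> a'"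
    and closed: "\<And>a a' b b'. a \<in> A \<Longrightarrow> a' \<in> A \<Longrightarrow> la a a' \<Longrightarrow> lb b' b \<Longrightarrow>
                   E a b \<Longrightarrow> E a b' \<Longrightarrow> E a' b' \<Longrightarrow> E a' b"
    and pos: "\<And>a a' b b'. a \<in> A \<Longrightarrow> a' \<in> A \<Longrightarrow> la a a' \<Longrightarrow> lb b' b \<Longrightarrow>
                   E a b \<Longrightarrow> E a b' \<Longrightarrow> E a' b' \<Longrightarrow> E a' b \<Longrightarrow> (\<sigma> a b = \<sigma> a b') = (\<sigma> a' b = \<sigma> a' b')"
  shows "\<exists>(f :: 'v \<Rightarrow> bool) g. \<forall>a \<in> A. \<forall>b. E a b \<longrightarrow> \<sigma> a b = (f a = g b)"
  using assms
proof (induction "card A" arbitrary: A)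
  case 0
  then show ?case by auto
next
  case (Suc n)
  note Fin = Suc.prems(1) and cA = Suc.prems(2) and cB = Suc.prems(3) and mn = Suc.prems(4)
    and cl = Suc.prems(5) and ps = Suc.prems(6)
  have "A \<noteq> {}" using Suc.hyps(2) by auto
  then obtain a where a: "a \<in> A" "\<And>a'. a' \<in> A \<Longrightarrow> \<mu> a \<le> \<mu> a'"
    using ex_min_if_finite[of "\<mu> ` A"] Fin by (auto simp: not_less)
  let ?A = "A - {a}"
  have cd: "n = card ?A" using Suc.hyps(2) a(1) Fin by simp
  have "\<exists>(f :: 'v \<Rightarrow> bool) g. \<forall>a \<in> ?A. \<forall>b. E a b \<longrightarrow> \<sigma> a b = (f a = g b)"
  proof (rule Suc.hyps(1)[OF cd])
    show "finite ?A" using Fin by simp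
  qed (use cA cB mn cl ps in \<open>(meson DiffD1)+\<close>)
  then obtain f :: "'v \<Rightarrow> bool" and g where fg: "\<And>a b. a \<in> ?A \<Longrightarrow> E a b \<Longrightarrow> \<sigma> a b = (f a = g b)" by blast
  define Bs where "Bs = {b. E a b \<and> (\<exists>a'\<in>?A. E a' b)}"
  have *: "(\<sigma> a b = g b) = (\<sigma> a b' = g b')" if "b \<in> Bs" "b' \<in> Bs" "lb b' b" for b b'
  proof -
    from that obtain a' where a': "a' \<in> ?A" "E a' b'" and e: "E a b" "E a b'" by (auto simp: Bs_def)
    \<comment> \<open>Minimality of \<open>\<mu> a\<close> rules out \<open>la a' a\<close>. With
      \<open>a'\<close> above \<open>a\<close>, closedness makes \<open>a'\<close> a neighbour of
      \<open>b\<close> as well, and a complete 4-cycle is available.\<close>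
    have "la a a'" using cB[of a a' b'] a' e a mn[of a' a] by fastforce
    then have e2: "E a' b" using cl[of a a' b' b] a' e a(1) that(3) by blast
    have "(\<sigma> a b = \<sigma> a b') = (\<sigma> a' b = \<sigma> a' b')"
      using ps[of a a' b' b] \<open>la a a'\<close> a' e e2 that(3) a(1) by blast
    then show ?thesis using fg[of a' b] fg[of a' b'] a' e2 by auto
  qed
  have eq: "(\<sigma> a b = g b) = (\<sigma> a b' = g b')" if "b \<in> Bs" "b' \<in> Bs" for b b'
    using cA[of a b b'] *[of b b'] *[of b' b] that a(1) by (auto simp: Bs_def)
  obtain k where k: "\<And>b. b \<in> Bs \<Longrightarrow> \<sigma> a b = (k = g b)"
  proof (cases "\<exists>b. b \<in> Bs")
    case True
    then obtain b0 where "b0 \<in> Bs" by blast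
    then show thesis using eq[of b0] that[of "\<sigma> a b0 = g b0"] by auto
  next
    case False
    then show thesis using that by blast
  qed
  define f' where "f' = f(a := k)"
  define g' where "g' = (\<lambda>b. if E a b \<and> b \<notin> Bs then (\<sigma> a b = k) else g b)"
  have "\<sigma> x b = (f' x = g' b)" if "x \<in> A" "E x b" for x b
  proof (cases "x = a")
    case True
    then show ?thesis using that k by (auto simp: f'_def g'_def)
  next
    case False
    then show ?thesis using that fg[of x b] by (auto simp: f'_def g'_def Bs_def)
  qed
  then show ?case by blast
qed

text \<open>
  The vertices \<open>v\<close> stand for the inner vertices of a binary tree, \<open>C v\<close> for the set of labels of the
  leaves below \<open>v\<close>, and \<open>side v\<close> tells the two child subtrees of \<open>v\<close> apart; its values outside \<open>C v\<close>
  are junk.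
\<close>

locale hierarchy =
  fixes V :: "'v set" and C :: "'v \<Rightarrow> 'm set" and side :: "'v \<Rightarrow> 'm \<Rightarrow> bool" and M :: "'m set"
  assumes finite_V: "finite V" and finite_M: "finite M"
    and C_subset: "v \<in> V \<Longrightarrow> C v \<subseteq> M"
    and separated: "x \<in> M \<Longrightarrow> y \<in> M \<Longrightarrow> x \<noteq> y \<Longrightarrow> \<exists>v\<in>V. x \<in> C v \<and> y \<in> C v \<and> side v x \<noteq> side v y"
    and laminar: "u \<in> V \<Longrightarrow> v \<in> V \<Longrightarrow> u \<noteq> v \<Longrightarrow> C u \<inter> C v = {} \<or>
        (C u \<subseteq> C v \<and> (\<forall>x\<in>C u. \<forall>y\<in>C u. side v x = side v y)) \<or>
        (C v \<subseteq> C u \<and> (\<forall>x\<in>C v. \<forall>y\<in>C v. side u x = side u y))"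
    and both_sides: "v \<in> V \<Longrightarrow> \<exists>x\<in>C v. \<exists>y\<in>C v. side v x \<noteq> side v y"
begin

text \<open>In a tree: \<open>v\<close> is the lowest common ancestor of the leaves labelled
  \<open>x\<close> and \<open>y\<close>.\<close>

definition splits :: "'v \<Rightarrow> 'm \<Rightarrow> 'm \<Rightarrow> bool" where
  "splits v x y \<longleftrightarrow> v \<in> V \<and> x \<in> C v \<and> y \<in> C v \<and> side v x \<noteq> side v y"

definition below :: "'v \<Rightarrow> 'v \<Rightarrow> bool" where
  "below u v \<longleftrightarrow> u \<in> V \<and> v \<in> V \<and> u \<noteq> v \<and> C u \<subseteq> C v"

text \<open>The order of the leaves along the leaf-line when \<open>f v\<close> names the side that
  is drawn first at \<open>v\<close>.\<close>

definition lt :: "('v \<Rightarrow> bool) \<Rightarrow> 'm \<Rightarrow> 'm \<Rightarrow> bool" where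
  "lt f x y \<longleftrightarrow> (\<exists>v. splits v x y \<and> side v x = f v)"

text \<open>The shape of \<open>K2_tree\<close>: \<open>p\<close> branches off first, then
  \<open>q\<close>, and \<open>r\<close>, \<open>s\<close> form the cherry. Nothing here forces
  \<open>r \<noteq> s\<close>; in a copy of \<open>K2\<close> the other tree does.\<close>

definition caterpillar :: "'m \<Rightarrow> 'm \<Rightarrow> 'm \<Rightarrow> 'm \<Rightarrow> bool" where
  "caterpillar p q r s \<longleftrightarrow> (\<exists>u. splits u p q \<and> splits u p r \<and> splits u p s) \<and>
     (\<exists>v. splits v q r \<and> splits v q s)"

text \<open>The shape of \<open>K1_tree\<close> with cherries \<open>p\<close>, \<open>q\<close> and
  \<open>r\<close>, \<open>s\<close>, where a cherry may degenerate. Together with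
  \<open>balanced p r q s\<close> in the other tree it makes all four labels distinct, and the two
  conditions say that they form a copy of \<open>K1\<close>.\<close>

definition balanced :: "'m \<Rightarrow> 'm \<Rightarrow> 'm \<Rightarrow> 'm \<Rightarrow> bool" where
  "balanced p q r s \<longleftrightarrow> (\<exists>u. splits u p r \<and> splits u p s \<and> splits u q r \<and> splits u q s)"

lemma splits_sym: "splits v x y \<longleftrightarrow> splits v y x"
  by (auto simp: splits_def)

lemma splitsD: "splits v x y \<Longrightarrow> v \<in> V \<and> x \<in> C v \<and> y \<in> C v \<and> side v x \<noteq> side v y \<and> x \<noteq> y \<and> x \<in> M \<and> y \<in> M"
  using C_subset by (auto simp: splits_def)

lemma splits_unique: "splits u x y \<Longrightarrow> splits v x y \<Longrightarrow> u = v"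
  using laminar[of u v] unfolding splits_def by blast

lemma splits_exists: "x \<in> M \<Longrightarrow> y \<in> M \<Longrightarrow> x \<noteq> y \<Longrightarrow> \<exists>v. splits v x y"
  using separated by (auto simp: splits_def)

lemma below_const: "below u v \<Longrightarrow> x \<in> C u \<Longrightarrow> y \<in> C u \<Longrightarrow> side v x = side v y"
  using laminar[of u v] both_sides[of u] both_sides[of v] unfolding below_def by blast

lemma below_subset: "below u v \<Longrightarrow> x \<in> C u \<Longrightarrow> x \<in> C v"
  by (auto simp: below_def)

lemma overlap: "u \<in> V \<Longrightarrow> v \<in> V \<Longrightarrow> x \<in> C u \<Longrightarrow> x \<in> C v \<Longrightarrow> u = v \<or> below u v \<or> below v u"
  using laminar[of u v] unfolding below_def by blast

lemma below_psubset: "below u v \<Longrightarrow> C u \<subset> C v"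
  using below_const[of u v] both_sides[of v] unfolding below_def by blast

lemma below_antisym: "below u v \<Longrightarrow> \<not> below v u"
  using below_psubset by blast

lemma below_trans: "below u v \<Longrightarrow> below v w \<Longrightarrow> below u w"
  using below_psubset unfolding below_def by blast

lemma below_card: "below u v \<Longrightarrow> card (C u) < card (C v)"
  using below_psubset C_subset finite_M by (meson below_def finite_subset psubset_card_mono)

lemma splits_outside:
  assumes "splits u x y" "v \<in> V" "x \<in> C v" "y \<notin> C v"
  shows "below v u"
  using overlap[of u v x] assms unfolding splits_def below_def by blast

text \<open>The head is the label that is alone on its side of the topmost splitting vertex. If
  \<open>p \<noteq> a\<close>, both vertices split \<open>p\<close> from \<open>a\<close> and so
  coincide; then only \<open>a\<close> would be alone there, although \<open>p\<close> is.\<close>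

lemma caterpillar_head:
  assumes u: "splits u p q" "splits u p r" "splits u p s" and v: "splits v a b" "splits v a c" "splits v a d"
    and eq: "{p, q, r, s} = {a, b, c, d}" and dist: "distinct [p, q, r, s]"
  shows "p = a"
proof (rule ccontr)
  assume n: "p \<noteq> a"
  have mem: "p \<in> {a, b, c, d}" "q \<in> {a, b, c, d}" "r \<in> {a, b, c, d}" "s \<in> {a, b, c, d}"
    by (simp_all add: eq[symmetric])
  have "a \<in> {p, q, r, s}" by (simp add: eq)
  then have a: "a = q \<or> a = r \<or> a = s" using n by auto
  have "splits v p a" using mem(1) n v splits_sym by blast
  moreover have "splits u p a" using a u by blast
  ultimately have uv: "u = v" using splits_unique by blast
  have pq: "side u p \<noteq> side u q" "side u p \<noteq> side u r" "side u p \<noteq> side u s"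
    using u unfolding splits_def by blast+
  have "side u x \<noteq> side u a" if "x \<in> {a, b, c, d}" "x \<noteq> a" for x
    using v that uv unfolding splits_def by auto
  then show False using pq mem a dist by (metis distinct_length_2_or_more)
qed

end

section \<open>Two trees with common labels: the signed bipartite graph\<close>

locale tangle = L: hierarchy V C c M + R: hierarchy W D d M
  for V :: "'v set" and C and c and W :: "'w set" and D and d and M :: "'m set" +
  assumes no_K1: "L.balanced p q r s \<Longrightarrow> \<not> R.balanced p r q s"
begin

lemmas splits_defs = L.splits_def R.splits_def

text \<open>
  The edges of the signed bipartite graph and their signs; the sign does not depend on the pair
  \<open>x, y\<close> because there is no \<open>K1\<close>.
\<close>

definition adj :: "'v \<Rightarrow> 'w \<Rightarrow> bool" where
  "adj v w \<longleftrightarrow> (\<exists>x y. L.splits v x y \<and> R.splits w x y)"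

definition sgn :: "'v \<Rightarrow> 'w \<Rightarrow> bool" where
  "sgn v w \<longleftrightarrow> (\<exists>x y. L.splits v x y \<and> R.splits w x y \<and> c v x = d w x)"

lemma adjI: "L.splits v x y \<Longrightarrow> R.splits w x y \<Longrightarrow> adj v w"
  by (auto simp: adj_def)

text \<open>Two pairs of opposite sign form a copy of \<open>K1\<close>: if \<open>x\<close> and
  \<open>x'\<close> lie together on the left, then \<open>x\<close> and \<open>y'\<close> lie
  together on the right, and vice versa.\<close>

lemma sgn_coherent:
  assumes "L.splits v x y" "R.splits w x y" "L.splits v x' y'" "R.splits w x' y'"
  shows "(c v x = d w x) = (c v x' = d w x')"
proof (rule ccontr)
  assume n: "\<not> ?thesis"
  show False
  proof (cases "c v x = c v x'")
    case True
    have "L.balanced x x' y' y" "R.balanced x y' x' y"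
      using assms n True unfolding L.balanced_def R.balanced_def splits_defs by blast+
    then show False using no_K1 by blast
  next
    case False
    have "L.balanced x y' x' y" "R.balanced x x' y' y"
      using assms n False unfolding L.balanced_def R.balanced_def splits_defs by blast+
    then show False using no_K1 by blast
  qed
qed

lemma sgn_eq: "L.splits v x y \<Longrightarrow> R.splits w x y \<Longrightarrow> sgn v w = (c v x = d w x)"
  using sgn_coherent unfolding sgn_def by blast

text \<open>Otherwise \<open>D w\<close> and \<open>D w'\<close> are disjoint, and their lowest
  common ancestor \<open>m\<close> has cherries \<open>x\<close>, \<open>y\<close> and
  \<open>x'\<close>, \<open>y'\<close>, whereas \<open>v\<close> separates \<open>x\<close> from
  \<open>y\<close> and \<open>x'\<close> from \<open>y'\<close>. This is a copy of
  \<open>K1\<close>.\<close>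

lemma nbrs_chain:
  assumes "adj v w" "adj v w'"
  shows "w = w' \<or> R.below w w' \<or> R.below w' w"
proof (rule ccontr)
  assume n: "\<not> ?thesis"
  obtain x y where 1: "L.splits v x y" "R.splits w x y" using assms(1) by (auto simp: adj_def)
  obtain x' y' where 2: "L.splits v x' y'" "R.splits w' x' y'" using assms(2) by (auto simp: adj_def)
  have disj: "D w \<inter> D w' = {}" using R.overlap[of w w'] n 1 2 unfolding R.splits_def by blast
  have "x \<noteq> x'" using disj 1 2 unfolding R.splits_def by blast
  then obtain m where m: "R.splits m x x'" using R.splits_exists 1 2 R.splitsD by meson
  have b1: "R.below w m" using R.splits_outside[OF m, of w] 1 2 disj unfolding R.splits_def by blast
  have b2: "R.below w' m" using R.splits_outside[of m x' x w'] m 1 2 disj R.splits_sym unfolding R.splits_def by blast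
  have sd: "d m x = d m y" "d m x' = d m y'" "y \<in> D m" "y' \<in> D m"
    using R.below_const[OF b1] R.below_const[OF b2] R.below_subset[OF b1] R.below_subset[OF b2] 1 2
    unfolding R.splits_def by blast+
  show False
  proof (cases "c v x = c v x'")
    case True
    have "L.balanced x x' y y'" "R.balanced x y x' y'"
      using True 1 2 m sd unfolding L.balanced_def R.balanced_def splits_defs by blast+
    then show False using no_K1 by blast
  next
    case False
    have "L.balanced x y' y x'" "R.balanced x y y' x'"
      using False 1 2 m sd unfolding L.balanced_def R.balanced_def splits_defs by blast+
    then show False using no_K1 by blast
  qed
qed

text \<open>A mixed pair is the witness. Seen from \<open>v'\<close> the labels \<open>x\<close>,
  \<open>y\<close> lie on one side, so one of \<open>x'\<close>, \<open>y'\<close> lies opposite to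
  both; seen from \<open>w\<close> this label is separated from one of \<open>x\<close>,
  \<open>y\<close>.\<close>

lemma adj_closed:
  assumes "L.below v v'" "R.below w' w" "adj v w" "adj v' w'"
  shows "adj v' w"
proof -
  obtain x y where 1: "L.splits v x y" "R.splits w x y" using assms(3) by (auto simp: adj_def)
  obtain x' y' where 2: "L.splits v' x' y'" "R.splits w' x' y'" using assms(4) by (auto simp: adj_def)
  have e: "d w x' = d w y'" "x' \<in> D w" "y' \<in> D w" "x \<in> C v'" "y \<in> C v'"
    using R.below_const[OF assms(2)] R.below_subset[OF assms(2)] L.below_subset[OF assms(1)] 1 2
    unfolding splits_defs by blast+
  show ?thesis using 1 2 e unfolding adj_def splits_defs by metis
qed

end

lemma tangle_swap:
  assumes "tangle V C c W D d M"
  shows "tangle W D d V C c M"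
proof -
  interpret tangle V C c W D d M by fact
  show ?thesis by unfold_locales (use no_K1 in blast)
qed

context tangle
begin

text \<open>The arguments ascend within each tree: lower and upper vertex on the left, then lower
  and upper vertex on the right.\<close>

definition nested :: "'v \<Rightarrow> 'v \<Rightarrow> 'w \<Rightarrow> 'w \<Rightarrow> bool" where
  "nested v v' w' w \<longleftrightarrow> L.below v v' \<and> R.below w' w \<and> adj v w \<and> adj v w' \<and> adj v' w \<and> adj v' w'"

text \<open>The pair at the two lower vertices supplies the middle labels. The head of the left
  caterpillar is a label across \<open>v'\<close>, taken from the edge \<open>v' w'\<close>; the
  head of the right one is a label across \<open>w\<close>, taken from the edge
  \<open>v w\<close>.\<close>

lemma nested_negative:
  assumes "nested v v' w' w" "(sgn v w = sgn v w') \<noteq> (sgn v' w = sgn v' w')"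
  obtains z q p u where "L.splits v' z q" "L.splits v' z p" "L.splits v' z u" "L.splits v q p" "L.splits v q u"
    "R.splits w u q" "R.splits w u p" "R.splits w u z" "R.splits w' q p" "R.splits w' q z"
proof -
  have b: "L.below v v'" "R.below w' w" using assms(1) by (auto simp: nested_def)
  obtain p q where pq: "L.splits v p q" "R.splits w' p q" using assms(1) by (auto simp: nested_def adj_def)
  obtain z where z: "z \<in> C v'" "z \<in> D w'" "c v' z \<noteq> c v' p"
  proof -
    obtain x y where "L.splits v' x y" "R.splits w' x y" using assms(1) by (auto simp: nested_def adj_def)
    then show thesis using that[of x] that[of y] unfolding splits_defs by blast
  qed
  obtain u where u: "u \<in> C v" "u \<in> D w" "d w u \<noteq> d w p"
  proof -
    obtain x y where "L.splits v x y" "R.splits w x y" using assms(1) by (auto simp: nested_def adj_def)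
    then show thesis using that[of x] that[of y] unfolding splits_defs by blast
  qed
  have vs: "v \<in> V" "v' \<in> V" "w \<in> W" "w' \<in> W" "p \<in> C v" "q \<in> C v" "p \<in> D w'" "q \<in> D w'"
    "c v p \<noteq> c v q" "d w' p \<noteq> d w' q"
    using b pq unfolding L.below_def R.below_def splits_defs by blast+
  have ins: "p \<in> C v'" "q \<in> C v'" "u \<in> C v'" "c v' p = c v' q" "c v' u = c v' p"
    "p \<in> D w" "q \<in> D w" "z \<in> D w" "d w p = d w q" "d w z = d w p"
    using L.below_subset[OF b(1)] R.below_subset[OF b(2)] L.below_const[OF b(1)] R.below_const[OF b(2)] vs z u
    by blast+
  note f = vs ins z u
  have "sgn v' w = (c v' z = d w z)" using sgn_eq[of v' z u w] f unfolding splits_defs by auto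
  moreover have "sgn v w' = (c v p = d w' p)" using sgn_eq pq by blast
  moreover have "sgn v' w' = (c v' z = d w' z)"
    using sgn_eq[of v' z p w'] sgn_eq[of v' z q w'] f unfolding splits_defs by (cases "d w' z = d w' p") auto
  moreover have "sgn v w = (c v u = d w u)"
    using sgn_eq[of v u p w] sgn_eq[of v u q w] f unfolding splits_defs by (cases "c v u = c v p") auto
  \<comment> \<open>Written out in sides, a negative product of the four signs means that
    \<open>u\<close> at \<open>v\<close> and \<open>z\<close> at \<open>w'\<close> fall on the side
    of the same member of the pair \<open>p\<close>, \<open>q\<close>. The other member then
    branches off second in both trees.\<close>
  ultimately have "(c v u = c v p) = (d w' z = d w' p)" using assms(2) f by auto
  then consider "c v u = c v p" "d w' z = d w' p" | "c v u = c v q" "d w' z = d w' q" using f by blast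
  then show thesis
  proof cases
    case 1
    show thesis by (rule that[of z q p u]) (use f 1 in \<open>simp_all add: splits_defs\<close>)
  next
    case 2
    show thesis by (rule that[of z p q u]) (use f 2 in \<open>simp_all add: splits_defs\<close>)
  qed
qed

end


section \<open>A single copy of K2 and an edge whose sign can be changed\<close>

locale unique_K2 = tangle V C c W D d M
  for V :: "'v set" and C and c and W :: "'w set" and D and d and M :: "'m set" +
  fixes a1 a2 a3 a4 v1 v2 w1 w2
  assumes v1: "L.splits v1 a1 a2" "L.splits v1 a1 a3" "L.splits v1 a1 a4"
    and v2: "L.splits v2 a2 a3" "L.splits v2 a2 a4"
    and w1: "R.splits w1 a4 a1" "R.splits w1 a4 a2" "R.splits w1 a4 a3"
    and w2: "R.splits w2 a2 a3" "R.splits w2 a2 a1"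
    and unique: "L.caterpillar p q r s \<Longrightarrow> R.caterpillar s q r p \<Longrightarrow> {p, q, r, s} = {a1, a2, a3, a4}"

text \<open>The label \<open>ai\<close> sits at the leaf \<open>li\<close> of \<open>K2\<close>.
  Exchanging the trees exchanges \<open>a1\<close> with \<open>a4\<close> and leaves
  \<open>a2\<close>, \<open>a3\<close> in place, because the matching of \<open>K2\<close> is
  symmetric.\<close>

lemma unique_K2_swap:
  assumes "unique_K2 V C c W D d M a1 a2 a3 a4 v1 v2 w1 w2"
  shows "unique_K2 W D d V C c M a4 a2 a3 a1 w1 w2 v1 v2"
proof -
  interpret unique_K2 V C c W D d M a1 a2 a3 a4 v1 v2 w1 w2 by fact
  interpret S: tangle W D d V C c M by (rule tangle_swap) unfold_locales
  have "{p, q, r, s} = {a4, a2, a3, a1}" if "R.caterpillar p q r s" "L.caterpillar s q r p" for p q r s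
    using unique[OF that(2,1)] by auto
  then show ?thesis
    using v1 v2 w1 w2 L.splits_sym R.splits_sym by unfold_locales blast+
qed

context unique_K2
begin

text \<open>Uniqueness determines only the set of labels. The shape does the rest: the heads of the
  two caterpillars are \<open>a1\<close> and \<open>a4\<close>, and \<open>a2\<close>,
  \<open>a3\<close> cannot trade places, since \<open>v2\<close> separates \<open>a2\<close> but not
  \<open>a3\<close> from \<open>a4\<close>.\<close>

lemma unique_nodes:
  assumes u: "L.splits u p q" "L.splits u p r" "L.splits u p s" and v: "L.splits v q r" "L.splits v q s"
    and x: "R.splits x s q" "R.splits x s r" "R.splits x s p" and y: "R.splits y q r" "R.splits y q p"
  shows "p = a1 \<and> q = a2 \<and> r = a3 \<and> s = a4 \<and> u = v1 \<and> v = v2 \<and> x = w1 \<and> y = w2"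
proof -
  have X: "{p, q, r, s} = {a1, a2, a3, a4}"
    using unique[of p q r s] u v x y unfolding L.caterpillar_def R.caterpillar_def by blast
  have dist: "distinct [a1, a2, a3, a4]"
    using v1 v2 w1 w2 by (auto dest: L.splitsD R.splitsD)
  have distp: "distinct [p, q, r, s]"
    using u v x y by (auto dest: L.splitsD R.splitsD)
  have mem: "a1 \<in> {p, q, r, s}" "a2 \<in> {p, q, r, s}" "a3 \<in> {p, q, r, s}" "a4 \<in> {p, q, r, s}"
    by (simp_all add: X)
  have mem': "p \<in> {a1, a2, a3, a4}" "q \<in> {a1, a2, a3, a4}" "r \<in> {a1, a2, a3, a4}" "s \<in> {a1, a2, a3, a4}"
    by (simp_all add: X[symmetric])
  have p: "p = a1" by (rule L.caterpillar_head[OF u v1 X distp])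
  have s: "s = a4"
    by (rule R.caterpillar_head[OF x w1(2,3,1)]) (use X distp in auto)
  have q: "q = a2"
  proof (rule ccontr)
    assume "q \<noteq> a2"
    then have "q = a3" "r = a2" using mem mem' p s dist distp by auto
    then have "v = v2" using v(1) v2(1) L.splits_sym L.splits_unique by metis
    then show False using v v2 \<open>q = a3\<close> \<open>r = a2\<close> \<open>s = a4\<close> unfolding L.splits_def by blast
  qed
  have r: "r = a3" using mem mem' p s q dist distp by auto
  have "u = v1" "v = v2" using u(1) v(1) v1(1) v2(1) L.splits_unique p q r by blast+
  moreover have "x = w1" "y = w2" using x(1) y(1) w1(2) w2(1) R.splits_unique s q r by blast+
  ultimately show ?thesis using p q r s by blast
qed

lemma nested_positive:
  assumes "nested v v' w' w" "\<not> (v = v2 \<and> v' = v1 \<and> w' = w2 \<and> w = w1)"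
  shows "(sgn v w = sgn v w') = (sgn v' w = sgn v' w')"
proof (rule ccontr)
  assume neg: "\<not> ?thesis"
  show False
  proof (rule nested_negative[OF assms(1)])
    show "(sgn v w = sgn v w') \<noteq> (sgn v' w = sgn v' w')" using neg .
  next
    fix z q p u
    assume "L.splits v' z q" "L.splits v' z p" "L.splits v' z u" "L.splits v q p" "L.splits v q u"
      "R.splits w u q" "R.splits w u p" "R.splits w u z" "R.splits w' q p" "R.splits w' q z"
    then show False using unique_nodes[of v' z q p u v w w'] assms(2) by blast
  qed
qed

lemma below_21: "L.below v2 v1"
proof -
  have o: "v2 = v1 \<or> L.below v2 v1 \<or> L.below v1 v2"
    using L.overlap[of v2 v1 a2] v1 v2 unfolding L.splits_def by blast
  have "c v1 a2 = c v1 a3" "c v2 a2 \<noteq> c v2 a3" using v1 v2 unfolding L.splits_def by blast+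
  moreover have "c v2 a2 = c v2 a3" if "L.below v1 v2"
    using L.below_const[OF that] v1 unfolding L.splits_def by blast
  ultimately show ?thesis using o by blast
qed

lemma below_R21: "R.below w2 w1"
proof -
  have o: "w2 = w1 \<or> R.below w2 w1 \<or> R.below w1 w2"
    using R.overlap[of w2 w1 a2] w1 w2 unfolding R.splits_def by blast
  have "d w1 a2 = d w1 a3" "d w2 a2 \<noteq> d w2 a3" using w1 w2 unfolding R.splits_def by blast+
  moreover have "d w2 a2 = d w2 a3" if "R.below w1 w2"
    using R.below_const[OF that] w1 unfolding R.splits_def by blast
  ultimately show ?thesis using o by blast
qed

lemma adj_Q: "adj v1 w1" "adj v1 w2" "adj v2 w1" "adj v2 w2"
proof -
  show "adj v1 w1" using adjI[of v1 a1 a4 w1] v1(3) w1(1) R.splits_sym by blast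
  show "adj v1 w2" using adjI[of v1 a1 a2 w2] v1(1) w2(2) R.splits_sym by blast
  show "adj v2 w1" using adjI[of v2 a2 a4 w1] v2(2) w1(2) R.splits_sym by blast
  show "adj v2 w2" using adjI[of v2 a2 a3 w2] v2(1) w2(1) by blast
qed

lemma in_clusters: "a1 \<in> C v1" "a2 \<in> C v1" "a3 \<in> C v1" "a4 \<in> C v1" "a2 \<in> C v2" "a3 \<in> C v2" "a4 \<in> C v2"
  "a1 \<in> D w1" "a2 \<in> D w1" "a3 \<in> D w1" "a4 \<in> D w1" "a1 \<in> D w2" "a2 \<in> D w2" "a3 \<in> D w2"
  "v1 \<in> V" "v2 \<in> V" "w1 \<in> W" "w2 \<in> W"
  "c v1 a2 \<longleftrightarrow> \<not> c v1 a1" "c v1 a3 \<longleftrightarrow> \<not> c v1 a1" "c v1 a4 \<longleftrightarrow> \<not> c v1 a1"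
  "c v2 a3 \<longleftrightarrow> \<not> c v2 a2" "c v2 a4 \<longleftrightarrow> \<not> c v2 a2"
  "d w1 a1 \<longleftrightarrow> \<not> d w1 a4" "d w1 a2 \<longleftrightarrow> \<not> d w1 a4" "d w1 a3 \<longleftrightarrow> \<not> d w1 a4"
  "d w2 a1 \<longleftrightarrow> \<not> d w2 a2" "d w2 a3 \<longleftrightarrow> \<not> d w2 a2"
  using v1 v2 w1 w2 unfolding splits_defs by blast+

lemma Q_negative: "(sgn v2 w1 = sgn v2 w2) \<noteq> (sgn v1 w1 = sgn v1 w2)"
proof -
  have "sgn v2 w1 = (c v2 a2 = d w1 a2)" using sgn_eq[of v2 a2 a4 w1] v2 w1 R.splits_sym by blast
  moreover have "sgn v2 w2 = (c v2 a2 = d w2 a2)" using sgn_eq[of v2 a2 a3 w2] v2 w2 by blast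
  moreover have "sgn v1 w1 = (c v1 a1 = d w1 a1)" using sgn_eq[of v1 a1 a4 w1] v1 w1 R.splits_sym by blast
  moreover have "sgn v1 w2 = (c v1 a1 = d w2 a1)" using sgn_eq[of v1 a1 a2 w2] v1 w2 R.splits_sym by blast
  ultimately show ?thesis using in_clusters by auto
qed

lemma positiveI:
  assumes "L.below v v'" "R.below w' w" "adj v w" "adj v w'" "adj v' w'"
    "\<not> (v = v2 \<and> v' = v1 \<and> w' = w2 \<and> w = w1)"
  shows "adj v' w \<and> (sgn v w = sgn v w') = (sgn v' w = sgn v' w')"
proof -
  have "nested v v' w' w" using assms adj_closed by (auto simp: nested_def)
  then show ?thesis using nested_positive assms(6) by (auto simp: nested_def)
qed

text \<open>A second neighbour \<open>u\<close> of \<open>w2\<close> above \<open>v2\<close> is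
  comparable with \<open>v1\<close>. The nested cycles over \<open>w2\<close>, \<open>w1\<close> on
  \<open>v2\<close>, \<open>u\<close> and on \<open>u\<close>, \<open>v1\<close> are both positive,
  so the one on \<open>v2\<close>, \<open>v1\<close> would be positive too, against
  \<open>Q_negative\<close>.\<close>

lemma above_v2:
  assumes "adj u w2" "L.below v2 u"
  shows "u = v1"
proof (rule ccontr)
  assume n: "u \<noteq> v1"
  have u1: "adj u w1" "(sgn v2 w1 = sgn v2 w2) = (sgn u w1 = sgn u w2)"
    using positiveI[OF assms(2) below_R21 adj_Q(3,4) assms(1)] n by auto
  have swap: "tangle W D d V C c M" by (rule tangle_swap) unfold_locales
  interpret S: tangle W D d V C c M by (rule swap)
  have "L.below u v1 \<or> L.below v1 u"
  proof -
    have "S.adj w2 u" "S.adj w2 v1" using assms(1) adj_Q(2) unfolding adj_def S.adj_def by blast+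
    then show ?thesis using S.nbrs_chain n by blast
  qed
  then have "(sgn u w1 = sgn u w2) = (sgn v1 w1 = sgn v1 w2)"
  proof
    assume "L.below u v1"
    then show ?thesis using positiveI[of u v1 w2 w1] u1 below_R21 adj_Q assms L.below_def by blast
  next
    assume "L.below v1 u"
    then show ?thesis using positiveI[of v1 u w2 w1] u1 below_R21 adj_Q assms
      using L.below_def below_21 by blast
  qed
  then show False using Q_negative u1 by blast
qed

lemma sgn_swap:
  assumes "tangle W D d V C c M"
  shows "tangle.adj W D d V C c w v = adj v w" "tangle.sgn W D d V C c w v = sgn v w"
  unfolding tangle.adj_def[OF assms] tangle.sgn_def[OF assms] adj_def sgn_def by blast+

end

context unique_K2
begin

lemma swapped: "unique_K2 W D d V C c M a4 a2 a3 a1 w1 w2 v1 v2"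
  by (rule unique_K2_swap) unfold_locales

lemma tangle_swapped: "tangle W D d V C c M"
  by (rule tangle_swap) unfold_locales

lemma nbrs_chain_R: "adj v w \<Longrightarrow> adj v' w \<Longrightarrow> v = v' \<or> L.below v v' \<or> L.below v' v"
  using tangle.nbrs_chain[OF tangle_swapped] sgn_swap[OF tangle_swapped] by simp

lemma above_w2: "adj v2 w \<Longrightarrow> R.below w2 w \<Longrightarrow> w = w1"
  using unique_K2.above_v2[OF swapped] sgn_swap[OF tangle_swapped] by simp

lemma below_v2: "x \<in> C v2 \<Longrightarrow> x \<in> C v1 \<and> c v1 x = (\<not> c v1 a1)"
  using L.below_subset[OF below_21] L.below_const[OF below_21, of x a2] in_clusters by blast

lemma below_w2: "x \<in> D w2 \<Longrightarrow> x \<in> D w1 \<and> d w1 x = (\<not> d w1 a4)"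
  using R.below_subset[OF below_R21] R.below_const[OF below_R21, of x a2] in_clusters by blast

text \<open>
  If replacing one of the four labels by \<open>x\<close> leaves the pattern intact, then \<open>x\<close> is that label.
\<close>

lemma label_2:
  assumes "x \<in> C v2" "x \<in> D w2" "c v2 x = c v2 a2" "d w2 x = d w2 a2"
  shows "x = a2"
proof -
  note f = assms below_v2[OF assms(1)] below_w2[OF assms(2)] in_clusters
  have "L.splits v1 a1 x" "L.splits v2 x a3" "L.splits v2 x a4" "R.splits w1 a4 x" "R.splits w2 x a3" "R.splits w2 x a1"
    using f by (simp_all add: splits_defs)
  then show ?thesis using unique_nodes[of v1 a1 x a3 a4 v2 w1 w2] v1 w1 by blast
qed

lemma label_3:
  assumes "x \<in> C v2" "x \<in> D w2" "c v2 x \<noteq> c v2 a2" "d w2 x \<noteq> d w2 a2"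
  shows "x = a3"
proof -
  note f = assms below_v2[OF assms(1)] below_w2[OF assms(2)] in_clusters
  have "L.splits v1 a1 x" "L.splits v2 a2 x" "R.splits w1 a4 x" "R.splits w2 a2 x"
    using f by (simp_all add: splits_defs)
  then show ?thesis using unique_nodes[of v1 a1 a2 x a4 v2 w1 w2] v1 v2 w1 w2 by blast
qed

lemma label_1:
  assumes "x \<in> C v1" "x \<in> D w2" "c v1 x = c v1 a1" "d w2 x \<noteq> d w2 a2"
  shows "x = a1"
proof -
  note f = assms below_w2[OF assms(2)] in_clusters
  have "L.splits v1 x a2" "L.splits v1 x a3" "L.splits v1 x a4" "R.splits w1 a4 x" "R.splits w2 a2 x"
    using f by (simp_all add: splits_defs)
  then show ?thesis using unique_nodes[of v1 x a2 a3 a4 v2 w1 w2] v2 w1 w2 by blast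
qed

text \<open>
  An edge of multiplicity one that lies on no nested 4-cycle except possibly the negative one.
  Changing its sign makes all nested 4-cycles positive.
\<close>

definition lone :: "'v \<Rightarrow> 'w \<Rightarrow> bool" where
  "lone v w \<longleftrightarrow> (\<exists>x y. \<forall>x' y'. L.splits v x' y' \<longrightarrow> R.splits w x' y' \<longrightarrow> {x', y'} = {x, y}) \<and>
     (\<forall>u u' x' x. nested u u' x' x \<longrightarrow> v \<in> {u, u'} \<longrightarrow> w \<in> {x, x'} \<longrightarrow>
        u = v2 \<and> u' = v1 \<and> x' = w2 \<and> x = w1)"

lemma lone_nested:
  assumes "lone v w" "nested u u' x' x" "v \<in> {u, u'}" "w \<in> {x, x'}"
  shows "u = v2 \<and> u' = v1 \<and> x' = w2 \<and> x = w1"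
  using conjunct2[OF assms(1)[unfolded lone_def], rule_format, OF assms(2-4)] .

text \<open>After the change of one sign a potential exists. Its values, used as the sides drawn
  first, give two leaf orders that agree on every pair except those on the changed edge, and that
  edge carries only one pair.\<close>

lemma one_disagreement:
  assumes e: "lone v w" "v \<in> {v1, v2}" "w \<in> {w1, w2}"
  shows "\<exists>f g x y. \<forall>x'\<in>M. \<forall>y'\<in>M. x' \<noteq> y' \<longrightarrow> {x', y'} \<noteq> {x, y} \<longrightarrow> L.lt f x' y' = R.lt g x' y'"
proof -
  define \<sigma> where "\<sigma> = (\<lambda>a b. sgn a b \<noteq> (a = v \<and> b = w))"
  have "\<exists>(f :: 'v \<Rightarrow> bool) g. \<forall>a \<in> V. \<forall>b. adj a b \<longrightarrow> \<sigma> a b = (f a = g b)"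
  proof (rule potential_exists[where la = L.below and lb = R.below and \<mu> = "\<lambda>v. card (C v)"])
    show "finite V" by (rule L.finite_V)
    show "b = b' \<or> R.below b b' \<or> R.below b' b" if "a \<in> V" "adj a b" "adj a b'" for a b b'
      using that nbrs_chain by blast
    show "a = a' \<or> L.below a a' \<or> L.below a' a" if "a \<in> V" "a' \<in> V" "adj a b" "adj a' b" for a a' b
      using that nbrs_chain_R by blast
    show "card (C a) < card (C a')" if "a \<in> V" "a' \<in> V" "L.below a a'" for a a'
      using that L.below_card by blast
    show "adj a' b" if "a \<in> V" "a' \<in> V" "L.below a a'" "R.below b' b" "adj a b" "adj a b'" "adj a' b'" for a a' b b'
      using that adj_closed by blast
    fix a a' b b'
    assume "L.below a a'" "R.below b' b" "adj a b" "adj a b'" "adj a' b'" "adj a' b"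
    then have n: "nested a a' b' b" by (auto simp: nested_def)
    show "(\<sigma> a b = \<sigma> a b') = (\<sigma> a' b = \<sigma> a' b')"
    proof (cases "a = v2 \<and> a' = v1 \<and> b' = w2 \<and> b = w1")
      case True
      \<comment> \<open>The changed edge is exactly one of the four edges of the negative cycle,
        which therefore becomes positive.\<close>
      have "v1 \<noteq> v2" "w1 \<noteq> w2" using below_21 below_R21 unfolding L.below_def R.below_def by auto
      moreover have "v = v1 \<or> v = v2" "w = w1 \<or> w = w2" using e(2,3) by blast+
      ultimately show ?thesis using True Q_negative unfolding \<sigma>_def by (elim disjE; simp; blast)
    next
      case False
      have "v \<in> {a, a'} \<Longrightarrow> w \<in> {b, b'} \<Longrightarrow> a = v2 \<and> a' = v1 \<and> b' = w2 \<and> b = w1"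
        using lone_nested[OF e(1) n] .
      then have "\<not> (a = v \<and> b = w)" "\<not> (a = v \<and> b' = w)" "\<not> (a' = v \<and> b = w)" "\<not> (a' = v \<and> b' = w)"
        using False by auto
      then have "\<sigma> a b = sgn a b" "\<sigma> a b' = sgn a b'" "\<sigma> a' b = sgn a' b" "\<sigma> a' b' = sgn a' b'"
        unfolding \<sigma>_def by simp_all
      then show ?thesis using nested_positive[OF n False] by simp
    qed
  qed
  then obtain f :: "'v \<Rightarrow> bool" and g where fg: "\<And>a b. a \<in> V \<Longrightarrow> adj a b \<Longrightarrow> \<sigma> a b = (f a = g b)" by blast
  obtain x y where xy: "\<And>x' y'. L.splits v x' y' \<Longrightarrow> R.splits w x' y' \<Longrightarrow> {x', y'} = {x, y}"
    using conjunct1[OF e(1)[unfolded lone_def]] by (elim exE) (rule that, blast)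
  have "L.lt f x' y' = R.lt g x' y'" if M: "x' \<in> M" "y' \<in> M" "x' \<noteq> y'" and ne: "{x', y'} \<noteq> {x, y}" for x' y'
  proof -
    obtain a b where a: "L.splits a x' y'" and b: "R.splits b x' y'"
      using L.splits_exists R.splits_exists M by meson
    have "\<not> (a = v \<and> b = w)" using xy a b ne by blast
    then have "(c a x' = d b x') = (f a = g b)"
      using fg[of a b] adjI[OF a b] sgn_eq[OF a b] a L.splitsD unfolding \<sigma>_def by blast
    moreover have "L.lt f x' y' = (c a x' = f a)" using a L.splits_unique unfolding L.lt_def by blast
    moreover have "R.lt g x' y' = (d b x' = g b)" using b R.splits_unique unfolding R.lt_def by blast
    ultimately show ?thesis by blast
  qed
  then show ?thesis by blast
qed

text \<open>The cycles on \<open>v2\<close>, \<open>v1\<close> over \<open>w'\<close>,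
  \<open>w2\<close> and over \<open>w'\<close>, \<open>w1\<close> would both be positive. Their
  product is the negative cycle over \<open>w2\<close>, \<open>w1\<close>.\<close>

lemma Q_contradiction:
  assumes "R.below w' w2" "adj v2 w'" "adj v1 w'"
  shows False
proof -
  have "R.below w' w1" using assms(1) below_R21 R.below_trans by blast
  then show False
    using positiveI[OF below_21 assms(1) adj_Q(4) assms(2,3)] positiveI[OF below_21 _ adj_Q(3) assms(2,3), of ]
      Q_negative assms below_R21 R.below_antisym R.below_def by (metis (full_types))
qed

text \<open>Coherent signs and the label lemmas leave only the pair \<open>a2\<close>,
  \<open>a3\<close>. On a nested cycle the edge joins two lower vertices, which forces the known
  cycle by \<open>above_v2\<close> and \<open>above_w2\<close>; or a lower and an upper one, which
  \<open>Q_contradiction\<close> or its mirror image excludes; or two upper ones, which the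
  hypothesis excludes.\<close>

lemma lone_23:
  assumes "\<And>v w. L.below v v2 \<Longrightarrow> R.below w w2 \<Longrightarrow> adj v w2 \<Longrightarrow> adj v2 w \<Longrightarrow> \<not> adj v w"
  shows "lone v2 w2"
  unfolding lone_def
proof (intro conjI exI allI impI)
  fix x y assume xy: "L.splits v2 x y" "R.splits w2 x y"
  have coh: "(c v2 x = d w2 x) = (c v2 a2 = d w2 a2)" using sgn_coherent[OF xy v2(1) w2(1)] .
  show "{x, y} = {a2, a3}"
  proof (cases "c v2 x = c v2 a2")
    case True
    then have "x = a2" "y = a3" using xy coh label_2[of x] label_3[of y] unfolding splits_defs by auto
    then show ?thesis by simp
  next
    case False
    then have "y = a2" "x = a3" using xy coh label_2[of y] label_3[of x] unfolding splits_defs by auto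
    then show ?thesis by auto
  qed
next
  fix u u' x' x
  assume n: "nested u u' x' x" and v: "v2 \<in> {u, u'}" and w: "w2 \<in> {x, x'}"
  have b: "L.below u u'" "R.below x' x" "adj u x" "adj u x'" "adj u' x" "adj u' x'"
    using n by (auto simp: nested_def)
  have "u = v2 \<and> u' = v1 \<and> x' = w2 \<and> x = w1"
  proof -
    consider "u = v2" "x' = w2" | "u = v2" "x = w2" | "u' = v2" "x' = w2" | "u' = v2" "x = w2"
      using v w by blast
    then show ?thesis
    proof cases
      case 1
      then show ?thesis using b above_v2 above_w2 by blast
    next
      case 2
      then show ?thesis using b above_v2[of u'] Q_contradiction[of x'] by blast
    next
      case 3
      have "x = w1" using above_w2[of x] b 3 by blast
      then show ?thesis using unique_K2.Q_contradiction[OF swapped, of u] sgn_swap[OF tangle_swapped] b 3 by simp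
    next
      case 4
      then show ?thesis using assms[of u x'] b by blast
    qed
  qed
  then show "u = v2" "u' = v1" "x' = w2" "x = w1" by blast+
qed

text \<open>Extends \<open>label_2\<close> from the labels below \<open>v2\<close> to all labels
  across \<open>v1\<close> from \<open>a1\<close>. Below \<open>v2\<close>, a \<open>y\<close> on
  the wrong side would form with \<open>x0\<close> a pair of the wrong sign. Outside
  \<open>C v2\<close>, the lowest common ancestor of \<open>y\<close> and \<open>a3\<close> lies
  above \<open>v2\<close> and takes its place in a copy with labels \<open>a1\<close>,
  \<open>y\<close>, \<open>a3\<close>, \<open>a4\<close>.\<close>

lemma label_2_up:
  assumes x0: "x0 \<in> C v2" "x0 \<in> D w2" "c v2 x0 = c v2 a2" "d w2 x0 \<noteq> d w2 a2"
    and y: "y \<in> C v1" "y \<in> D w2" "c v1 y \<noteq> c v1 a1" "d w2 y = d w2 a2"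
  shows "y = a2"
proof (cases "y \<in> C v2")
  case True
  have False if "c v2 y \<noteq> c v2 a2"
    using sgn_coherent[of v2 y x0 w2 a2 a3] that True x0 y v2(1) w2(1) in_clusters
    unfolding splits_defs by blast
  then show ?thesis using label_2[of y] True y by blast
next
  case False
  then have "y \<noteq> a3" using in_clusters by blast
  then obtain u where u: "L.splits u y a3" using L.splits_exists y(1) in_clusters L.C_subset by (meson subsetD)
  have "L.below v2 u" using L.splits_outside[of u a3 y v2] u False in_clusters L.splits_sym by blast
  then have "L.splits u y a4" using u L.below_const[of v2 u a3 a4] L.below_subset[of v2 u a4] in_clusters
    unfolding L.splits_def by blast
  moreover have "L.splits v1 a1 y" "R.splits w1 a4 y" "R.splits w2 y a3" "R.splits w2 y a1"
    using y below_w2[OF y(2)] in_clusters by (simp_all add: splits_defs)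
  ultimately show ?thesis using unique_nodes[of v1 a1 y a3 a4 u w1 w2] u v1 w1 by blast
qed

text \<open>
  The case in which the pair \<open>a2, a3\<close> does not work: \<open>v0\<close> and \<open>w0\<close> are the lower vertices of a
  further nested 4-cycle through \<open>v2\<close> and \<open>w2\<close>.  A second such obstruction at \<open>v1\<close> and \<open>w2\<close> would
  produce, together with this one, another negative nested 4-cycle through the vertex \<open>w3\<close> that
  separates \<open>a1\<close> from \<open>a3\<close>.
\<close>

lemma lone_12:
  assumes b0: "L.below v0 v2" "R.below w0 w2" "adj v0 w0" "adj v0 w2" "adj v2 w0"
    and x0: "x0 \<in> C v0" "x0 \<in> D w0" "c v2 x0 = c v2 a2"
  shows "lone v1 w2"
proof -
  note cl = in_clusters
  have v0: "\<And>x. x \<in> C v0 \<Longrightarrow> x \<in> C v2" "\<And>x. x \<in> C v0 \<Longrightarrow> c v2 x = c v2 a2"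
    using L.below_subset[OF b0(1)] L.below_const[OF b0(1) _ x0(1)] x0(3) by blast+
  obtain p0 q0 where pq0: "L.splits v0 p0 q0" "R.splits w0 p0 q0" using b0(3) by (auto simp: adj_def)
  \<comment> \<open>Otherwise every label common to \<open>v0\<close> and \<open>w0\<close> could
    replace \<open>a2\<close> and hence equals \<open>a2\<close>, but the edge \<open>v0 w0\<close>
    carries two different labels.\<close>
  have w2x: "d w2 x0 \<noteq> d w2 a2"
  proof
    assume *: "d w2 x0 = d w2 a2"
    then have "\<And>x. x \<in> C v0 \<Longrightarrow> x \<in> D w0 \<Longrightarrow> x = a2"
      using label_2 v0 R.below_subset[OF b0(2)] R.below_const[OF b0(2) _ x0(2)] by metis
    then show False using pq0 unfolding splits_defs by metis
  qed
  have w0: "\<And>x. x \<in> D w0 \<Longrightarrow> x \<in> D w2" "\<And>x. x \<in> D w0 \<Longrightarrow> d w2 x \<noteq> d w2 a2"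
    using R.below_subset[OF b0(2)] R.below_const[OF b0(2) _ x0(2)] w2x by blast+
  have x0in: "x0 \<in> C v2" "x0 \<in> D w2" using v0 w0 x0 by blast+
  have up: "y = a2" if "y \<in> C v1" "y \<in> D w2" "c v1 y \<noteq> c v1 a1" "d w2 y = d w2 a2" for y
    using label_2_up[OF x0in x0(3) w2x that] .
  \<comment> \<open>The edge \<open>v0 w2\<close> has a label on the side of \<open>a2\<close> at
    \<open>w2\<close>, and that label can only be \<open>a2\<close>. In the same way the edge
    \<open>v2 w0\<close> yields \<open>a3\<close> below \<open>w0\<close>.\<close>
  have in0: "a2 \<in> C v0"
  proof -
    obtain r where "r \<in> C v0" "r \<in> D w2" "d w2 r = d w2 a2"
      using b0(4) unfolding adj_def splits_defs by blast
    then show ?thesis using label_2 v0 by metis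
  qed
  have in0': "a3 \<in> D w0"
  proof -
    obtain r where "r \<in> D w0" "r \<in> C v2" "c v2 r \<noteq> c v2 a2"
      using b0(5) unfolding adj_def splits_defs by blast
    then show ?thesis using label_3 w0 by metis
  qed
  \<comment> \<open>With \<open>a1\<close> below \<open>w0\<close>, \<open>v1\<close> would become a
    common neighbour with \<open>v2\<close> of a vertex below \<open>w2\<close>.\<close>
  have not1: "a1 \<notin> D w0"
  proof
    assume "a1 \<in> D w0"
    then have "adj v1 w0"
      using pq0 cl L.below_subset[OF below_21] L.below_const[OF below_21, of _ a2] v0
      unfolding adj_def splits_defs by metis
    then show False using Q_contradiction b0 by blast
  qed
  obtain w3 where w3: "R.splits w3 a1 a3"
    using R.splits_exists[of a1 a3] cl R.C_subset by (metis subsetD)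
  have w3b: "R.below w3 w2"
  proof -
    have "R.below w2 w3 \<Longrightarrow> False"
      using R.below_const[of w2 w3 a1 a3] w3 cl unfolding R.splits_def by blast
    moreover have "w3 \<noteq> w2" using w3 cl unfolding R.splits_def by blast
    ultimately show ?thesis using R.overlap[of w2 w3 a1] w3 cl unfolding R.splits_def by blast
  qed
  have in_w3: "x \<in> D w3" if x: "x \<in> C v2" "x \<in> D w2" "c v2 x = c v2 a2" "d w2 x \<noteq> d w2 a2" for x
  proof (rule ccontr)
    assume n: "x \<notin> D w3"
    then have "x \<noteq> a1" using w3 unfolding R.splits_def by blast
    then obtain m where m: "R.splits m x a1" using R.splits_exists x(2) cl R.C_subset by (meson subsetD)
    have "R.below w3 m" using R.splits_outside[of m a1 x w3] m n w3 R.splits_sym unfolding R.splits_def by blast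
    then have "R.splits m x a3" using m w3 R.below_const[of w3 m a1 a3] R.below_subset[of w3 m a3]
      unfolding R.splits_def by blast
    moreover have "L.splits v1 a1 x" "L.splits v2 x a3" "L.splits v2 x a4" "R.splits w1 a4 x"
      using x below_v2[OF x(1)] below_w2[OF x(2)] cl by (simp_all add: splits_defs)
    ultimately have "x = a2"
      using unique_nodes[of v1 a1 x a3 a4 v2 w1 m] m v1 w1 by blast
    then show False using x by blast
  qed
  \<comment> \<open>\<open>w0\<close> contains \<open>a3\<close> but not \<open>a1\<close>, so it
    lies under the \<open>a3\<close> side of \<open>w3\<close>. Below, the second obstruction
    \<open>w'\<close> turns out to lie under the \<open>a1\<close> side.\<close>
  have w0b: "R.below w0 w3"
    using R.overlap[of w0 w3 a3] in0' w3 not1 R.below_subset[of w3 w0 a1] b0(2)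
    unfolding R.splits_def R.below_def by blast
  have side0: "d w3 x = d w3 a3" if "x \<in> D w0" for x using R.below_const[OF w0b that in0'] .

  \<comment> \<open>The second obstruction: \<open>v\<close> and \<open>w'\<close> are the lower
    vertices of a nested cycle with upper vertices \<open>v1\<close> and \<open>w2\<close>.\<close>
  have main: False if b: "L.below v v2" "R.below w' w2" "adj v w'" "adj v w2" "adj v1 w'" for v w'
  proof -
    obtain p q where pq: "L.splits v p q" "R.splits w' p q" using b(3) by (auto simp: adj_def)
    have in2: "a2 \<in> C v"
    proof -
      obtain r where r: "r \<in> C v" "r \<in> D w2" "d w2 r = d w2 a2"
        using b(4) unfolding adj_def splits_defs by blast
      have "r \<in> C v1" "c v1 r \<noteq> c v1 a1"
        using r L.below_subset[OF b(1)] L.below_subset[OF below_21] L.below_const[OF below_21, of r a2] cl by blast+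
      then show ?thesis using up r by metis
    qed
    have vv: "\<And>x. x \<in> C v \<Longrightarrow> x \<in> C v2" "\<And>x. x \<in> C v \<Longrightarrow> c v2 x = c v2 a2"
      using L.below_subset[OF b(1)] L.below_const[OF b(1) _ in2] by blast+
    have in1: "a1 \<in> D w'"
    proof -
      obtain r where r: "r \<in> D w'" "r \<in> C v1" "c v1 r = c v1 a1"
        using b(5) unfolding adj_def splits_defs by blast
      have "r \<in> D w2" using R.below_subset[OF b(2)] r by blast
      moreover have "d w2 r \<noteq> d w2 a2"
        using sgn_coherent[of v1 r a3 w2 a1 a2] r calculation cl unfolding splits_defs by blast
      ultimately show ?thesis using label_1 r by metis
    qed
    have ww: "\<And>x. x \<in> D w' \<Longrightarrow> x \<in> D w2" "\<And>x. x \<in> D w' \<Longrightarrow> d w2 x \<noteq> d w2 a2"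
      using R.below_subset[OF b(2)] R.below_const[OF b(2) _ in1] cl by blast+
    have not3: "a3 \<notin> D w'"
    proof
      assume "a3 \<in> D w'"
      then have "adj v2 w'"
        using pq vv cl unfolding adj_def splits_defs by metis
      then show False using Q_contradiction b by blast
    qed
    have w'b: "R.below w' w3"
      using R.overlap[of w' w3 a1] in1 w3 not3 R.below_subset[of w3 w' a3] b(2)
      unfolding R.splits_def R.below_def by blast
    have side': "d w3 x = d w3 a1" if "x \<in> D w'" for x using R.below_const[OF w'b that in1] .
    have w3s: "d w3 a1 \<noteq> d w3 a3" "a1 \<in> D w3" "a3 \<in> D w3" "w3 \<in> W" using w3 unfolding R.splits_def by blast+
    have inw3: "p \<in> D w3" "q \<in> D w3" "p0 \<in> D w3" "q0 \<in> D w3"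
      using R.below_subset[OF w'b] R.below_subset[OF w0b] pq pq0 unfolding R.splits_def by blast+
    have sp: "d w3 p = d w3 a1" "d w3 q = d w3 a1" "d w3 p0 = d w3 a3" "d w3 q0 = d w3 a3"
      using side' side0 pq pq0 unfolding R.splits_def by blast+
    have s2: "d w2 p \<noteq> d w2 a2" "d w2 q \<noteq> d w2 a2" "d w2 p0 \<noteq> d w2 a2" "d w2 q0 \<noteq> d w2 a2"
       "p \<in> D w2" "q \<in> D w2" "p0 \<in> D w2" "q0 \<in> D w2"
      using ww w0 pq pq0 unfolding R.splits_def by blast+
    have lv: "p \<in> C v" "q \<in> C v" "c v p \<noteq> c v q" "p0 \<in> C v0" "q0 \<in> C v0" "c v0 p0 \<noteq> c v0 q0"
      "v \<in> V" "v0 \<in> V"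
      using pq pq0 unfolding L.splits_def by blast+
    \<comment> \<open>Both \<open>v\<close> and \<open>v0\<close> contain \<open>a2\<close>, so they
      are comparable.\<close>
    consider "v = v0" | "L.below v0 v" | "L.below v v0"
      using L.overlap[of v v0 a2] in2 in0 lv by blast
    then show False
    proof cases
      case 1
      \<comment> \<open>At the common vertex \<open>v\<close>, each of \<open>p\<close>,
        \<open>q\<close> is opposite to one of \<open>p0\<close>, \<open>q0\<close>, and
        \<open>w3\<close> has \<open>p\<close>, \<open>q\<close> on one side and \<open>p0\<close>,
        \<open>q0\<close> on the other. The two mixed pairs on the edge \<open>v w3\<close> have
        opposite signs.\<close>
      have "(c v p = d w3 p) = (c v q = d w3 q)"
      proof -
        obtain r s where rs: "{r, s} = {p0, q0}" "c v p \<noteq> c v r" "c v q \<noteq> c v s" 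
          using lv 1 by (metis insert_commute)
        then have rs': "r \<in> {p0, q0}" "s \<in> {p0, q0}" by blast+
        have "L.splits v p r" "R.splits w3 p r" "L.splits v q s" "R.splits w3 q s"
          using rs rs' sp lv inw3 w3s 1 unfolding splits_defs by auto
        then show ?thesis using sgn_coherent by blast
      qed
      then show False using sp lv by auto
    next
      case 2
      \<comment> \<open>The cycle on \<open>v\<close>, \<open>v2\<close> over \<open>w3\<close>,
        \<open>w2\<close> is negative: the left sides cancel, the labels used at \<open>w2\<close>
        lie opposite to \<open>a2\<close>, and at \<open>w3\<close> one of them lies with
        \<open>a1\<close> and the other with \<open>a3\<close>. Its upper right vertex is not
        \<open>w1\<close>, so it is not the known cycle.\<close>
      obtain y where y: "y \<in> {p, q}" "c v y \<noteq> c v a2" using lv by auto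
      have y': "y \<in> C v" "d w3 y = d w3 a1" "y \<in> D w3" "y \<in> D w2" "d w2 y \<noteq> d w2 a2"
        using y lv sp inw3 s2 by auto
      have "p0 \<in> C v" "c v p0 = c v a2"
        using L.below_subset[OF 2] L.below_const[OF 2] lv in0 by blast+
      then have e1: "L.splits v y p0" "R.splits w3 y p0" "L.splits v y a2" "R.splits w2 y a2"
        using y y' lv inw3 sp w3s in2 cl s2 unfolding splits_defs by auto
      have e2: "L.splits v2 a3 p" "R.splits w3 a3 p"
        using vv lv sp inw3 w3s cl unfolding splits_defs by auto
      have e3: "L.splits v2 a3 a2" "R.splits w2 a3 a2" using v2 w2 L.splits_sym R.splits_sym by blast+
      have "(sgn v w2 = sgn v w3) = (sgn v2 w2 = sgn v2 w3)"
        using positiveI[OF b(1) w3b] adjI e1 e2 b(4) below_R21 unfolding R.below_def by blast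
      moreover have "sgn v w3 = (c v y = d w3 y)" "sgn v w2 = (c v y = d w2 y)"
        "sgn v2 w3 = (c v2 a3 = d w3 a3)" "sgn v2 w2 = (c v2 a3 = d w2 a3)"
        using sgn_eq e1 e2 e3 by blast+
      ultimately show False using y' w3s cl by auto
    next
      case 3
      \<comment> \<open>The same computation for the cycle on \<open>v0\<close>, \<open>v1\<close>
        over \<open>w3\<close>, \<open>w2\<close>.\<close>
      obtain y where y: "y \<in> {p0, q0}" "c v0 y \<noteq> c v0 a2" using lv by auto
      have y': "y \<in> C v0" "d w3 y = d w3 a3" "y \<in> D w3" "y \<in> D w2" "d w2 y \<noteq> d w2 a2"
        using y lv sp inw3 s2 by auto
      have "p \<in> C v0" "c v0 p = c v0 a2"
        using L.below_subset[OF 3] L.below_const[OF 3] lv in2 by blast+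
      then have e1: "L.splits v0 y p" "R.splits w3 y p" "L.splits v0 y a2" "R.splits w2 y a2"
        using y y' lv inw3 sp w3s in0 cl s2 unfolding splits_defs by auto
      have e2: "L.splits v1 a1 a3" "R.splits w3 a1 a3" "L.splits v1 a1 a2" "R.splits w2 a1 a2"
        using v1 w3 w2 R.splits_sym by blast+
      have "L.below v0 v1" using b0(1) below_21 L.below_trans by blast
      then have "(sgn v0 w2 = sgn v0 w3) = (sgn v1 w2 = sgn v1 w3)"
        using positiveI[of v0 v1 w3 w2] w3b adjI e1 e2 b0(4) below_R21 unfolding R.below_def by blast
      moreover have "sgn v0 w3 = (c v0 y = d w3 y)" "sgn v0 w2 = (c v0 y = d w2 y)"
        "sgn v1 w3 = (c v1 a1 = d w3 a1)" "sgn v1 w2 = (c v1 a1 = d w2 a1)"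
        using sgn_eq e1 e2 by blast+
      ultimately show False using y' w3s cl by auto
    qed
  qed
  show ?thesis
    unfolding lone_def
  proof (intro conjI exI allI impI)
    fix x y assume xy: "L.splits v1 x y" "R.splits w2 x y"
    have coh: "(c v1 x = d w2 x) = (c v1 a1 = d w2 a1)"
      using sgn_coherent[OF xy, of a1 a2] v1(1) w2(2) R.splits_sym by blast
    show "{x, y} = {a1, a2}"
    proof (cases "c v1 x = c v1 a1")
      case True
      then have "x = a1" "y = a2"
        using xy coh label_1[of x] up[of y] cl unfolding splits_defs by auto
      then show ?thesis by simp
    next
      case False
      then have "y = a1" "x = a2"
        using xy coh label_1[of y] up[of x] cl unfolding splits_defs by auto
      then show ?thesis by auto
    qed
  next
    fix u u' x' x
    assume n: "nested u u' x' x" and v: "v1 \<in> {u, u'}" and w: "w2 \<in> {x, x'}"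
    have b: "L.below u u'" "R.below x' x" "adj u x" "adj u x'" "adj u' x" "adj u' x'"
      using n by (auto simp: nested_def)
    have "adj u' w2" "adj u w2" using b w by blast+
    \<comment> \<open>If \<open>v1\<close> were the lower vertex, the upper one would be a neighbour
      of \<open>w2\<close> above \<open>v2\<close>, hence again \<open>v1\<close>.\<close>
    have u': "u' = v1"
      using v above_v2[OF \<open>adj u' w2\<close>] b(1) L.below_trans[OF below_21] by blast
    have u: "u = v2 \<or> L.below u v2"
      using nbrs_chain_R[OF \<open>adj u w2\<close> adj_Q(4)] above_v2[OF \<open>adj u w2\<close>] b(1) u' unfolding L.below_def by blast
    have "u = v2 \<and> u' = v1 \<and> x' = w2 \<and> x = w1"
    proof (cases "x' = w2")
      case True
      show ?thesis
      proof (cases "u = v2")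
        case True
        then show ?thesis using b u' \<open>x' = w2\<close> above_w2 by blast
      next
        case False
        then have ub: "L.below u v2" using u by blast
        have xw: "x = w1" using above_w2[of x] adj_closed[OF ub b(2) b(3)] True b adj_Q by blast
        \<comment> \<open>With \<open>u\<close> strictly below \<open>v2\<close>, the cycles over
          \<open>w2\<close>, \<open>w1\<close> on \<open>u\<close>, \<open>v1\<close> and on
          \<open>u\<close>, \<open>v2\<close> are positive and compose to the negative one.\<close>
        have "(sgn u w1 = sgn u w2) = (sgn v1 w1 = sgn v1 w2)"
          using nested_positive[OF n] False u' xw True by blast
        moreover have "(sgn u w1 = sgn u w2) = (sgn v2 w1 = sgn v2 w2)"
          using positiveI[OF ub below_R21] b xw True adj_Q False by blast
        ultimately show ?thesis using Q_negative by blast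
      qed
    next
      case False
      then have xw: "x = w2" using w by blast
      show ?thesis
      proof (cases "u = v2")
        case True
        then show ?thesis using Q_contradiction[of x'] b xw u' by blast
      next
        case False
        then show ?thesis using main[of u x'] u b xw u' by blast
      qed
    qed
    then show "u = v2" "u' = v1" "x' = w2" "x = w1" by blast+
  qed
qed

text \<open>If nothing obstructs the edge \<open>v2 w2\<close>, it is lone. Otherwise the pair at
  the bottom of the obstruction lies on the side of \<open>a2\<close> at \<open>v2\<close>, and
  \<open>v1 w2\<close> is lone, or at \<open>w2\<close>, and the mirror image makes
  \<open>v2 w1\<close> lone.\<close>

theorem orders_exist:
  "\<exists>f g x y. \<forall>x'\<in>M. \<forall>y'\<in>M. x' \<noteq> y' \<longrightarrow> {x', y'} \<noteq> {x, y} \<longrightarrow> L.lt f x' y' = R.lt g x' y'"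
proof (cases "\<exists>v w. L.below v v2 \<and> R.below w w2 \<and> adj v w2 \<and> adj v2 w \<and> adj v w")
  case False
  then have "lone v2 w2" using lone_23 by blast
  then show ?thesis using one_disagreement by blast
next
  case True
  then obtain v w where b: "L.below v v2" "R.below w w2" "adj v w2" "adj v2 w" "adj v w" by blast
  obtain x y where xy: "L.splits v x y" "R.splits w x y" using b(5) by (auto simp: adj_def)
  show ?thesis
  proof (cases "c v2 x = c v2 a2")
    case True
    then have "lone v1 w2" using lone_12[of v w x] b xy unfolding splits_defs by blast
    then show ?thesis using one_disagreement by blast
  next
    case False
    interpret S: unique_K2 W D d V C c M a4 a2 a3 a1 w1 w2 v1 v2 by (rule swapped)
    \<comment> \<open>Off the side of \<open>a2\<close> in both trees, \<open>x\<close> and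
      \<open>y\<close> could each replace \<open>a3\<close>, so they would be equal.\<close>
    have "d w2 x = d w2 a2"
    proof (rule ccontr)
      assume n: "d w2 x \<noteq> d w2 a2"
      have "z = a3" if "z \<in> {x, y}" for z
        using label_3[of z] that xy n False b L.below_subset[OF b(1)] R.below_subset[OF b(2)]
          L.below_const[OF b(1), of x y] R.below_const[OF b(2), of x y]
        unfolding splits_defs by auto
      then show False using xy L.splitsD by blast
    qed
    then have "S.lone w1 v2" using S.lone_12[of w v x] b xy sgn_swap[OF tangle_swapped]
      unfolding splits_defs by simp
    then show ?thesis using S.one_disagreement by (metis insertCI)
  qed
qed

end

section \<open>Ancestors in rooted trees\<close>

lemma path_unique:
  assumes "acyclic_graph G" "path_between G u p v" "path_between G u q v"
  shows "p = q"
  using assms(2,3)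
proof (induction p arbitrary: u q)
  case Nil
  then show ?case by (simp add: path_between_def)
next
  case (Cons a p)
  obtain q' where q: "q = u # q'" using Cons.prems(2) by (cases q) (auto simp: path_between_def)
  have a: "a = u" using Cons.prems(1) by (simp add: path_between_def)
  show ?case
  proof (cases "p = [] \<or> q' = []")
    case True
    then have "u = v" using Cons.prems q a by (auto simp: path_between_def)
    then show ?thesis using Cons.prems q a last_in_set[of p] last_in_set[of q']
      by (auto simp: path_between_def split: if_splits)
  next
    case False
    define x where "x = hd p"
    define y where "y = hd q'"
    have p1: "path_between G x p v" and q1: "path_between G y q' v"
      and ex: "{u, x} \<in> edges G" and ey: "{u, y} \<in> edges G" and un: "u \<notin> set p" "u \<notin> set q'" "u \<in> verts G"
      using Cons.prems False q a unfolding path_between_def x_def y_def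
      by (auto simp: successively_Cons)
    show ?thesis
    proof (cases "x = y")
      case True
      then show ?thesis using Cons.IH[OF p1] q1 q a by simp
    next
      case False
      have "\<exists>z\<in>set p. z \<in> set q'"
        using p1 q1 unfolding path_between_def by (metis last_in_set)
      then obtain ps z ps' where ps: "p = ps @ z # ps'" "z \<in> set q'" "\<forall>s\<in>set ps. s \<notin> set q'"
        using split_list_first_prop[of p "\<lambda>z. z \<in> set q'"] by blast
      obtain qs qs' where qs: "q' = qs @ z # qs'" using ps(2) split_list by metis
      have hx: "x = hd (ps @ [z])" using p1 ps(1) by (cases ps) (auto simp: path_between_def)
      have hy: "y = hd (qs @ [z])" using q1 qs by (cases qs) (auto simp: path_between_def)
      \<comment> \<open>The two paths leave \<open>u\<close> along different edges; \<open>z\<close>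
        is the first vertex of \<open>p\<close> that lies on \<open>q'\<close>. Going along
        \<open>p\<close> to \<open>z\<close> and back along \<open>q'\<close> to \<open>y\<close>,
        the edge from \<open>y\<close> to \<open>u\<close> closes a cycle.\<close>
      define r where "r = u # ps @ z # rev qs"
      have "successively (\<lambda>x y. {x, y} \<in> edges G) (ps @ z # rev qs)"
      proof -
        have 1: "successively (\<lambda>x y. {x, y} \<in> edges G) (ps @ [z])"
          using p1 ps(1) by (auto simp: path_between_def successively_append_iff successively_Cons)
        have 2: "successively (\<lambda>x y. {x, y} \<in> edges G) (rev (qs @ [z]))"
          using q1 qs unfolding successively_rev
          by (auto simp: path_between_def successively_append_iff successively_Cons insert_commute)
        show ?thesis using 1 2 by (auto simp: successively_append_iff)
      qed
      moreover have "hd (ps @ z # rev qs) = x" using hx by (cases ps) auto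
      ultimately have s: "successively (\<lambda>x y. {x, y} \<in> edges G) r"
        unfolding r_def using ex by (auto simp: successively_Cons)
      have "last r = y" using hy unfolding r_def by (cases qs) auto
      moreover have "distinct r" "set r \<subseteq> verts G"
        using p1 q1 ps qs un unfolding r_def path_between_def by auto
      ultimately have "path_between G u r y" using s unfolding path_between_def r_def by auto
      moreover have "length r \<ge> 3"
        using False hx hy unfolding r_def by (cases ps; cases qs) auto
      moreover have "{y, u} \<in> edges G" using ey by (simp add: insert_commute)
      ultimately show ?thesis using assms(1) unfolding acyclic_graph_def by blast
    qed
  qed
qed

definition anc :: "'v rtree \<Rightarrow> 'v \<Rightarrow> 'v \<Rightarrow> bool" where
  "anc t u v \<longleftrightarrow> (\<exists>p. path_between t (root t) p v \<and> u \<in> set p)"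

lemma proper_ancestor_anc: "proper_ancestor t u v \<longleftrightarrow> u \<noteq> v \<and> anc t u v"
  by (simp add: proper_ancestor_def anc_def)

text \<open>Represents a vertex by its path from the root. The ancestor order becomes the prefix
  order of lists, so that comparability, meets and children reduce to facts about lists.\<close>

definition rpath :: "'v rtree \<Rightarrow> 'v \<Rightarrow> 'v list" where
  "rpath t v = (THE p. path_between t (root t) p v)"

definition children :: "'v rtree \<Rightarrow> 'v \<Rightarrow> 'v set" where
  "children t v = {c \<in> verts t. rpath t c = rpath t v @ [c]}"

definition inodes :: "'v rtree \<Rightarrow> 'v set" where
  "inodes t = verts t - {root t} - leaves t"

locale tree =
  fixes t :: "'v rtree"
  assumes rooted: "rooted_tree t"
begin

lemma basics: "simple_graph t" "connected_graph t" "acyclic_graph t" "root t \<in> verts t" "finite (verts t)"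
  "degree t (root t) = 1"
  using rooted by (auto simp: rooted_tree_def is_tree_def simple_graph_def)

lemma rpath: "v \<in> verts t \<Longrightarrow> path_between t (root t) (rpath t v) v"
proof -
  assume "v \<in> verts t"
  then obtain p where p: "path_between t (root t) p v" using basics unfolding connected_graph_def by blast
  show ?thesis unfolding rpath_def
    by (rule theI[where a = p]) (use p path_unique[OF basics(3)] in blast)+
qed

lemma path_in_verts: "path_between t u p v \<Longrightarrow> u \<in> verts t \<and> v \<in> verts t"
  unfolding path_between_def by (metis hd_in_set last_in_set subsetD)

lemma rpath_eqI: "path_between t (root t) p v \<Longrightarrow> rpath t v = p"
  using path_unique[OF basics(3)] rpath path_in_verts by blast

lemma rpath_facts:
  assumes "v \<in> verts t"
  shows "rpath t v \<noteq> []" "hd (rpath t v) = root t" "last (rpath t v) = v" "set (rpath t v) \<subseteq> verts t"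
    "distinct (rpath t v)" "successively (\<lambda>x y. {x, y} \<in> edges t) (rpath t v)" "v \<in> set (rpath t v)"
  using rpath[OF assms] unfolding path_between_def by (auto dest: last_in_set)

lemma rpath_prefix:
  assumes "v \<in> verts t" "rpath t v = xs @ u # ys"
  shows "rpath t u = xs @ [u]"
proof (rule rpath_eqI)
  have "successively (\<lambda>x y. {x, y} \<in> edges t) (xs @ [u])"
    using rpath_facts(6)[OF assms(1)] assms(2) successively_append_iff[of _ "xs @ [u]" ys] by simp
  moreover have "hd (xs @ [u]) = root t" using rpath_facts(2)[OF assms(1)] assms(2) by (cases xs) auto
  ultimately show "path_between t (root t) (xs @ [u]) u"
    using rpath_facts(4,5)[OF assms(1)] assms(2) by (simp add: path_between_def)
qed

lemma rpath_inj: "u \<in> verts t \<Longrightarrow> v \<in> verts t \<Longrightarrow> rpath t u = rpath t v \<Longrightarrow> u = v"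
  using rpath_facts(3) by metis

lemma rpath_root: "rpath t (root t) = [root t]"
  by (rule rpath_eqI) (use basics in \<open>auto simp: path_between_def\<close>)

lemma anc_iff: "anc t u v \<longleftrightarrow> v \<in> verts t \<and> u \<in> set (rpath t v)"
  unfolding anc_def using rpath rpath_eqI path_in_verts by metis

lemma anc_verts: "anc t u v \<Longrightarrow> u \<in> verts t \<and> v \<in> verts t"
  unfolding anc_iff using rpath_facts(4) by blast

lemma anc_prefix: "anc t u v \<longleftrightarrow> u \<in> verts t \<and> v \<in> verts t \<and> prefix (rpath t u) (rpath t v)"
proof
  assume a: "anc t u v"
  then obtain xs ys where "rpath t v = xs @ u # ys" unfolding anc_iff by (meson split_list)
  then show "u \<in> verts t \<and> v \<in> verts t \<and> prefix (rpath t u) (rpath t v)"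
    using rpath_prefix[of v xs u ys] anc_verts[OF a] by (auto simp: prefix_def)
next
  assume "u \<in> verts t \<and> v \<in> verts t \<and> prefix (rpath t u) (rpath t v)"
  then show "anc t u v" unfolding anc_iff using rpath_facts(7) set_mono_prefix by blast
qed

lemma anc_refl: "v \<in> verts t \<Longrightarrow> anc t v v"
  by (simp add: anc_prefix)

lemma anc_trans: "anc t u v \<Longrightarrow> anc t v w \<Longrightarrow> anc t u w"
  unfolding anc_prefix using prefix_order.trans by blast

lemma anc_antisym: "anc t u v \<Longrightarrow> anc t v u \<Longrightarrow> u = v"
  unfolding anc_prefix using prefix_order.antisym rpath_inj by blast

lemma anc_chain: "anc t u w \<Longrightarrow> anc t v w \<Longrightarrow> anc t u v \<or> anc t v u"
  unfolding anc_prefix using prefix_same_cases by blast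

lemma anc_root: "v \<in> verts t \<Longrightarrow> anc t (root t) v"
  unfolding anc_iff using rpath_facts by (metis hd_in_set)

lemma childD: "c \<in> children t v \<Longrightarrow> v \<in> verts t \<Longrightarrow> c \<in> verts t \<and> anc t v c \<and> c \<noteq> v \<and> c \<noteq> root t"
  unfolding children_def anc_prefix using rpath_root rpath_facts(1) by auto

lemma edges_iff:
  "{u, v} \<in> edges t \<longleftrightarrow> u \<in> verts t \<and> v \<in> verts t \<and> (v \<in> children t u \<or> u \<in> children t v)"
proof
  assume e: "{u, v} \<in> edges t"
  have uv: "u \<in> verts t" "v \<in> verts t" "u \<noteq> v"
    using e basics(1) unfolding simple_graph_def by (auto simp: doubleton_eq_iff)
  have "rpath t v = rpath t u @ [v] \<or> rpath t u = rpath t v @ [u]"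
  proof (cases "v \<in> set (rpath t u)")
    case False
    have "path_between t (root t) (rpath t u @ [v]) v"
      using rpath_facts[OF uv(1)] uv e False
      by (auto simp: path_between_def successively_append_iff successively_Cons)
    then show ?thesis using rpath_eqI by blast
  next
    case True
    then obtain xs ys where xy: "rpath t u = xs @ v # ys" by (meson split_list)
    have v: "rpath t v = xs @ [v]" using rpath_prefix[OF uv(1) xy] .
    have ys: "ys \<noteq> []" using xy rpath_facts(3)[OF uv(1)] uv(3) by auto
    show ?thesis
    proof (cases "length ys = 1")
      case True
      then obtain y where "ys = [y]" by (metis One_nat_def length_0_conv length_Suc_conv)
      then show ?thesis using xy v rpath_facts(3)[OF uv(1)] by simp
    next
      case False
      \<comment> \<open>An edge from \<open>u\<close> back to a vertex two or more steps earlier on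
        its root path closes a cycle.\<close>
      then have "length (v # ys) \<ge> 3" using ys by (cases ys) (auto simp: Suc_le_eq)
      moreover have "path_between t v (v # ys) u"
        using rpath_facts[OF uv(1)] xy ys by (auto simp: path_between_def successively_append_iff)
      ultimately show ?thesis using basics(3) e unfolding acyclic_graph_def by blast
    qed
  qed
  then show "u \<in> verts t \<and> v \<in> verts t \<and> (v \<in> children t u \<or> u \<in> children t v)"
    using uv by (auto simp: children_def)
next
  have *: "{a, b} \<in> edges t" if "a \<in> verts t" "b \<in> children t a" for a b
    using rpath_facts[of b] rpath_facts[of a] that
    by (auto simp: children_def successively_append_iff successively_Cons)
  assume "u \<in> verts t \<and> v \<in> verts t \<and> (v \<in> children t u \<or> u \<in> children t v)"
  then show "{u, v} \<in> edges t" using *[of u v] *[of v u] by (auto simp: insert_commute)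
qed

lemma edges_eq: "edges t = {{u, c} | u c. u \<in> verts t \<and> c \<in> children t u}"
proof
  show "edges t \<subseteq> {{u, c} | u c. u \<in> verts t \<and> c \<in> children t u}"
  proof
    fix e assume e: "e \<in> edges t"
    then obtain u v where uv: "e = {u, v}" using basics(1) unfolding simple_graph_def by blast
    then show "e \<in> {{u, c} | u c. u \<in> verts t \<and> c \<in> children t u}"
      using e edges_iff[of u v] by (auto simp: insert_commute)
  qed
next
  show "{{u, c} | u c. u \<in> verts t \<and> c \<in> children t u} \<subseteq> edges t"
  proof
    fix e assume "e \<in> {{u, c} | u c. u \<in> verts t \<and> c \<in> children t u}"
    then obtain u c where "e = {u, c}" "u \<in> verts t" "c \<in> children t u" by blast
    then show "e \<in> edges t" using edges_iff[of u c] childD[of c u] by simp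
  qed
qed

definition parent :: "'v \<Rightarrow> 'v" where
  "parent v = last (butlast (rpath t v))"

lemma parent:
  assumes "v \<in> verts t" "v \<noteq> root t"
  shows "parent v \<in> verts t" "v \<in> children t (parent v)"
proof -
  obtain xs where xs: "rpath t v = xs @ [v]" using rpath_facts[OF assms(1)] by (metis append_butlast_last_id)
  have "xs \<noteq> []" using xs rpath_facts(2)[OF assms(1)] assms(2) by auto
  then obtain ys u where ys: "xs = ys @ [u]" by (meson rev_exhaust)
  have p: "parent v = u" using xs ys by (simp add: parent_def butlast_append)
  have u: "rpath t u = ys @ [u]" using rpath_prefix[OF assms(1), of ys u "[v]"] xs ys by simp
  show "parent v \<in> verts t" using rpath_facts(4)[OF assms(1)] xs ys p by auto
  show "v \<in> children t (parent v)" using p u xs ys assms by (simp add: children_def)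
qed

lemma child_unique_parent: "c \<in> children t u \<Longrightarrow> c \<in> children t v \<Longrightarrow> u \<in> verts t \<Longrightarrow> v \<in> verts t \<Longrightarrow> u = v"
  using rpath_inj by (auto simp: children_def)

text \<open>Formulated for a set \<open>A\<close> of retained lower end points, so that it computes
  degrees both in the tree and in a union of root paths.\<close>

lemma degree_of_subforest:
  fixes G :: "('v, 'z) graph_scheme"
  assumes E: "edges G = {{u, c} | u c. u \<in> verts t \<and> c \<in> children t u \<and> c \<in> A}" and x: "x \<in> verts t"
  shows "degree G x = card (children t x \<inter> A) + (if x \<noteq> root t \<and> x \<in> A then 1 else 0)"
proof -
  let ?I = "(\<lambda>c. {x, c}) ` (children t x \<inter> A)"
  let ?P = "if x \<noteq> root t \<and> x \<in> A then {{parent x, x}} else {}"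
  have fin: "finite (children t x)" using basics(5) by (simp add: children_def)
  have "{e \<in> edges G. x \<in> e} = ?I \<union> ?P"
  proof
    show "{e \<in> edges G. x \<in> e} \<subseteq> ?I \<union> ?P"
    proof
      fix e assume "e \<in> {e \<in> edges G. x \<in> e}"
      then obtain u c where uc: "e = {u, c}" "u \<in> verts t" "c \<in> children t u" "c \<in> A" "x = u \<or> x = c"
        unfolding E by auto
      show "e \<in> ?I \<union> ?P"
      proof (cases "x = u")
        case True then show ?thesis using uc by auto
      next
        case False
        then have "x = c" using uc by blast
        moreover have "x \<noteq> root t" using childD uc \<open>x = c\<close> by blast
        moreover have "u = parent x" using child_unique_parent parent[OF x] uc calculation by metis
        ultimately show ?thesis using uc by auto
      qed
    qed
    show "?I \<union> ?P \<subseteq> {e \<in> edges G. x \<in> e}"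
      unfolding E using x parent[OF x] by auto
  qed
  moreover have "inj_on (\<lambda>c. {x, c}) (children t x \<inter> A)"
    by (auto simp: inj_on_def doubleton_eq_iff)
  moreover have "?I \<inter> ?P = {}"
  proof -
    have False if "x \<noteq> root t" "c \<in> children t x" "{parent x, x} = {x, c}" for c
    proof -
      have "parent x = c" using that(3) by (auto simp: doubleton_eq_iff)
      then have "rpath t c = rpath t x @ [c]" "rpath t x = rpath t c @ [x]"
        using that parent[OF x] by (auto simp: children_def)
      then show False by simp
    qed
    then show ?thesis by auto
  qed
  ultimately show ?thesis using fin by (simp add: degree_def card_Un_disjoint card_image)
qed

lemma degree_eq: "x \<in> verts t \<Longrightarrow> degree t x = card (children t x) + (if x \<noteq> root t then 1 else 0)"
  using degree_of_subforest[of t "verts t" x] edges_eq by (auto simp: children_def inf_absorb1 Int_def cong: conj_cong)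

lemma finite_children: "finite (children t x)"
  using basics(5) by (simp add: children_def)

lemma leaf_iff: "v \<in> leaves t \<longleftrightarrow> v \<in> verts t \<and> v \<noteq> root t \<and> children t v = {}"
  using degree_eq finite_children by (auto simp: leaves_def)

lemma root_child: "card (children t (root t)) = 1"
  using degree_eq[OF basics(4)] basics(6) by simp

lemma child_towards:
  assumes "anc t u v" "u \<noteq> v"
  shows "\<exists>c\<in>children t u. anc t c v"
proof -
  obtain ys where ys: "rpath t v = rpath t u @ ys" using assms(1) unfolding anc_prefix prefix_def by blast
  have uv: "u \<in> verts t" "v \<in> verts t" using anc_verts assms by blast+
  have "ys \<noteq> []" using ys rpath_inj uv assms(2) by auto
  then obtain c zs where "ys = c # zs" by (meson neq_Nil_conv)
  then have yc: "rpath t v = rpath t u @ c # zs" using ys by simp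
  have "rpath t c = rpath t u @ [c]" by (rule rpath_prefix[OF uv(2) yc])
  moreover have "c \<in> set (rpath t v)" using yc by simp
  ultimately show ?thesis using uv rpath_facts(4)[OF uv(2)] unfolding children_def anc_iff by blast
qed

lemma child_unique:
  assumes "c \<in> children t u" "c' \<in> children t u" "anc t c v" "anc t c' v"
  shows "c = c'"
  using anc_chain[OF assms(3,4)] assms(1,2) unfolding anc_prefix children_def by auto

lemma leaf_below: "v \<in> verts t \<Longrightarrow> \<exists>l\<in>leaves t. anc t v l"
proof -
  assume v: "v \<in> verts t"
  let ?A = "{w. anc t v w}"
  have fin: "finite ?A" using finite_subset[OF _ basics(5)] anc_verts by blast
  have ne: "?A \<noteq> {}" using anc_refl[OF v] by blast
  have "\<exists>w. anc t v w \<and> (\<forall>x. anc t v x \<longrightarrow> length (rpath t x) \<le> length (rpath t w))"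
  proof -
    let ?N = "(\<lambda>x. length (rpath t x)) ` ?A"
    have "Max ?N \<in> ?N" using fin ne by (intro Max_in) auto
    then obtain w where "anc t v w" "Max ?N = length (rpath t w)" by auto
    then show ?thesis using Max_ge[of ?N] fin by auto
  qed
  then obtain w where w: "anc t v w" "\<And>x. anc t v x \<Longrightarrow> length (rpath t x) \<le> length (rpath t w)" by blast
  have wv: "w \<in> verts t" using anc_verts w by blast
  have "children t w = {}"
  proof (rule ccontr)
    assume "children t w \<noteq> {}"
    then obtain c where c: "c \<in> children t w" by blast
    then have "anc t v c" using childD[OF c wv] w anc_trans by blast
    then have "length (rpath t c) \<le> length (rpath t w)" using w by blast
    then show False using c by (simp add: children_def)
  qed
  moreover then have "w \<noteq> root t" using root_child by auto
  ultimately show ?thesis using w wv leaf_iff by blast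
qed

text \<open>\<open>z\<close> is the last vertex before the root paths of \<open>x\<close> and
  \<open>y\<close> diverge. It is not the root, which has a single child.\<close>

lemma meet_exists:
  assumes "x \<in> verts t" "y \<in> verts t" "\<not> anc t x y" "\<not> anc t y x"
  obtains z c c' where "z \<in> verts t" "z \<noteq> root t" "c \<in> children t z" "c' \<in> children t z" "c \<noteq> c'" "anc t c x" "anc t c' y"
proof -
  have "rpath t x \<parallel> rpath t y" using assms unfolding anc_prefix parallel_def by blast
  then obtain as b bs c cs where d: "b \<noteq> c" "rpath t x = as @ b # bs" "rpath t y = as @ c # cs"
    using parallel_decomp by blast
  have "as \<noteq> []" using d rpath_facts(2)[OF assms(1)] rpath_facts(2)[OF assms(2)] by auto
  then obtain zs z where z: "as = zs @ [z]" by (meson rev_exhaust)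
  have rz: "rpath t z = as" using rpath_prefix[OF assms(1), of zs z "b # bs"] d z by simp
  have zin: "z \<in> set (rpath t x)" using d z by auto
  then have zv: "z \<in> verts t" using rpath_facts(4)[OF assms(1)] by blast
  have b: "b \<in> children t z" "anc t b x"
    using rpath_prefix[OF assms(1) d(2)] rz rpath_facts(4)[OF assms(1)] d(2) assms(1) unfolding children_def anc_iff by auto
  have c: "c \<in> children t z" "anc t c y"
    using rpath_prefix[OF assms(2) d(3)] rz rpath_facts(4)[OF assms(2)] d(3) assms(2) unfolding children_def anc_iff by auto
  have "z \<noteq> root t"
  proof
    assume "z = root t"
    then have "card {b, c} \<le> 1" using card_mono[OF finite_children, of "{b, c}" z] b c root_child by simp
    then show False using d(1) by simp
  qed
  then show thesis using that zv b c d(1) by blast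
qed

lemma leaf_anc: "l \<in> leaves t \<Longrightarrow> anc t l v \<Longrightarrow> v = l"
  using child_towards leaf_iff by blast

lemma leaf_verts: "l \<in> leaves t \<Longrightarrow> l \<in> verts t"
  by (simp add: leaf_iff)

end

section \<open>Binary trees as hierarchies\<close>

locale bintree = tree t for t :: "'v rtree" +
  assumes binary: "rooted_binary_tree t"
begin

lemma inodes_verts: "v \<in> inodes t \<Longrightarrow> v \<in> verts t \<and> v \<noteq> root t \<and> v \<notin> leaves t"
  by (simp add: inodes_def)

lemma inodes_children: "v \<in> inodes t \<Longrightarrow> card (children t v) = 2"
  using binary degree_eq[of v] by (auto simp: rooted_binary_tree_def inodes_def)

text \<open>An arbitrary choice; it only serves to tell the two children apart.\<close>

definition left :: "'v \<Rightarrow> 'v" where "left v = (SOME c. c \<in> children t v)"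

lemma left_child: "v \<in> inodes t \<Longrightarrow> left v \<in> children t v"
  unfolding left_def using inodes_children[of v] by (metis card_eq_0_iff ex_in_conv someI_ex zero_neq_numeral)

lemma right_child: "v \<in> inodes t \<Longrightarrow> \<exists>c. children t v = {left v, c} \<and> c \<noteq> left v"
  using inodes_children[of v] left_child[of v] unfolding card_2_iff by auto

text \<open>A proper descendant of \<open>v\<close> lies below exactly one child of
  \<open>v\<close>, hence sides are constant on its labels. Incomparable vertices share no leaf. The
  root separates nothing and is left out.\<close>

lemma hierarchy_of_tree:
  assumes "finite M" "bij_betw lab M (leaves t)"
  shows "hierarchy (inodes t) (\<lambda>v. {m \<in> M. anc t v (lab m)}) (\<lambda>v m. anc t (left v) (lab m)) M"
proof
  have labM: "\<And>m. m \<in> M \<Longrightarrow> lab m \<in> leaves t" using assms(2) by (auto simp: bij_betw_def)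
  show "finite (inodes t)" using basics(5) by (simp add: inodes_def)
  show "finite M" by fact
  show "{m \<in> M. anc t v (lab m)} \<subseteq> M" for v by blast
  show "\<exists>v\<in>inodes t. x \<in> {m \<in> M. anc t v (lab m)} \<and> y \<in> {m \<in> M. anc t v (lab m)} \<and>
      anc t (left v) (lab x) \<noteq> anc t (left v) (lab y)" if xy: "x \<in> M" "y \<in> M" "x \<noteq> y" for x y
  proof -
    have ne: "lab x \<noteq> lab y" using xy assms(2) by (meson bij_betw_def inj_onD)
    obtain z c c' where z: "z \<in> verts t" "z \<noteq> root t" "c \<in> children t z" "c' \<in> children t z" "c \<noteq> c'"
      "anc t c (lab x)" "anc t c' (lab y)"
      using meet_exists[of "lab x" "lab y"] leaf_anc ne labM xy leaf_verts by metis
    have zi: "z \<in> inodes t" using z leaf_iff by (auto simp: inodes_def)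
    have az: "anc t z (lab x)" "anc t z (lab y)" using z childD anc_trans by blast+
    have "left z = c \<or> left z = c'" using right_child[OF zi] z by auto
    then have "anc t (left z) (lab x) \<noteq> anc t (left z) (lab y)" using z child_unique by blast
    then show ?thesis using zi az xy by blast
  qed
  have const: "{m \<in> M. anc t u (lab m)} \<subseteq> {m \<in> M. anc t v (lab m)} \<and>
     (\<forall>x\<in>{m \<in> M. anc t u (lab m)}. \<forall>y\<in>{m \<in> M. anc t u (lab m)}. anc t (left v) (lab x) = anc t (left v) (lab y))"
    if uv: "v \<in> inodes t" "anc t v u" "u \<noteq> v" for u v
  proof -
    obtain c where c: "c \<in> children t v" "anc t c u" using child_towards[OF uv(2)] uv(3) by blast
    have "anc t (left v) (lab x) \<longleftrightarrow> left v = c" if "anc t u (lab x)" for x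
      using child_unique[OF c(1) left_child[OF uv(1)], of "lab x"] anc_trans[OF c(2) that] by blast
    then show ?thesis using uv(2) anc_trans by blast
  qed
  show "{m \<in> M. anc t u (lab m)} \<inter> {m \<in> M. anc t v (lab m)} = {} \<or>
    ({m \<in> M. anc t u (lab m)} \<subseteq> {m \<in> M. anc t v (lab m)} \<and>
     (\<forall>x\<in>{m \<in> M. anc t u (lab m)}. \<forall>y\<in>{m \<in> M. anc t u (lab m)}. anc t (left v) (lab x) = anc t (left v) (lab y))) \<or>
    ({m \<in> M. anc t v (lab m)} \<subseteq> {m \<in> M. anc t u (lab m)} \<and>
     (\<forall>x\<in>{m \<in> M. anc t v (lab m)}. \<forall>y\<in>{m \<in> M. anc t v (lab m)}. anc t (left u) (lab x) = anc t (left u) (lab y)))"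
    if uv: "u \<in> inodes t" "v \<in> inodes t" "u \<noteq> v" for u v
  proof (cases "anc t u v \<or> anc t v u")
    case True
    then show ?thesis using const[OF uv(1) _ uv(3)[symmetric]] const[OF uv(2) _ uv(3)] by meson
  next
    case False
    then have "{m \<in> M. anc t u (lab m)} \<inter> {m \<in> M. anc t v (lab m)} = {}" using anc_chain by blast
    then show ?thesis by (rule disjI1)
  qed
  show "\<exists>x\<in>{m \<in> M. anc t v (lab m)}. \<exists>y\<in>{m \<in> M. anc t v (lab m)}. anc t (left v) (lab x) \<noteq> anc t (left v) (lab y)"
    if v: "v \<in> inodes t" for v
  proof -
    have vv: "v \<in> verts t" using v inodes_verts by blast
    obtain c where c: "children t v = {left v, c}" "c \<noteq> left v" using right_child[OF v] by blast
    have cv: "left v \<in> verts t" "c \<in> verts t" "anc t v (left v)" "anc t v c" using c childD[OF _ vv] by auto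
    obtain l l' where l: "l \<in> leaves t" "anc t (left v) l" "l' \<in> leaves t" "anc t c l'"
      using leaf_below cv by meson
    obtain x y where xy: "x \<in> M" "lab x = l" "y \<in> M" "lab y = l'" using l assms(2) by (metis bij_betw_iff_bijections)
    have "\<not> anc t (left v) l'" using child_unique[of c v "left v" l'] c l by auto
    then have "anc t (left v) (lab x) \<noteq> anc t (left v) (lab y)" using xy l by simp
    moreover have "anc t v (lab x)" "anc t v (lab y)" using anc_trans[OF cv(3) l(2)] anc_trans[OF cv(4) l(4)] xy by simp_all
    ultimately show ?thesis using xy(1,3) by (intro bexI[of _ x] bexI[of _ y]) simp_all
  qed
qed

end

section \<open>Induced subtrees\<close>

lemma path_edges_alt: "path_edges p = {{u, c} | u c. \<exists>xs ys. p = xs @ u # c # ys}"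
proof
  show "path_edges p \<subseteq> {{u, c} | u c. \<exists>xs ys. p = xs @ u # c # ys}"
  proof
    fix e assume "e \<in> path_edges p"
    then obtain i where i: "e = {p ! i, p ! Suc i}" "Suc i < length p" by (auto simp: path_edges_def)
    have "p = take i p @ p ! i # p ! Suc i # drop (Suc (Suc i)) p"
      using i(2) by (metis Cons_nth_drop_Suc Suc_lessD append_take_drop_id)
    then show "e \<in> {{u, c} | u c. \<exists>xs ys. p = xs @ u # c # ys}" using i(1) by blast
  qed
next
  show "{{u, c} | u c. \<exists>xs ys. p = xs @ u # c # ys} \<subseteq> path_edges p"
  proof
    fix e assume "e \<in> {{u, c} | u c. \<exists>xs ys. p = xs @ u # c # ys}"
    then obtain u c xs ys where e: "e = {u, c}" "p = xs @ u # c # ys" by blast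
    then have "e = {p ! length xs, p ! Suc (length xs)}" "Suc (length xs) < length p"
      by (auto simp: nth_append)
    then show "e \<in> path_edges p" unfolding path_edges_def by blast
  qed
qed

locale leaf_set = bintree t for t :: "'v rtree" +
  fixes S :: "'v set"
  assumes S_leaves: "S \<subseteq> leaves t" and S_nonempty: "S \<noteq> {}"
begin

abbreviation U :: "'v rtree" where "U \<equiv> root_path_union t S"

definition used :: "'v set" where "used = {v. \<exists>s\<in>S. anc t v s}"

text \<open>What suppression leaves: an inner vertex survives exactly when both of its branches lead
  to chosen leaves, since it then has degree 3 in the union of the root paths.\<close>

definition surv :: "'v \<Rightarrow> bool" where
  "surv v \<longleftrightarrow> v = root t \<or> v \<in> S \<or> (v \<in> inodes t \<and> children t v \<subseteq> used)"

text \<open>The Hasse diagram of the ancestor order on the survivors. It turns out to be the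
  adjacency of the induced tree, directed away from the root.\<close>

definition cover :: "'v \<Rightarrow> 'v \<Rightarrow> bool" where
  "cover u v \<longleftrightarrow> surv u \<and> surv v \<and> u \<noteq> v \<and> anc t u v \<and>
     \<not> (\<exists>w. surv w \<and> w \<noteq> u \<and> w \<noteq> v \<and> anc t u w \<and> anc t w v)"

lemma S_verts: "s \<in> S \<Longrightarrow> s \<in> verts t"
  using S_leaves leaf_verts by blast

lemma used_verts: "v \<in> used \<Longrightarrow> v \<in> verts t"
  using anc_verts by (auto simp: used_def)

lemma used_up: "anc t u v \<Longrightarrow> v \<in> used \<Longrightarrow> u \<in> used"
  using anc_trans by (auto simp: used_def)

lemma U_simps: "verts U = used" "edges U = {{u, c} | u c. u \<in> verts t \<and> c \<in> children t u \<and> c \<in> used}" "root U = root t"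
proof -
  have p: "{p. \<exists>s\<in>S. path_between t (root t) p s} = rpath t ` S"
    using rpath[OF S_verts] rpath_eqI by blast
  have "verts U = \<Union> (set ` {p. \<exists>s\<in>S. path_between t (root t) p s})"
    unfolding root_path_union_def by (simp add: setcompr_eq_image)
  also have "\<dots> = used" unfolding p using S_verts by (auto simp: used_def anc_iff)
  finally show "verts U = used" .
  show "root U = root t" by (simp add: root_path_union_def)
  have "edges U = \<Union> (path_edges ` {p. \<exists>s\<in>S. path_between t (root t) p s})"
    unfolding root_path_union_def by (simp add: setcompr_eq_image)
  also have "\<dots> = (\<Union>s\<in>S. path_edges (rpath t s))" unfolding p by simp
  also have "\<dots> = {{u, c} | u c. u \<in> verts t \<and> c \<in> children t u \<and> c \<in> used}"
  proof
    show "(\<Union>s\<in>S. path_edges (rpath t s)) \<subseteq> {{u, c} | u c. u \<in> verts t \<and> c \<in> children t u \<and> c \<in> used}"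
    proof
      fix e assume "e \<in> (\<Union>s\<in>S. path_edges (rpath t s))"
      then obtain s u c xs ys where s: "s \<in> S" "e = {u, c}" "rpath t s = xs @ u # c # ys"
        unfolding path_edges_alt by blast
      have sv: "s \<in> verts t" using s S_verts by blast
      have "rpath t u = xs @ [u]" using rpath_prefix[OF sv s(3)] .
      moreover have "rpath t c = (xs @ [u]) @ [c]" using rpath_prefix[OF sv, of "xs @ [u]" c ys] s(3) by simp
      moreover have "u \<in> set (rpath t s)" "c \<in> set (rpath t s)" using s(3) by auto
      moreover then have "u \<in> verts t" "c \<in> verts t" using rpath_facts(4)[OF sv] by blast+
      ultimately have "u \<in> verts t" "c \<in> children t u" "c \<in> used"
        using s(1) sv by (auto simp: children_def used_def anc_iff)
      then show "e \<in> {{u, c} | u c. u \<in> verts t \<and> c \<in> children t u \<and> c \<in> used}" using s(2) by blast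
    qed
    show "{{u, c} | u c. u \<in> verts t \<and> c \<in> children t u \<and> c \<in> used} \<subseteq> (\<Union>s\<in>S. path_edges (rpath t s))"
    proof
      fix e assume "e \<in> {{u, c} | u c. u \<in> verts t \<and> c \<in> children t u \<and> c \<in> used}"
      then obtain u c s where c: "e = {u, c}" "u \<in> verts t" "c \<in> children t u" "s \<in> S" "anc t c s"
        by (auto simp: used_def)
      obtain ys where "rpath t s = rpath t c @ ys" using c(5) unfolding anc_prefix prefix_def by blast
      moreover have "rpath t c = rpath t u @ [c]" using c(3) by (simp add: children_def)
      moreover obtain xs where "rpath t u = xs @ [u]" using rpath_facts[OF c(2)] by (metis append_butlast_last_id)
      ultimately have "rpath t s = xs @ u # c # ys" by simp
      then show "e \<in> (\<Union>s\<in>S. path_edges (rpath t s))" using c(1,4) unfolding path_edges_alt by blast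
    qed
  qed
  finally show "edges U = {{u, c} | u c. u \<in> verts t \<and> c \<in> children t u \<and> c \<in> used}" .
qed

lemma root_used: "root t \<in> used"
  using S_nonempty S_verts anc_root by (auto simp: used_def)

lemma S_used: "s \<in> S \<Longrightarrow> s \<in> used"
  using S_verts anc_refl by (auto simp: used_def)

lemma used_leaf: "v \<in> used \<Longrightarrow> v \<in> leaves t \<Longrightarrow> v \<in> S"
  using leaf_anc by (auto simp: used_def)

lemma used_child: "v \<in> used \<Longrightarrow> v \<notin> leaves t \<Longrightarrow> \<exists>c\<in>children t v. c \<in> used"
  using child_towards S_leaves unfolding used_def by blast

lemma degree_U: "v \<in> verts t \<Longrightarrow> degree U v = card (children t v \<inter> used) + (if v \<noteq> root t \<and> v \<in> used then 1 else 0)"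
  by (rule degree_of_subforest[OF U_simps(2)])

lemma inodes_cases: "v \<in> verts t \<Longrightarrow> v = root t \<or> v \<in> leaves t \<or> v \<in> inodes t"
  by (auto simp: inodes_def)

lemma surv_used: "surv v \<Longrightarrow> v \<in> used"
proof -
  assume "surv v"
  then consider "v = root t" | "v \<in> S" | "v \<in> inodes t" "children t v \<subseteq> used" by (auto simp: surv_def)
  then show ?thesis
  proof cases
    case 3
    then have "left v \<in> used" "v \<in> verts t" using left_child inodes_verts by blast+
    then show ?thesis using used_up childD[OF left_child[OF 3(1)]] by blast
  qed (auto simp: root_used S_used)
qed

lemma degree2_iff:
  assumes v: "v \<in> used"
  shows "degree U v = 2 \<longleftrightarrow> \<not> surv v"
proof -
  have vv: "v \<in> verts t" using used_verts v by blast
  note d = degree_U[OF vv]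
  consider "v = root t" | "v \<in> leaves t" | "v \<in> inodes t" using inodes_cases vv by blast
  then show ?thesis
  proof cases
    case 1
    then have "degree U v \<le> 1" using d root_child card_mono[OF finite_children[of v], of "children t v \<inter> used"] by simp
    then show ?thesis using 1 by (simp add: surv_def)
  next
    case 2
    then have "degree U v \<le> 1" using d leaf_iff by simp
    then show ?thesis using 2 used_leaf v by (simp add: surv_def)
  next
    case 3
    then have nr: "v \<noteq> root t" "v \<notin> leaves t" "v \<notin> S" using inodes_verts S_leaves by blast+
    obtain c where c: "children t v = {left v, c}" "c \<noteq> left v" using right_child[OF 3] by blast
    have "\<exists>c\<in>children t v. c \<in> used" using used_child v nr by blast
    then have "card (children t v \<inter> used) = 1 \<longleftrightarrow> \<not> children t v \<subseteq> used"
      using c by (cases "left v \<in> used"; cases "c \<in> used") auto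
    then show ?thesis using d nr v 3 by (auto simp: surv_def)
  qed
qed

lemma verts_induced: "verts (induced_tree t S) = {v. surv v}"
  using degree2_iff surv_used by (auto simp: induced_tree_def suppress_def U_simps)

lemma path_down:
  assumes "anc t u v"
  obtains xs ys where "rpath t v = xs @ u # ys" "path_between t u (u # ys) v"
    "set (u # ys) = {w. anc t u w \<and> anc t w v}"
proof -
  have uv: "u \<in> verts t" "v \<in> verts t" "u \<in> set (rpath t v)"
    using anc_verts assms unfolding anc_iff by blast+
  obtain xs ys where r: "rpath t v = xs @ u # ys" using uv(3) by (meson split_list)
  have ru: "rpath t u = xs @ [u]" using rpath_prefix[OF uv(2) r] .
  have f: "distinct (xs @ u # ys)" "last (xs @ u # ys) = v" "set (xs @ u # ys) \<subseteq> verts t"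
    "successively (\<lambda>x y. {x, y} \<in> edges t) (xs @ u # ys)"
    using rpath_facts[OF uv(2)] r by simp_all
  have "path_between t u (u # ys) v"
    using f by (auto simp: path_between_def successively_append_iff)
  moreover have "set (u # ys) = {w. anc t u w \<and> anc t w v}"
  proof
    show "set (u # ys) \<subseteq> {w. anc t u w \<and> anc t w v}"
    proof
      fix w assume w: "w \<in> set (u # ys)"
      then obtain as bs where ab: "u # ys = as @ w # bs" by (meson split_list)
      have rw: "rpath t w = (xs @ as) @ [w]" using rpath_prefix[OF uv(2), of "xs @ as" w bs] r ab by simp
      have "u \<in> set (rpath t w)" using rw ab by (cases as) auto
      moreover have "w \<in> verts t" "w \<in> set (rpath t v)" using w f(3) r by auto
      ultimately show "w \<in> {w. anc t u w \<and> anc t w v}" using uv unfolding anc_iff by blast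
    qed
    show "{w. anc t u w \<and> anc t w v} \<subseteq> set (u # ys)"
    proof
      fix w assume "w \<in> {w. anc t u w \<and> anc t w v}"
      then have w: "anc t u w" "anc t w v" by auto
      then have "w \<in> set (xs @ u # ys)" using r unfolding anc_iff by simp
      moreover have "w \<notin> set xs"
      proof
        assume "w \<in> set xs"
        then have "anc t w u" using ru uv unfolding anc_iff by simp
        then show False using w(1) anc_antisym \<open>w \<in> set xs\<close> f(1) by fastforce
      qed
      ultimately show "w \<in> set (u # ys)" by auto
    qed
  qed
  ultimately show thesis using that r by blast
qed

lemma path_U_t: "path_between U u p v \<Longrightarrow> path_between t u p v"
proof -
  assume p: "path_between U u p v"
  have "edges U \<subseteq> edges t" using U_simps(2) edges_eq by blast
  then have "successively (\<lambda>x y. {x, y} \<in> edges t) p"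
    using p successively_mono[of _ p] unfolding path_between_def by (smt (verit) subsetD)
  then show ?thesis using p used_verts U_simps(1) unfolding path_between_def by blast
qed

lemma edge_cover:
  assumes p: "path_between U u p v" and s: "surv u" "surv v" "u \<noteq> v" and a: "anc t u v"
    and d: "\<forall>w \<in> set p - {u, v}. degree U w = 2"
  shows "cover u v"
proof -
  obtain xs ys where xy: "rpath t v = xs @ u # ys" "path_between t u (u # ys) v"
    "set (u # ys) = {w. anc t u w \<and> anc t w v}" using path_down[OF a] by blast
  have "p = u # ys" using path_unique[OF basics(3) path_U_t[OF p] xy(2)] .
  then have "\<not> surv w" if "anc t u w" "anc t w v" "w \<noteq> u" "w \<noteq> v" for w
    using that d xy(3) degree2_iff used_up surv_used[OF s(2)] by blast
  then show ?thesis using s a by (auto simp: cover_def)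
qed

text \<open>A path between incomparable vertices turns at their meet. There both branches are used
  and an edge leads upwards, so the degree is at least 3 and the meet is not suppressed.\<close>

lemma path_comparable:
  assumes p: "path_between U u p v" and s: "surv u" "surv v" "u \<noteq> v"
    and d: "\<forall>w \<in> set p - {u, v}. degree U w = 2"
  shows "anc t u v \<or> anc t v u"
proof (rule ccontr)
  assume n: "\<not> ?thesis"
  have uv: "u \<in> used" "v \<in> used" "u \<in> verts t" "v \<in> verts t" using surv_used s used_verts by blast+
  obtain z c c' where z: "z \<in> verts t" "z \<noteq> root t" "c \<in> children t z" "c' \<in> children t z" "c \<noteq> c'" "anc t c u" "anc t c' v"
    using meet_exists[of u v] uv n by blast
  have cz: "anc t z c" "anc t z c'" "{z, c} \<in> edges t" "{z, c'} \<in> edges t" "c \<noteq> z" "c' \<noteq> z"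
    using childD z edges_iff by blast+
  obtain ys where ys: "path_between t c (c # ys) u" "set (c # ys) = {w. anc t c w \<and> anc t w u}"
    using path_down[OF z(6)] by blast
  obtain ys' where ys': "path_between t c' (c' # ys') v" "set (c' # ys') = {w. anc t c' w \<and> anc t w v}"
    using path_down[OF z(7)] by blast
  define q where "q = rev (c # ys) @ z # c' # ys'"
  have disj: "set (c # ys) \<inter> set (c' # ys') = {}" using child_unique z ys(2) ys'(2) by blast
  have nz: "z \<notin> set (c # ys)" "z \<notin> set (c' # ys')" using ys(2) ys'(2) cz anc_antisym by blast+
  have "path_between t u q v"
    unfolding path_between_def
  proof (intro conjI)
    show "q \<noteq> []" by (simp add: q_def)
    show "hd q = u" using ys(1) unfolding q_def path_between_def by (cases ys rule: rev_cases) auto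
    show "last q = v" using ys'(1) unfolding q_def path_between_def by simp
    show "set q \<subseteq> verts t" using ys(1) ys'(1) z(1) unfolding q_def path_between_def by auto
    show "distinct q" using ys(1) ys'(1) disj nz unfolding q_def path_between_def by auto
    have "successively (\<lambda>x y. {x, y} \<in> edges t) (rev (c # ys))"
      using ys(1) unfolding path_between_def successively_rev by (simp add: insert_commute)
    moreover have "last (rev (c # ys)) = c" by simp
    ultimately show "successively (\<lambda>x y. {x, y} \<in> edges t) q"
      using ys'(1) cz unfolding q_def path_between_def
      by (simp only: successively_append_iff successively_Cons) (auto simp: insert_commute)
  qed
  then have "p = q" using path_unique[OF basics(3) path_U_t[OF p]] by blast
  moreover have "z \<noteq> u" "z \<noteq> v" using z(6,7) cz anc_antisym by blast+
  ultimately have "degree U z = 2" using d by (simp add: q_def)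
  moreover have "c \<in> used" "c' \<in> used" "z \<in> used" using used_up uv z cz by blast+
  moreover have "card {c, c'} \<le> card (children t z \<inter> used)"
    using card_mono[of "children t z \<inter> used" "{c, c'}"] finite_children[of z] calculation z by simp
  ultimately show False using degree_U[OF z(1)] z(2,5) by simp
qed

lemma edges_induced: "edges (induced_tree t S) = {{u, v} | u v. cover u v}"
proof
  show "edges (induced_tree t S) \<subseteq> {{u, v} | u v. cover u v}"
  proof
    fix e assume "e \<in> edges (induced_tree t S)"
    then obtain u v p where e: "e = {u, v}" "u \<noteq> v" "degree U u \<noteq> 2" "degree U v \<noteq> 2"
      "path_between U u p v" "\<forall>w \<in> set p - {u, v}. degree U w = 2"
      by (auto simp: induced_tree_def suppress_def)
    have uv: "u \<in> used" "v \<in> used" using e(5) U_simps(1) unfolding path_between_def by (metis hd_in_set last_in_set subsetD)+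
    then have s: "surv u" "surv v" using e degree2_iff by blast+
    show "e \<in> {{u, v} | u v. cover u v}"
    proof (cases "anc t u v")
      case True
      then show ?thesis using edge_cover[OF e(5) s e(2) True e(6)] e(1) by blast
    next
      case False
      then have a: "anc t v u" using path_comparable[OF e(5) s e(2) e(6)] by blast
      have "path_between U v (rev p) u"
        using e(5) unfolding path_between_def successively_rev by (simp add: hd_rev last_rev insert_commute)
      then have "cover v u" using edge_cover[of v "rev p" u] s e(2,6) a by (simp add: insert_commute)
      then show ?thesis using e(1) by blast
    qed
  qed
next
  show "{{u, v} | u v. cover u v} \<subseteq> edges (induced_tree t S)"
  proof
    fix e assume "e \<in> {{u, v} | u v. cover u v}"
    then obtain u v where e: "e = {u, v}" and c: "cover u v" by blast
    have s: "surv u" "surv v" "u \<noteq> v" "anc t u v" using c by (auto simp: cover_def)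
    obtain xs ys where xy: "rpath t v = xs @ u # ys" "path_between t u (u # ys) v"
      "set (u # ys) = {w. anc t u w \<and> anc t w v}" using path_down[OF s(4)] by blast
    have us: "set (u # ys) \<subseteq> used" using xy(3) used_up surv_used[OF s(2)] by blast
    have "{a, b} \<in> edges U" if "{a, b} \<in> edges t" "a \<in> used" "b \<in> used" for a b
    proof -
      have "b \<in> children t a \<or> a \<in> children t b" "a \<in> verts t" "b \<in> verts t" using that edges_iff by blast+
      then show ?thesis using that unfolding U_simps(2) by (auto simp: insert_commute)
    qed
    then have "successively (\<lambda>x y. {x, y} \<in> edges U) (u # ys)"
      using xy(2) us successively_mono[of "\<lambda>x y. {x, y} \<in> edges t" "u # ys" "\<lambda>x y. {x, y} \<in> edges U"]
      unfolding path_between_def by blast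
    then have p: "path_between U u (u # ys) v" using xy(2) us U_simps(1) unfolding path_between_def by simp
    have "\<forall>w \<in> set (u # ys) - {u, v}. degree U w = 2"
      using c us degree2_iff xy(3) unfolding cover_def by blast
    moreover have "degree U u \<noteq> 2" "degree U v \<noteq> 2"
      using degree2_iff[OF surv_used[OF s(1)]] degree2_iff[OF surv_used[OF s(2)]] s(1,2) by simp_all
    ultimately have "u \<noteq> v \<and> degree U u \<noteq> 2 \<and> degree U v \<noteq> 2 \<and>
        (\<exists>p. path_between U u p v \<and> (\<forall>w \<in> set p - {u, v}. degree U w = 2))"
      using p s(3) by blast
    then show "e \<in> edges (induced_tree t S)"
      unfolding induced_tree_def suppress_def e rtree.simps graph.simps by blast
  qed
qed

lemma root_induced: "root (induced_tree t S) = root t"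
  by (simp add: induced_tree_def suppress_def U_simps)

end

section \<open>Induced trees on four labels\<close>

lemma (in hierarchy) excluded:
  assumes "splits u x r" "splits u x s" "splits v r s"
  shows "x \<notin> C v \<and> below v u"
proof -
  have "u \<noteq> v" using assms unfolding splits_def by blast
  moreover have "\<not> below u v" using below_const[of u v r s] assms unfolding splits_def by blast
  ultimately have b: "below v u" using overlap[of u v r] assms unfolding splits_def by blast
  then show ?thesis using below_const[of v u x r] assms unfolding splits_def by blast
qed

lemma (in hierarchy) caterpillarI:
  assumes n: "n \<in> V" "m \<in> V" and p: "p \<in> M" "p \<notin> C n" and q: "q \<in> C n" "r \<in> C n" "s \<in> C n"
    and m: "q \<notin> C m" "r \<in> C m" "s \<in> C m"
  shows "caterpillar p q r s"
proof -
  have M: "q \<in> M" "r \<in> M" "s \<in> M" "p \<noteq> q" "q \<noteq> r" using n p q m C_subset by blast+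
  obtain u where u: "splits u p q" using splits_exists p M by blast
  have b: "below n u" using splits_outside[of u q p n] u n p q splits_sym by blast
  have "splits u p r" "splits u p s"
    using u below_const[OF b q(1)] below_subset[OF b] q unfolding splits_def by blast+
  moreover obtain v where v: "splits v q r" using splits_exists M by blast
  have c: "below m v" using splits_outside[of v r q m] v n m splits_sym by blast
  have "splits v q s"
    using v below_const[OF c m(2)] below_subset[OF c] m unfolding splits_def by blast
  ultimately show ?thesis using u v unfolding caterpillar_def by blast
qed

definition tree_image :: "('u \<Rightarrow> 'v) \<Rightarrow> 'u rtree \<Rightarrow> 'v rtree \<Rightarrow> bool" where
  "tree_image g K I \<longleftrightarrow> inj_on g (verts K) \<and> verts I = g ` verts K \<and> edges I = (`) g ` edges K \<and> g (root K) = root I"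

text \<open>The model counterpart of \<open>cover\<close>, with inclusion of sets of leaf indices in
  place of the ancestor order.\<close>

definition kcover :: "kvertex set \<Rightarrow> (kvertex \<Rightarrow> nat set) \<Rightarrow> kvertex \<Rightarrow> kvertex \<Rightarrow> bool" where
  "kcover K \<kappa> i j \<longleftrightarrow> i \<in> K \<and> j \<in> K \<and> i \<noteq> j \<and> \<kappa> j \<subseteq> \<kappa> i \<and>
     \<not> (\<exists>w\<in>K. w \<noteq> i \<and> w \<noteq> j \<and> \<kappa> j \<subseteq> \<kappa> w \<and> \<kappa> w \<subseteq> \<kappa> i)"

text \<open>
  The indices of the leaves below a vertex.  The additional index 5 separates the root from its
  child, so that inclusion of these sets is the ancestor order.
\<close>

fun \<kappa>2 :: "kvertex \<Rightarrow> nat set" where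
  "\<kappa>2 Root = {1,2,3,4,5}"
| "\<kappa>2 (Inner n) = (if n = 1 then {1,2,3,4} else if n = 2 then {2,3,4} else {3,4})"
| "\<kappa>2 (Leaf n) = {n}"

fun \<kappa>1 :: "kvertex \<Rightarrow> nat set" where
  "\<kappa>1 Root = {1,2,3,4,5}"
| "\<kappa>1 (Inner n) = (if n = 1 then {1,2,3,4} else if n = 2 then {1,2} else {3,4})"
| "\<kappa>1 (Leaf n) = {n}"

definition KV :: "kvertex set" where
  "KV = {Root, Inner 1, Inner 2, Inner 3, Leaf 1, Leaf 2, Leaf 3, Leaf 4}"

lemma kcover_2: "kcover KV \<kappa>2 i j \<longleftrightarrow> (i, j) \<in> {(Root, Inner 1), (Inner 1, Leaf 1), (Inner 1, Inner 2),
    (Inner 2, Leaf 2), (Inner 2, Inner 3), (Inner 3, Leaf 3), (Inner 3, Leaf 4)}" (is "?L = ?R")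
proof
  assume ?R
  then show ?L unfolding kcover_def KV_def by (elim insertE emptyE) simp_all
next
  assume L: ?L
  have b: "\<not> (w \<in> KV \<and> w \<noteq> i \<and> w \<noteq> j \<and> \<kappa>2 j \<subseteq> \<kappa>2 w \<and> \<kappa>2 w \<subseteq> \<kappa>2 i)" for w
    using L unfolding kcover_def by blast
  have "i \<in> KV" "j \<in> KV" "i \<noteq> j" "\<kappa>2 j \<subseteq> \<kappa>2 i" using L unfolding kcover_def by blast+
  \<comment> \<open>Only the inner vertices can lie strictly between two others, so testing these
    three is enough.\<close>
  then show ?R using b[of "Inner 1"] b[of "Inner 2"] b[of "Inner 3"]
    unfolding KV_def by (elim insertE emptyE) simp_all
qed

lemma kcover_1: "kcover KV \<kappa>1 i j \<longleftrightarrow> (i, j) \<in> {(Root, Inner 1), (Inner 1, Inner 2), (Inner 1, Inner 3),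
    (Inner 2, Leaf 1), (Inner 2, Leaf 2), (Inner 3, Leaf 3), (Inner 3, Leaf 4)}" (is "?L = ?R")
proof
  assume ?R
  then show ?L unfolding kcover_def KV_def by (elim insertE emptyE) simp_all
next
  assume L: ?L
  have b: "\<not> (w \<in> KV \<and> w \<noteq> i \<and> w \<noteq> j \<and> \<kappa>1 j \<subseteq> \<kappa>1 w \<and> \<kappa>1 w \<subseteq> \<kappa>1 i)" for w
    using L unfolding kcover_def by blast
  have "i \<in> KV" "j \<in> KV" "i \<noteq> j" "\<kappa>1 j \<subseteq> \<kappa>1 i" using L unfolding kcover_def by blast+
  then show ?R using b[of "Inner 1"] b[of "Inner 2"] b[of "Inner 3"]
    unfolding KV_def by (elim insertE emptyE) simp_all
qed

lemma pairs_image: "{{i, j} | i j. (i, j) \<in> S} = (\<lambda>(i, j). {i, j}) ` S"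
  by auto

lemma K2_tree_edges: "edges K2_tree = {{i, j} | i j. kcover KV \<kappa>2 i j}"
  unfolding kcover_2 pairs_image K2_tree_def by simp

lemma K1_tree_edges: "edges K1_tree = {{i, j} | i j. kcover KV \<kappa>1 i j}"
  unfolding kcover_1 pairs_image K1_tree_def by simp

lemma K_verts: "verts K1_tree = KV" "verts K2_tree = KV"
  by (simp_all add: K1_tree_def K2_tree_def KV_def)

lemma \<kappa>1_inj: "inj_on \<kappa>1 KV"
proof (rule inj_onI)
  fix i j assume i: "i \<in> KV" "j \<in> KV" and e: "\<kappa>1 i = \<kappa>1 j"
  have m: "n \<in> \<kappa>1 i \<longleftrightarrow> n \<in> \<kappa>1 j" for n using e by simp
  show "i = j" using i m[of 1] m[of 2] m[of 3] m[of 4] m[of 5]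
    unfolding KV_def by (elim insertE emptyE) simp_all
qed

lemma \<kappa>2_inj: "inj_on \<kappa>2 KV"
proof (rule inj_onI)
  fix i j assume i: "i \<in> KV" "j \<in> KV" and e: "\<kappa>2 i = \<kappa>2 j"
  have m: "n \<in> \<kappa>2 i \<longleftrightarrow> n \<in> \<kappa>2 j" for n using e by simp
  show "i = j" using i m[of 1] m[of 2] m[of 3] m[of 4] m[of 5]
    unfolding KV_def by (elim insertE emptyE) simp_all
qed

locale labelled = bintree t for t :: "'v rtree" +
  fixes M :: "'m set" and lab :: "'m \<Rightarrow> 'v"
  assumes finite_labels: "finite M" and lab: "bij_betw lab M (leaves t)"
begin

definition cl :: "'v \<Rightarrow> 'm set" where "cl v = {m \<in> M. anc t v (lab m)}"
definition sd :: "'v \<Rightarrow> 'm \<Rightarrow> bool" where "sd v m = anc t (left v) (lab m)"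

sublocale H: hierarchy "inodes t" cl sd M
  using hierarchy_of_tree[OF finite_labels lab] unfolding cl_def sd_def .

lemma lab_leaf: "m \<in> M \<Longrightarrow> lab m \<in> leaves t"
  using lab by (auto simp: bij_betw_def)

lemma lab_inj: "x \<in> M \<Longrightarrow> y \<in> M \<Longrightarrow> lab x = lab y \<Longrightarrow> x = y"
  using lab by (meson bij_betw_def inj_onD)

end

locale sublabelled = labelled t M lab for t :: "'v rtree" and M :: "'m set" and lab +
  fixes Z :: "'m set"
  assumes Z: "Z \<subseteq> M" "Z \<noteq> {}"
begin

sublocale leaf_set t "lab ` Z"
  using Z lab_leaf by unfold_locales auto

definition B :: "'v \<Rightarrow> 'm set" where "B v = {z \<in> Z. anc t v (lab z)}"

lemma B_cl: "B v = Z \<inter> cl v"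
  using Z by (auto simp: B_def cl_def)

lemma surv_inode:
  assumes v: "v \<in> inodes t"
  shows "children t v \<subseteq> used \<longleftrightarrow> (\<exists>x\<in>Z. \<exists>y\<in>Z. H.splits v x y)"
proof
  have vv: "v \<in> verts t" using v inodes_verts by blast
  obtain c where c: "children t v = {left v, c}" "c \<noteq> left v" using right_child[OF v] by blast
  have av: "anc t v (left v)" "anc t v c" using c childD[OF _ vv] by blast+
  {
    assume "children t v \<subseteq> used"
    then obtain x y where xy: "x \<in> Z" "y \<in> Z" "anc t (left v) (lab x)" "anc t c (lab y)"
      using c unfolding used_def by auto
    moreover have "\<not> anc t (left v) (lab y)" using child_unique[of c v "left v" "lab y"] c xy by auto
    ultimately have "H.splits v x y"
      using v Z av anc_trans unfolding H.splits_def cl_def sd_def by blast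
    then show "\<exists>x\<in>Z. \<exists>y\<in>Z. H.splits v x y" using xy by blast
  }
  assume "\<exists>x\<in>Z. \<exists>y\<in>Z. H.splits v x y"
  then obtain x y where xy: "x \<in> Z" "y \<in> Z" "anc t (left v) (lab x)" "\<not> anc t (left v) (lab y)" "anc t v (lab y)"
    unfolding H.splits_def cl_def sd_def by blast
  have "v \<noteq> lab y" using v inodes_verts lab_leaf Z xy by blast
  then obtain d where "d \<in> children t v" "anc t d (lab y)" using child_towards xy by blast
  then have "anc t c (lab y)" using c xy by auto
  then show "children t v \<subseteq> used" using c xy unfolding used_def by auto
qed

lemma surv_cases: "surv v \<longleftrightarrow> v = root t \<or> v \<in> lab ` Z \<or> (\<exists>x\<in>Z. \<exists>y\<in>Z. H.splits v x y)"
  using surv_inode unfolding surv_def H.splits_def by blast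

text \<open>A surviving inner vertex has labels of \<open>Z\<close> below both children, so a proper
  descendant has strictly fewer. The root is excluded because its child may have the same labels
  below it.\<close>

lemma anc_B:
  assumes "surv u" "surv v" "u \<noteq> root t" "v \<noteq> root t"
  shows "anc t u v \<longleftrightarrow> B v \<subseteq> B u"
proof
  assume "anc t u v"
  then show "B v \<subseteq> B u" using anc_trans unfolding B_def by blast
next
  assume sub: "B v \<subseteq> B u"
  obtain z where z: "z \<in> Z" "anc t v (lab z)" using surv_used[OF assms(2)] unfolding used_def by blast
  then have "anc t u (lab z)" using sub unfolding B_def by blast
  then consider "anc t u v" | "anc t v u" "u \<noteq> v" using anc_chain z by blast
  then show "anc t u v"
  proof cases
    case 2
    then have "v \<notin> leaves t" using leaf_anc by blast
    then have "v \<notin> lab ` Z" using lab_leaf Z by blast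
    then obtain x y where xy: "x \<in> Z" "y \<in> Z" "H.splits v x y" using assms surv_cases by blast
    obtain c where c: "c \<in> children t v" "anc t c u" using child_towards 2 by blast
    have "x \<in> B u" "y \<in> B u" using sub xy Z unfolding B_cl H.splits_def by blast+
    then have "anc t c (lab x)" "anc t c (lab y)" using anc_trans c unfolding B_def by blast+
    then have False
      using xy(3) child_unique[OF c(1) left_child] unfolding H.splits_def sd_def by metis
    then show ?thesis ..
  qed
qed

text \<open>Both trees are Hasse diagrams, one of the ancestor order on the survivors, the other of
  inclusion of the sets \<open>\<kappa> k\<close>. Since \<open>g\<close> respects the two orders,
  it respects covers; \<open>l\<close> translates leaf indices into labels.\<close>

lemma induced_image:
  assumes K: "Root \<in> K" and \<kappa>: "\<And>k. k \<in> K \<Longrightarrow> k \<noteq> Root \<Longrightarrow> \<kappa> k \<subseteq> {1..4} \<and> 5 \<notin> \<kappa> k" "\<kappa> Root = {1..5}"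
    and inj: "inj_on \<kappa> K" and l: "inj_on l {1..4}"
    and g: "g Root = root t" "\<And>k. k \<in> K \<Longrightarrow> k \<noteq> Root \<Longrightarrow> surv (g k) \<and> g k \<noteq> root t \<and> B (g k) = l ` \<kappa> k"
    and surj: "\<And>v. surv v \<Longrightarrow> v \<noteq> root t \<Longrightarrow> v \<in> g ` K"
  shows "inj_on g K" "verts (induced_tree t (lab ` Z)) = g ` K"
    "edges (induced_tree t (lab ` Z)) = (`) g ` {{i, j} | i j. kcover K \<kappa> i j}"
proof -
  have s: "surv (g k)" if "k \<in> K" for k using g that by (cases "k = Root") (auto simp: surv_def)
  have img: "l ` \<kappa> j \<subseteq> l ` \<kappa> i \<longleftrightarrow> \<kappa> j \<subseteq> \<kappa> i" if "i \<in> K" "j \<in> K" "i \<noteq> Root" "j \<noteq> Root" for i j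
    by (rule inj_on_image_subset_iff[OF l]) (use \<kappa>(1)[OF that(1,3)] \<kappa>(1)[OF that(2,4)] in blast)+
  have ord: "anc t (g i) (g j) \<longleftrightarrow> \<kappa> j \<subseteq> \<kappa> i" if ij: "i \<in> K" "j \<in> K" for i j
  proof (cases "i = Root")
    case True
    have "\<kappa> j \<subseteq> {1..5}" using \<kappa> ij by (cases "j = Root") fastforce+
    then show ?thesis using True g anc_root s[OF ij(2)] surv_used used_verts \<kappa>(2) by metis
  next
    case i: False
    show ?thesis
    proof (cases "j = Root")
      case True
      have "\<not> anc t (g i) (root t)" using g(2)[OF ij(1) i] unfolding anc_iff rpath_root by simp
      moreover have "5 \<in> {1..5::nat}" by simp
      then have "\<not> {1..5} \<subseteq> \<kappa> i" using \<kappa>(1)[OF ij(1) i] by blast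
      ultimately show ?thesis using True g(1) \<kappa>(2) by simp
    next
      case False
      then show ?thesis using anc_B[of "g i" "g j"] g(2) ij i img by simp
    qed
  qed
  show gi: "inj_on g K"
  proof (rule inj_onI)
    fix i j assume ij: "i \<in> K" "j \<in> K" "g i = g j"
    have "g i \<in> verts t" using s[OF ij(1)] surv_used used_verts by blast
    then have "\<kappa> j \<subseteq> \<kappa> i" "\<kappa> i \<subseteq> \<kappa> j" using ord[of i j] ord[of j i] ij anc_refl by auto
    then show "i = j" using inj ij by (meson inj_onD subset_antisym)
  qed
  have sv: "{v. surv v} = g ` K"
  proof (intro set_eqI iffI)
    fix v assume "v \<in> {v. surv v}"
    then show "v \<in> g ` K" using surj[of v] g(1) K by (cases "v = root t") (metis imageI, simp)
  next
    fix v assume "v \<in> g ` K"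
    then show "v \<in> {v. surv v}" using s by auto
  qed
  then show "verts (induced_tree t (lab ` Z)) = g ` K" using verts_induced by simp
  have svD: "\<exists>k. w = g k \<and> k \<in> K" if "surv w" for w
  proof -
    have "w \<in> g ` K" using that sv by (metis mem_Collect_eq)
    then show ?thesis by auto
  qed
  have cov: "cover (g i) (g j) \<longleftrightarrow> kcover K \<kappa> i j" if ij: "i \<in> K" "j \<in> K" for i j
  proof -
    have "(\<exists>w. surv w \<and> w \<noteq> g i \<and> w \<noteq> g j \<and> anc t (g i) w \<and> anc t w (g j)) \<longleftrightarrow>
        (\<exists>w\<in>K. w \<noteq> i \<and> w \<noteq> j \<and> \<kappa> j \<subseteq> \<kappa> w \<and> \<kappa> w \<subseteq> \<kappa> i)" (is "?A = ?B")
    proof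
      assume ?A
      then obtain w where w: "surv w" "w \<noteq> g i" "w \<noteq> g j" "anc t (g i) w" "anc t w (g j)" by blast
      obtain k where k: "w = g k" "k \<in> K" using svD[OF w(1)] by blast
      have "k \<noteq> i" "k \<noteq> j" using w k by auto
      moreover have "\<kappa> j \<subseteq> \<kappa> k" "\<kappa> k \<subseteq> \<kappa> i" using w ord[OF ij(1) k(2)] ord[OF k(2) ij(2)] k(1) by auto
      ultimately show ?B using k(2) by blast
    next
      assume ?B
      then obtain k where k: "k \<in> K" "k \<noteq> i" "k \<noteq> j" "\<kappa> j \<subseteq> \<kappa> k" "\<kappa> k \<subseteq> \<kappa> i" by blast
      have "g k \<noteq> g i" "g k \<noteq> g j" using inj_onD[OF gi _ k(1)] k ij by metis+
      moreover have "anc t (g i) (g k)" "anc t (g k) (g j)"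
        using k ord[OF ij(1) k(1)] ord[OF k(1) ij(2)] by auto
      ultimately show ?A using s[OF k(1)] by blast
    qed
    moreover have "g i = g j \<longleftrightarrow> i = j" using inj_onD[OF gi _ ij] by auto
    ultimately show ?thesis using ij ord[OF ij] s unfolding cover_def kcover_def by simp
  qed
  show "edges (induced_tree t (lab ` Z)) = (`) g ` {{i, j} | i j. kcover K \<kappa> i j}"
  proof
    show "edges (induced_tree t (lab ` Z)) \<subseteq> (`) g ` {{i, j} | i j. kcover K \<kappa> i j}"
    proof
      fix e assume "e \<in> edges (induced_tree t (lab ` Z))"
      then obtain u v where e: "e = {u, v}" "cover u v" unfolding edges_induced by blast
      then have "surv u" "surv v" unfolding cover_def by simp_all
      then obtain i j where "u = g i" "v = g j" "i \<in> K" "j \<in> K" using svD[of u] svD[of v] by auto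
      then have "e = g ` {i, j}" "kcover K \<kappa> i j" using e cov by auto
      then show "e \<in> (`) g ` {{i, j} | i j. kcover K \<kappa> i j}" by blast
    qed
    show "(`) g ` {{i, j} | i j. kcover K \<kappa> i j} \<subseteq> edges (induced_tree t (lab ` Z))"
    proof
      fix e assume "e \<in> (`) g ` {{i, j} | i j. kcover K \<kappa> i j}"
      then obtain i j where "e = g ` {i, j}" "kcover K \<kappa> i j" by blast
      then have "e = {g i, g j}" "cover (g i) (g j)" using cov unfolding kcover_def by auto
      then show "e \<in> edges (induced_tree t (lab ` Z))" unfolding edges_induced by blast
    qed
  qed
qed

lemma B_leaf: "x \<in> Z \<Longrightarrow> B (lab x) = {x}"
proof -
  assume x: "x \<in> Z"
  then have l: "lab x \<in> leaves t" using lab_leaf Z by blast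
  have "z = x" if "z \<in> Z" "anc t (lab x) (lab z)" for z
    using lab_inj[of z x] leaf_anc[OF l that(2)] that(1) x Z by blast
  moreover have "anc t (lab x) (lab x)" using anc_refl[OF leaf_verts[OF l]] .
  ultimately show ?thesis using x unfolding B_def by blast
qed

lemma surv_leaf: "x \<in> Z \<Longrightarrow> surv (lab x) \<and> lab x \<noteq> root t"
proof -
  assume x: "x \<in> Z"
  then have "lab x \<in> leaves t" using lab_leaf Z by blast
  then show ?thesis using surv_cases[of "lab x"] leaf_iff[of "lab x"] x by blast
qed

lemma surv_node: "H.splits v x y \<Longrightarrow> x \<in> Z \<Longrightarrow> y \<in> Z \<Longrightarrow> surv v \<and> v \<noteq> root t"
  using surv_cases inodes_verts unfolding H.splits_def by blast

text \<open>The common part of both shapes: four labels are split by three vertices only, so these,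
  the root and the four leaves are all survivors, and just their label sets remain to be compared
  with \<open>\<kappa>\<close>.\<close>

lemma image_of_nodes:
  assumes Zq: "Z = {p, q, r, s}" "distinct [p, q, r, s]"
    and K: "verts K = KV" "edges K = {{i, j} | i j. kcover KV \<kappa> i j}" "root K = Root" "inj_on \<kappa> KV"
      "\<kappa> Root = {1,2,3,4,5}" "\<And>n. \<kappa> (Leaf n) = {n}" "\<kappa> (Inner 1) = {1,2,3,4}"
      "\<kappa> (Inner 2) \<subseteq> {1,2,3,4}" "\<kappa> (Inner 3) \<subseteq> {1,2,3,4}"
    and l: "l 1 = p" "l 2 = q" "l 3 = r" "l (4::nat) = s"
    and n: "H.splits n1 x1 y1" "H.splits n2 x2 y2" "H.splits n3 x3 y3" "{x1, y1, x2, y2, x3, y3} \<subseteq> Z"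
    and B: "B n1 = l ` {1,2,3,4}" "B n2 = l ` \<kappa> (Inner 2)" "B n3 = l ` \<kappa> (Inner 3)"
    and all: "\<And>v x y. H.splits v x y \<Longrightarrow> x \<in> Z \<Longrightarrow> y \<in> Z \<Longrightarrow> v = n1 \<or> v = n2 \<or> v = n3"
  shows "\<exists>g. tree_image g K (induced_tree t (lab ` Z)) \<and>
    g (Leaf 1) = lab p \<and> g (Leaf 2) = lab q \<and> g (Leaf 3) = lab r \<and> g (Leaf 4) = lab s"
proof -
  define g where "g = (\<lambda>k. case k of Root \<Rightarrow> root t
    | Inner m \<Rightarrow> if m = 1 then n1 else if m = 2 then n2 else n3 | Leaf m \<Rightarrow> lab (l m))"
  have g: "g Root = root t" "g (Inner 1) = n1" "g (Inner 2) = n2" "g (Inner 3) = n3"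
    "g (Leaf 1) = lab p" "g (Leaf 2) = lab q" "g (Leaf 3) = lab r" "g (Leaf 4) = lab s"
    using l by (simp_all add: g_def)
  have e: "{1..4} = {1,2,3,4::nat}" "{1..5} = {1,2,3,4,5::nat}" by auto
  have r1: "Root \<in> KV" by (simp add: KV_def)
  have r2: "\<kappa> k \<subseteq> {1..4} \<and> 5 \<notin> \<kappa> k" if "k \<in> KV" "k \<noteq> Root" for k
  proof -
    have sub: "\<kappa> k \<subseteq> {1,2,3,4}"
      using that K(6-9) unfolding KV_def by (elim insertE emptyE) simp_all
    have "5 \<notin> {1,2,3,4::nat}" by simp
    then show ?thesis using sub unfolding e by blast
  qed
  have r3: "\<kappa> Root = {1..5}" using K(5) e by simp
  have r4: "inj_on l {1..4}" unfolding e using Zq(2) l by (auto simp: inj_on_def)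
  have r5: "surv (g k) \<and> g k \<noteq> root t \<and> B (g k) = l ` \<kappa> k" if k: "k \<in> KV" "k \<noteq> Root" for k
  proof -
    consider "k = Inner 1" | "k = Inner 2" | "k = Inner 3" | "k = Leaf 1" | "k = Leaf 2" | "k = Leaf 3" | "k = Leaf 4"
      using k unfolding KV_def by blast
    then show ?thesis
    proof cases
      case 1 then show ?thesis using surv_node[OF n(1)] n(4) B g K by simp
    next
      case 2 then show ?thesis using surv_node[OF n(2)] n(4) B g K by simp
    next
      case 3 then show ?thesis using surv_node[OF n(3)] n(4) B g K by simp
    next
      case 4 then show ?thesis using surv_leaf[of p] B_leaf[of p] Zq(1) g K l by simp
    next
      case 5 then show ?thesis using surv_leaf[of q] B_leaf[of q] Zq(1) g K l by simp
    next
      case 6 then show ?thesis using surv_leaf[of r] B_leaf[of r] Zq(1) g K l by simp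
    next
      case 7 then show ?thesis using surv_leaf[of s] B_leaf[of s] Zq(1) g K l by simp
    qed
  qed
  have gK: "g ` KV = {root t, n1, n2, n3, lab p, lab q, lab r, lab s}"
    unfolding KV_def image_insert g image_empty by blast
  have r6: "v \<in> g ` KV" if v: "surv v" "v \<noteq> root t" for v
  proof (cases "v \<in> lab ` Z")
    case True
    then show ?thesis unfolding gK Zq(1) by blast
  next
    case False
    then obtain x y where "x \<in> Z" "y \<in> Z" "H.splits v x y" using v surv_cases by blast
    then show ?thesis unfolding gK using all by blast
  qed
  have "tree_image g K (induced_tree t (lab ` Z))"
    using induced_image[of KV \<kappa> l g, OF r1 r2 r3 K(4) r4 g(1) r5 r6] K(1-3) g(1) root_induced
    unfolding tree_image_def by simp
  then show ?thesis using g by blast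
qed

lemma caterpillar_image:
  assumes c: "H.caterpillar p q r s" "r \<noteq> s" and Zq: "Z = {p, q, r, s}"
  shows "\<exists>g. tree_image g K2_tree (induced_tree t (lab ` Z)) \<and>
    g (Leaf 1) = lab p \<and> g (Leaf 2) = lab q \<and> g (Leaf 3) = lab r \<and> g (Leaf 4) = lab s"
proof -
  obtain n1 n2 where n1: "H.splits n1 p q" "H.splits n1 p r" "H.splits n1 p s"
    and n2: "H.splits n2 q r" "H.splits n2 q s" using c(1) unfolding H.caterpillar_def by blast
  obtain n3 where n3: "H.splits n3 r s" using H.splits_exists[of r s] n2 H.splitsD c(2) by blast
  have d: "distinct [p, q, r, s]" using n1 n2 c(2) H.splitsD by auto
  define l where "l = (\<lambda>i::nat. if i = 1 then p else if i = 2 then q else if i = 3 then r else s)"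
  have out: "p \<notin> cl n2" "p \<notin> cl n3" "q \<notin> cl n3"
    using H.excluded[OF n1(1,2) n2(1)] H.excluded[OF n1(2,3) n3] H.excluded[OF n2(1,2) n3] by blast+
  have ins: "{p, q, r, s} \<subseteq> cl n1" "{q, r, s} \<subseteq> cl n2" "{r, s} \<subseteq> cl n3"
    using n1 n2 n3 unfolding H.splits_def by blast+
  have inter: "Z \<inter> cl n1 = {p, q, r, s}" "Z \<inter> cl n2 = {q, r, s}" "Z \<inter> cl n3 = {r, s}"
    using out ins Zq by auto
  show ?thesis
  proof (rule image_of_nodes[where \<kappa> = \<kappa>2 and l = l and ?n1.0 = n1 and ?n2.0 = n2 and ?n3.0 = n3])
    show "H.splits n1 p q" "H.splits n2 q r" "H.splits n3 r s" by fact+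
    show "{p, q, q, r, r, s} \<subseteq> Z" using Zq by blast
    show "B n1 = l ` {1,2,3,4}" "B n2 = l ` \<kappa>2 (Inner 2)" "B n3 = l ` \<kappa>2 (Inner 3)"
      by (simp_all add: B_cl inter l_def insert_commute)
    show "v = n1 \<or> v = n2 \<or> v = n3" if "H.splits v x y" "x \<in> Z" "y \<in> Z" for v x y
      using that H.splits_unique[of v] n1 n2 n3 H.splits_sym H.splitsD[OF that(1)] unfolding Zq
      by (elim insertE emptyE) metis+
  qed (use Zq d K_verts K2_tree_edges \<kappa>2_inj in \<open>auto simp: l_def K2_tree_def\<close>)
qed

lemma balanced_image:
  assumes b: "H.balanced p q r s" "p \<noteq> q" "r \<noteq> s" and Zq: "Z = {p, q, r, s}"
  shows "\<exists>g. tree_image g K1_tree (induced_tree t (lab ` Z)) \<and>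
    g (Leaf 1) = lab p \<and> g (Leaf 2) = lab q \<and> g (Leaf 3) = lab r \<and> g (Leaf 4) = lab s"
proof -
  obtain n1 where n1: "H.splits n1 p r" "H.splits n1 p s" "H.splits n1 q r" "H.splits n1 q s"
    using b(1) unfolding H.balanced_def by blast
  obtain n2 where n2: "H.splits n2 p q" using H.splits_exists[of p q] n1 H.splitsD b(2) by blast
  obtain n3 where n3: "H.splits n3 r s" using H.splits_exists[of r s] n1 H.splitsD b(3) by blast
  have d: "distinct [p, q, r, s]" using n1 b H.splitsD by auto
  define l where "l = (\<lambda>i::nat. if i = 1 then p else if i = 2 then q else if i = 3 then r else s)"
  have out: "r \<notin> cl n2" "s \<notin> cl n2" "p \<notin> cl n3" "q \<notin> cl n3"
    using H.excluded[of n1 r p q n2] H.excluded[of n1 s p q n2] H.excluded[of n1 p r s n3] H.excluded[of n1 q r s n3]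
      n1 n2 n3 H.splits_sym by blast+
  have ins: "{p, q, r, s} \<subseteq> cl n1" "{p, q} \<subseteq> cl n2" "{r, s} \<subseteq> cl n3"
    using n1 n2 n3 unfolding H.splits_def by blast+
  have inter: "Z \<inter> cl n1 = {p, q, r, s}" "Z \<inter> cl n2 = {p, q}" "Z \<inter> cl n3 = {r, s}"
    using out ins Zq by auto
  show ?thesis
  proof (rule image_of_nodes[where \<kappa> = \<kappa>1 and l = l and ?n1.0 = n1 and ?n2.0 = n2 and ?n3.0 = n3])
    show "H.splits n1 p r" "H.splits n2 p q" "H.splits n3 r s" by fact+
    show "{p, r, p, q, r, s} \<subseteq> Z" using Zq by blast
    show "B n1 = l ` {1,2,3,4}" "B n2 = l ` \<kappa>1 (Inner 2)" "B n3 = l ` \<kappa>1 (Inner 3)"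
      by (simp_all add: B_cl inter l_def insert_commute)
    show "v = n1 \<or> v = n2 \<or> v = n3" if "H.splits v x y" "x \<in> Z" "y \<in> Z" for v x y
      using that H.splits_unique[of v] n1 n2 n3 H.splits_sym H.splitsD[OF that(1)] unfolding Zq
      by (elim insertE emptyE) metis+
  qed (use Zq d K_verts K1_tree_edges \<kappa>1_inj in \<open>auto simp: l_def K1_tree_def\<close>)
qed

end

section \<open>Isomorphisms and the copies of K1 and K2 in a tanglegram\<close>

lemma isomorphic_of_images:
  assumes L: "tree_image gL (left_tree K) (left_tree I)" and R: "tree_image gR (right_tree K) (right_tree I)"
    and M: "matching I = map_prod gL gR ` matching K"
    and K: "edges (left_tree K) \<subseteq> Pow (verts (left_tree K))" "edges (right_tree K) \<subseteq> Pow (verts (right_tree K))"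
      "matching K \<subseteq> verts (left_tree K) \<times> verts (right_tree K)" 
      "root (left_tree K) \<in> verts (left_tree K)" "root (right_tree K) \<in> verts (right_tree K)"
  shows "tanglegram_isomorphic I K"
proof -
  let ?G = "tanglegram_graph K" and ?H = "tanglegram_graph I"
  define g where "g = map_sum gL gR"
  have inj: "inj_on g (verts ?G)"
  proof (rule inj_onI)
    fix x y assume "x \<in> verts ?G" "y \<in> verts ?G" "g x = g y"
    then show "x = y"
      using L R unfolding tree_image_def tanglegram_graph_def g_def
      by (cases x; cases y) (auto dest: inj_onD)
  qed
  have v: "verts ?H = g ` verts ?G"
    using L R unfolding tree_image_def tanglegram_graph_def g_def by (simp add: image_Un image_image)
  have e: "edges ?H = (`) g ` edges ?G"
  proof -
    have 1: "(`) Inl ` edges (left_tree I) = (`) g ` ((`) Inl ` edges (left_tree K))"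
      using L unfolding tree_image_def g_def by (simp add: image_image)
    have 2: "(`) Inr ` edges (right_tree I) = (`) g ` ((`) Inr ` edges (right_tree K))"
      using R unfolding tree_image_def g_def by (simp add: image_image)
    have p: "{{Inl x, Inr y} | x y. (x, y) \<in> S} = (\<lambda>(x, y). {Inl x, Inr y}) ` S" for S :: "('p \<times> 'q) set"
      by auto
    have 3: "{{Inl x, Inr y} | x y. (x, y) \<in> matching I} = (`) g ` {{Inl x, Inr y} | x y. (x, y) \<in> matching K}"
      unfolding p M g_def by (simp add: image_image case_prod_beta)
    show ?thesis unfolding tanglegram_graph_def graph.simps image_Un 1 2 3 ..
  qed
  have sub: "edges ?G \<subseteq> Pow (verts ?G)"
  proof
    fix e assume "e \<in> edges ?G"
    then consider e0 where "e = Inl ` e0" "e0 \<in> edges (left_tree K)" | e0 where "e = Inr ` e0" "e0 \<in> edges (right_tree K)"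
      | x y where "e = {Inl x, Inr y}" "(x, y) \<in> matching K"
      unfolding tanglegram_graph_def by auto
    then show "e \<in> Pow (verts ?G)"
    proof cases
      case 1
      then have "e0 \<subseteq> verts (left_tree K)" using K(1) by blast
      then show ?thesis using 1 unfolding tanglegram_graph_def by (simp add: image_mono le_supI1)
    next
      case 2
      then have "e0 \<subseteq> verts (right_tree K)" using K(2) by blast
      then show ?thesis using 2 unfolding tanglegram_graph_def by (simp add: image_mono le_supI2)
    next
      case 3
      then have "x \<in> verts (left_tree K)" "y \<in> verts (right_tree K)" using K(3) by blast+
      then show ?thesis using 3 unfolding tanglegram_graph_def by simp
    qed
  qed
  \<comment> \<open>The two tree maps go from the model \<open>K\<close> to \<open>I\<close>; the
    required isomorphism is the inverse of their sum.\<close>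
  define f where "f = inv_into (verts ?G) g"
  have fg: "f (g x) = x" if "x \<in> verts ?G" for x using inj that unfolding f_def by simp
  have "graph_iso f ?H ?G"
    unfolding graph_iso_def
  proof (intro conjI ballI)
    show "bij_betw f (verts ?H) (verts ?G)"
      unfolding v f_def using inj by (simp add: bij_betw_inv_into inj_on_imp_bij_betw)
    fix x y assume "x \<in> verts ?H" "y \<in> verts ?H"
    then obtain a b where ab: "x = g a" "y = g b" "a \<in> verts ?G" "b \<in> verts ?G" unfolding v by blast
    have "{g a, g b} \<in> edges ?H \<longleftrightarrow> {a, b} \<in> edges ?G"
    proof
      assume "{g a, g b} \<in> edges ?H"
      then obtain ed where ed: "ed \<in> edges ?G" "g ` ed = g ` {a, b}" unfolding e by auto
      \<comment> \<open>\<open>g\<close> is injective on vertices only, hence the need for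
        \<open>sub\<close>.\<close>
      then have "ed = {a, b}" using inj_on_image_eq_iff[OF inj, of ed "{a, b}"] sub ab by blast
      then show "{a, b} \<in> edges ?G" using ed by simp
    next
      assume "{a, b} \<in> edges ?G"
      then show "{g a, g b} \<in> edges ?H" unfolding e by (rule image_eqI[rotated]) simp
    qed
    then show "{x, y} \<in> edges ?H \<longleftrightarrow> {f x, f y} \<in> edges ?G" using ab fg by simp
  qed
  moreover have "f (Inl (root (left_tree I))) = Inl (root (left_tree K))"
    using fg[of "Inl (root (left_tree K))"] L K unfolding tree_image_def g_def tanglegram_graph_def by simp
  moreover have "f (Inr (root (right_tree I))) = Inr (root (right_tree K))"
    using fg[of "Inr (root (right_tree K))"] R K unfolding tree_image_def g_def tanglegram_graph_def by simp
  ultimately show ?thesis unfolding tanglegram_isomorphic_def by blast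
qed

lemma matching_finite: "is_tanglegram T \<Longrightarrow> finite (matching T)"
proof -
  assume "is_tanglegram T"
  then have "matching T \<subseteq> verts (left_tree T) \<times> verts (right_tree T)" "finite (verts (left_tree T))" "finite (verts (right_tree T))"
    unfolding is_tanglegram_def perfect_matching_def leaves_def rooted_binary_tree_def rooted_tree_def is_tree_def simple_graph_def
    by blast+
  then show ?thesis by (meson finite_SigmaI finite_subset)
qed

lemma labelled_left:
  assumes "is_tanglegram T"
  shows "labelled (left_tree T) (matching T) fst"
proof unfold_locales
  show "finite (matching T)" by (rule matching_finite[OF assms])
  show "rooted_tree (left_tree T)" "rooted_binary_tree (left_tree T)"
    using assms by (auto simp: is_tanglegram_def rooted_binary_tree_def)
  have "perfect_matching (matching T) (leaves (left_tree T)) (leaves (right_tree T))"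
    using assms by (simp add: is_tanglegram_def)
  then show "bij_betw fst (matching T) (leaves (left_tree T))"
    unfolding perfect_matching_def bij_betw_def by (force simp: inj_on_def)
qed

lemma labelled_right:
  assumes "is_tanglegram T"
  shows "labelled (right_tree T) (matching T) snd"
proof unfold_locales
  show "finite (matching T)" by (rule matching_finite[OF assms])
  show "rooted_tree (right_tree T)" "rooted_binary_tree (right_tree T)"
    using assms by (auto simp: is_tanglegram_def rooted_binary_tree_def)
  have "perfect_matching (matching T) (leaves (left_tree T)) (leaves (right_tree T))"
    using assms by (simp add: is_tanglegram_def)
  then show "bij_betw snd (matching T) (leaves (right_tree T))"
    unfolding perfect_matching_def bij_betw_def by (force simp: inj_on_def)
qed

context leaf_set
begin

lemma cover_unique: "cover u v \<Longrightarrow> cover u' v \<Longrightarrow> u = u'"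
  using anc_chain[of u v u'] unfolding cover_def by blast

lemma cover_root: "\<not> cover w (root t)"
  unfolding cover_def anc_iff rpath_root by auto

lemma cover_leaf: "v \<in> S \<Longrightarrow> \<not> cover v w"
  using leaf_anc S_leaves unfolding cover_def by blast

lemma cover_skip: "cover u v \<Longrightarrow> anc t u w \<Longrightarrow> surv w \<Longrightarrow> w \<noteq> u \<Longrightarrow> w \<noteq> v \<Longrightarrow> \<not> anc t w v"
  unfolding cover_def by blast

text \<open>An isomorphism might a priori mix the two trees. Starting from the fixed root, an inner
  vertex of \<open>K2\<close> has three neighbours, so its image is not a leaf, which has only a
  parent and a mate. Then all neighbours of the image lie in the same tree, the unique parent is
  already taken, and the remaining ones must be children.\<close>

lemma K2_embedding:
  fixes \<phi> :: "kvertex \<Rightarrow> 'x" and \<iota> :: "'v \<Rightarrow> 'x" and adj :: "'x \<Rightarrow> 'x \<Rightarrow> bool"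
  assumes i: "inj \<iota>" "inj_on \<phi> KV" "\<phi> Root = \<iota> (root t)"
    and edge: "\<And>i j. {i, j} \<in> edges K2_tree \<Longrightarrow> adj (\<phi> i) (\<phi> j)"
    and nb: "\<And>v y. adj (\<iota> v) y \<Longrightarrow> (\<exists>w. y = \<iota> w \<and> {v, w} \<in> edges (induced_tree t S)) \<or> (v \<in> S \<and> y = mate v)"
  obtains n where "\<And>k. k \<in> KV \<Longrightarrow> \<phi> k = \<iota> (n k)"
    "cover (n Root) (n (Inner 1))" "cover (n (Inner 1)) (n (Leaf 1))" "cover (n (Inner 1)) (n (Inner 2))"
    "cover (n (Inner 2)) (n (Leaf 2))" "cover (n (Inner 2)) (n (Inner 3))"
    "cover (n (Inner 3)) (n (Leaf 3))" "cover (n (Inner 3)) (n (Leaf 4))"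
proof -
  have ed: "adj (\<phi> Root) (\<phi> (Inner 1))" "adj (\<phi> (Inner 1)) (\<phi> Root)" "adj (\<phi> (Inner 1)) (\<phi> (Leaf 1))" "adj (\<phi> (Inner 1)) (\<phi> (Inner 2))"
    "adj (\<phi> (Inner 2)) (\<phi> (Inner 1))" "adj (\<phi> (Inner 2)) (\<phi> (Leaf 2))" "adj (\<phi> (Inner 2)) (\<phi> (Inner 3))"
    "adj (\<phi> (Inner 3)) (\<phi> (Inner 2))" "adj (\<phi> (Inner 3)) (\<phi> (Leaf 3))" "adj (\<phi> (Inner 3)) (\<phi> (Leaf 4))"
    by (rule edge; simp add: K2_tree_def insert_commute)+
  have ne: "\<phi> a \<noteq> \<phi> b" if "a \<in> KV" "b \<in> KV" "a \<noteq> b" for a b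
    using i(2) that by (meson inj_onD)
  have kv: "Root \<in> KV" "Inner 1 \<in> KV" "Inner 2 \<in> KV" "Inner 3 \<in> KV" "Leaf 1 \<in> KV" "Leaf 2 \<in> KV" "Leaf 3 \<in> KV" "Leaf 4 \<in> KV"
    by (simp_all add: KV_def)
  have edc: "cover v w \<or> cover w v" if vw: "{v, w} \<in> edges (induced_tree t S)" for v w
  proof -
    obtain x y where "{v, w} = {x, y}" "cover x y" using vw unfolding edges_induced by blast
    then show ?thesis by (auto simp: doubleton_eq_iff)
  qed
  have step: "\<exists>w. y = \<iota> w \<and> cover v w" if v: "v \<notin> S" "adj (\<iota> v) y" "\<And>u. cover u v \<Longrightarrow> y \<noteq> \<iota> u" for v y
  proof -
    obtain w where w: "y = \<iota> w" "{v, w} \<in> edges (induced_tree t S)" using nb[OF v(2)] v(1) by blast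
    then show ?thesis using edc[OF w(2)] v(3)[of w] by blast
  qed
  \<comment> \<open>A chosen leaf covers nothing and is covered once, so together with its mate it
    has at most two neighbours.\<close>
  have three: "v \<notin> S" if a: "adj (\<iota> v) y1" "adj (\<iota> v) y2" "adj (\<iota> v) y3" and d: "y1 \<noteq> y2" "y1 \<noteq> y3" "y2 \<noteq> y3" for v y1 y2 y3
  proof
    assume v: "v \<in> S"
    have *: "(\<exists>w. y = \<iota> w \<and> cover w v) \<or> y = mate v" if "adj (\<iota> v) y" for y
      using nb[OF that] edc cover_leaf[OF v] by blast
    show False using *[OF a(1)] *[OF a(2)] *[OF a(3)] d cover_unique by metis
  qed
  have rS: "root t \<notin> S" using S_leaves leaf_iff by blast
  obtain n1 where n1: "\<phi> (Inner 1) = \<iota> n1" "cover (root t) n1"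
    using step[OF rS, of "\<phi> (Inner 1)"] ed(1) i(3) cover_root by auto
  have n1S: "n1 \<notin> S"
    using three[of n1 "\<phi> Root" "\<phi> (Leaf 1)" "\<phi> (Inner 2)"] ed n1(1) ne kv by simp
  have c1: "u = root t" if "cover u n1" for u using cover_unique that n1(2) by blast
  have c1': "\<phi> k \<noteq> \<iota> u" if "cover u n1" "k \<in> KV" "k \<noteq> Root" for k u
    using c1[OF that(1)] i(3) ne[OF that(2) kv(1) that(3)] by simp
  obtain l1 where l1: "\<phi> (Leaf 1) = \<iota> l1" "cover n1 l1"
    using step[OF n1S, of "\<phi> (Leaf 1)"] ed(3) n1(1) c1'[of _ "Leaf 1"] kv by auto
  obtain n2 where n2: "\<phi> (Inner 2) = \<iota> n2" "cover n1 n2"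
    using step[OF n1S, of "\<phi> (Inner 2)"] ed(4) n1(1) c1'[of _ "Inner 2"] kv by auto
  have n2S: "n2 \<notin> S"
    using three[of n2 "\<phi> (Inner 1)" "\<phi> (Leaf 2)" "\<phi> (Inner 3)"] ed n2(1) ne kv by simp
  have c2': "\<phi> k \<noteq> \<iota> u" if "cover u n2" "k \<in> KV" "k \<noteq> Inner 1" for k u
    using cover_unique[OF that(1) n2(2)] n1(1) ne[OF that(2) kv(2) that(3)] by simp
  obtain l2 where l2: "\<phi> (Leaf 2) = \<iota> l2" "cover n2 l2"
    using step[OF n2S, of "\<phi> (Leaf 2)"] ed(6) n2(1) c2'[of _ "Leaf 2"] kv by auto
  obtain n3 where n3: "\<phi> (Inner 3) = \<iota> n3" "cover n2 n3"
    using step[OF n2S, of "\<phi> (Inner 3)"] ed(7) n2(1) c2'[of _ "Inner 3"] kv by auto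
  have n3S: "n3 \<notin> S"
    using three[of n3 "\<phi> (Inner 2)" "\<phi> (Leaf 3)" "\<phi> (Leaf 4)"] ed n3(1) ne kv by simp
  have c3': "\<phi> k \<noteq> \<iota> u" if "cover u n3" "k \<in> KV" "k \<noteq> Inner 2" for k u
    using cover_unique[OF that(1) n3(2)] n2(1) ne[OF that(2) kv(3) that(3)] by simp
  obtain l3 where l3: "\<phi> (Leaf 3) = \<iota> l3" "cover n3 l3"
    using step[OF n3S, of "\<phi> (Leaf 3)"] ed(9) n3(1) c3'[of _ "Leaf 3"] kv by auto
  obtain l4 where l4: "\<phi> (Leaf 4) = \<iota> l4" "cover n3 l4"
    using step[OF n3S, of "\<phi> (Leaf 4)"] ed(10) n3(1) c3'[of _ "Leaf 4"] kv by auto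
  define n where "n = (\<lambda>k. case k of Root \<Rightarrow> root t
    | Inner m \<Rightarrow> if m = 1 then n1 else if m = 2 then n2 else n3
    | Leaf m \<Rightarrow> if m = 1 then l1 else if m = 2 then l2 else if m = 3 then l3 else l4)"
  have nn: "n Root = root t" "n (Inner 1) = n1" "n (Inner 2) = n2" "n (Inner 3) = n3"
    "n (Leaf 1) = l1" "n (Leaf 2) = l2" "n (Leaf 3) = l3" "n (Leaf 4) = l4"
    by (simp_all add: n_def)
  have "\<phi> k = \<iota> (n k)" if kk: "k \<in> KV" for k
  proof -
    consider "k = Root" | "k = Inner 1" | "k = Inner 2" | "k = Inner 3" | "k = Leaf 1" | "k = Leaf 2" | "k = Leaf 3" | "k = Leaf 4"
      using kk unfolding KV_def by blast
    then show ?thesis by cases (simp_all only: nn n1 n2 n3 l1 l2 l3 l4 i)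
  qed
  then show thesis using that[of n] nn n1 n2 n3 l1 l2 l3 l4 by simp
qed

end

context sublabelled
begin

text \<open>If \<open>n2\<close> were above the leaf of \<open>p\<close>, it would lie between this
  leaf and the vertex \<open>n1\<close> that covers it; likewise for \<open>n3\<close> and
  \<open>q\<close>. So \<open>n2\<close> and \<open>n3\<close> provide the two clusters for
  \<open>caterpillarI\<close>.\<close>

lemma caterpillar_of_embedding:
  assumes c: "cover n0 n1" "cover n1 (lab p)" "cover n1 n2" "cover n2 (lab q)" "cover n2 n3" "cover n3 (lab r)" "cover n3 (lab s)"
    and m: "p \<in> M" "q \<in> M" "r \<in> M" "s \<in> M" and d: "n2 \<noteq> lab p" "n3 \<noteq> lab q"
  shows "H.caterpillar p q r s"
proof -
  have a: "anc t n2 (lab q)" "anc t n2 n3" "anc t n3 (lab r)" "anc t n3 (lab s)" "n2 \<noteq> n1" "n3 \<noteq> n2" "surv n2" "surv n3"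
    "anc t n1 n2" "n3 \<noteq> lab r"
    using c unfolding cover_def by blast+
  have x: "\<not> anc t n2 (lab p)" using cover_skip[OF c(2) a(9,7,5) d(1)] .
  have y: "\<not> anc t n3 (lab q)" using cover_skip[OF c(4) a(2,8,6) d(2)] .
  have nl: "n2 \<notin> leaves t" "n3 \<notin> leaves t" using leaf_anc a by blast+
  have nr: "n2 \<noteq> root t" "n3 \<noteq> root t" using c cover_root by blast+
  have V: "n2 \<in> inodes t" "n3 \<in> inodes t" using nl nr a anc_verts by (auto simp: inodes_def)
  have "anc t n2 (lab r)" "anc t n2 (lab s)" using a anc_trans by blast+
  then show ?thesis using H.caterpillarI[OF V m(1), of q r s] x y m a unfolding cl_def by blast
qed

end

lemma edge_in_image: "inj \<iota> \<Longrightarrow> {\<iota> v, y} \<in> (`) \<iota> ` E \<longleftrightarrow> (\<exists>w. y = \<iota> w \<and> {v, w} \<in> E)"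
proof
  assume i: "inj \<iota>" and "{\<iota> v, y} \<in> (`) \<iota> ` E"
  then obtain e where e: "{\<iota> v, y} = \<iota> ` e" "e \<in> E" by blast
  then obtain w where w: "y = \<iota> w" by blast
  then have "\<iota> ` {v, w} = \<iota> ` e" using e by simp
  then have "{v, w} = e" by (metis i inj_image_eq_iff)
  then show "\<exists>w. y = \<iota> w \<and> {v, w} \<in> E" using w e by blast
next
  assume "\<exists>w. y = \<iota> w \<and> {v, w} \<in> E"
  then obtain w where w: "{\<iota> v, y} = \<iota> ` {v, w}" "{v, w} \<in> E" by auto
  then show "{\<iota> v, y} \<in> (`) \<iota> ` E" by (rule image_eqI)
qed

lemma left_nbr: "{Inl v, y} \<in> edges (tanglegram_graph I) \<longleftrightarrow>
    (\<exists>w. y = Inl w \<and> {v, w} \<in> edges (left_tree I)) \<or> (\<exists>w. y = Inr w \<and> (v, w) \<in> matching I)"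
proof -
  have "{Inl v, y} \<notin> (`) Inr ` edges (right_tree I)" by blast
  moreover have "{Inl v, y} \<in> {{Inl x, Inr y} | x y. (x, y) \<in> matching I} \<longleftrightarrow> (\<exists>w. y = Inr w \<and> (v, w) \<in> matching I)"
    by (auto simp: doubleton_eq_iff)
  ultimately show ?thesis unfolding tanglegram_graph_def graph.simps Un_iff edge_in_image[OF inj_Inl] by simp
qed

lemma right_nbr: "{Inr v, y} \<in> edges (tanglegram_graph I) \<longleftrightarrow>
    (\<exists>w. y = Inr w \<and> {v, w} \<in> edges (right_tree I)) \<or> (\<exists>w. y = Inl w \<and> (w, v) \<in> matching I)"
proof -
  have "{Inr v, y} \<notin> (`) Inl ` edges (left_tree I)" by blast
  moreover have "{Inr v, y} \<in> {{Inl x, Inr y} | x y. (x, y) \<in> matching I} \<longleftrightarrow> (\<exists>w. y = Inl w \<and> (w, v) \<in> matching I)"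
    by (auto simp: doubleton_eq_iff)
  ultimately show ?thesis unfolding tanglegram_graph_def graph.simps Un_iff edge_in_image[OF inj_Inr] by simp
qed

lemma K2_subsets: "edges K2_tree \<subseteq> Pow KV" "edges K1_tree \<subseteq> Pow KV" "Root \<in> KV" 
  "matching K2 \<subseteq> KV \<times> KV" "matching K1 \<subseteq> KV \<times> KV"
proof -
  have "\<forall>e\<in>edges K2_tree. \<forall>x\<in>e. x \<in> KV" "\<forall>e\<in>edges K1_tree. \<forall>x\<in>e. x \<in> KV"
    by (simp_all add: K2_tree_def K1_tree_def KV_def)
  then show "edges K2_tree \<subseteq> Pow KV" "edges K1_tree \<subseteq> Pow KV" by blast+
  show "Root \<in> KV" by (simp add: KV_def)
  have "\<forall>p\<in>matching K2. fst p \<in> KV \<and> snd p \<in> KV" "\<forall>p\<in>matching K1. fst p \<in> KV \<and> snd p \<in> KV"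
    by (simp_all add: K2_def K1_def KV_def)
  then show "matching K2 \<subseteq> KV \<times> KV" "matching K1 \<subseteq> KV \<times> KV" by (simp_all add: subset_iff mem_Times_iff)
qed

lemma K_root: "root K1_tree = Root" "root K2_tree = Root"
  by (simp_all add: K1_tree_def K2_tree_def)

locale valid_tanglegram =
  fixes T :: "('a, 'b) tanglegram"
  assumes T: "is_tanglegram T"
begin

sublocale L: labelled "left_tree T" "matching T" fst by (rule labelled_left[OF T])
sublocale R: labelled "right_tree T" "matching T" snd by (rule labelled_right[OF T])

lemma cross_responsible_K2:
  assumes L: "L.H.caterpillar a b c d" and R: "R.H.caterpillar d b c a"
  shows "cross_responsible T {a, b, c, d}"
proof -
  have M: "{a, b, c, d} \<subseteq> matching T"
    using L L.H.splitsD unfolding L.H.caterpillar_def by blast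
  have ne: "c \<noteq> d" "c \<noteq> a" using L R L.H.splitsD R.H.splitsD unfolding L.H.caterpillar_def R.H.caterpillar_def by blast+
  interpret L': sublabelled "left_tree T" "matching T" fst "{a, b, c, d}" by unfold_locales (use M in auto)
  interpret R': sublabelled "right_tree T" "matching T" snd "{a, b, c, d}" by unfold_locales (use M in auto)
  obtain gL where gL: "tree_image gL K2_tree (induced_tree (left_tree T) (fst ` {a, b, c, d}))"
    "gL (Leaf 1) = fst a" "gL (Leaf 2) = fst b" "gL (Leaf 3) = fst c" "gL (Leaf 4) = fst d"
    using L'.caterpillar_image[OF L ne(1) refl] by blast
  have "{a, b, c, d} = {d, b, c, a}" by auto
  then obtain gR where gR: "tree_image gR K2_tree (induced_tree (right_tree T) (snd ` {a, b, c, d}))"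
    "gR (Leaf 1) = snd d" "gR (Leaf 2) = snd b" "gR (Leaf 3) = snd c" "gR (Leaf 4) = snd a"
    using R'.caterpillar_image[OF R ne(2)] by blast
  have "tanglegram_isomorphic (induced_tanglegram T {a, b, c, d}) K2"
  proof (rule isomorphic_of_images)
    show "tree_image gL (left_tree K2) (left_tree (induced_tanglegram T {a, b, c, d}))"
      using gL by (simp add: K2_def induced_tanglegram_def)
    show "tree_image gR (right_tree K2) (right_tree (induced_tanglegram T {a, b, c, d}))"
      using gR by (simp add: K2_def induced_tanglegram_def)
    show "matching (induced_tanglegram T {a, b, c, d}) = map_prod gL gR ` matching K2"
      unfolding K2_def induced_tanglegram_def tanglegram.simps image_insert map_prod_simp gL gR by simp
  qed (use K2_subsets K_verts in \<open>simp_all add: K2_def K_root\<close>)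
  then show ?thesis using M by (simp add: cross_responsible_def)
qed

lemma cross_responsible_K1:
  assumes L: "L.H.balanced a b c d" and R: "R.H.balanced a c b d"
  shows "cross_responsible T {a, b, c, d}"
proof -
  have M: "{a, b, c, d} \<subseteq> matching T"
    using L L.H.splitsD unfolding L.H.balanced_def by blast
  have ne: "a \<noteq> b" "c \<noteq> d" "a \<noteq> c" "b \<noteq> d"
    using L R L.H.splitsD R.H.splitsD unfolding L.H.balanced_def R.H.balanced_def by blast+
  interpret L': sublabelled "left_tree T" "matching T" fst "{a, b, c, d}" by unfold_locales (use M in auto)
  interpret R': sublabelled "right_tree T" "matching T" snd "{a, b, c, d}" by unfold_locales (use M in auto)
  obtain gL where gL: "tree_image gL K1_tree (induced_tree (left_tree T) (fst ` {a, b, c, d}))"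
    "gL (Leaf 1) = fst a" "gL (Leaf 2) = fst b" "gL (Leaf 3) = fst c" "gL (Leaf 4) = fst d"
    using L'.balanced_image[OF L ne(1,2) refl] by blast
  \<comment> \<open>The right cherries are \<open>a\<close>, \<open>c\<close> and \<open>b\<close>,
    \<open>d\<close>: the matching of \<open>K1\<close> exchanges the second and third leaf.\<close>
  have "{a, b, c, d} = {a, c, b, d}" by auto
  then obtain gR where gR: "tree_image gR K1_tree (induced_tree (right_tree T) (snd ` {a, b, c, d}))"
    "gR (Leaf 1) = snd a" "gR (Leaf 2) = snd c" "gR (Leaf 3) = snd b" "gR (Leaf 4) = snd d"
    using R'.balanced_image[OF R ne(3,4)] by blast
  have "tanglegram_isomorphic (induced_tanglegram T {a, b, c, d}) K1"
  proof (rule isomorphic_of_images)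
    show "tree_image gL (left_tree K1) (left_tree (induced_tanglegram T {a, b, c, d}))"
      using gL by (simp add: K1_def induced_tanglegram_def)
    show "tree_image gR (right_tree K1) (right_tree (induced_tanglegram T {a, b, c, d}))"
      using gR by (simp add: K1_def induced_tanglegram_def)
    show "matching (induced_tanglegram T {a, b, c, d}) = map_prod gL gR ` matching K1"
      unfolding K1_def induced_tanglegram_def tanglegram.simps image_insert map_prod_simp gL gR by simp
  qed (use K2_subsets K_verts in \<open>simp_all add: K1_def K_root\<close>)
  then show ?thesis using M by (simp add: cross_responsible_def)
qed

text \<open>The inverse \<open>g\<close> of the isomorphism is followed down from either root. The
  leaves reached are paired by the matching of \<open>K2\<close>, which is how the four labels are
  found.\<close>

lemma caterpillars_of_K2:
  assumes X: "X \<subseteq> matching T" and iso: "tanglegram_isomorphic (induced_tanglegram T X) K2"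
  obtains a b c d where "X = {a, b, c, d}" "L.H.caterpillar a b c d" "R.H.caterpillar d b c a"
proof -
  let ?I = "induced_tanglegram T X"
  let ?G = "tanglegram_graph ?I" and ?K = "tanglegram_graph K2"
  obtain f where f: "graph_iso f ?G ?K" "f (Inl (root (left_tree ?I))) = Inl (root (left_tree K2))"
    "f (Inr (root (right_tree ?I))) = Inr (root (right_tree K2))"
    using iso unfolding tanglegram_isomorphic_def by blast
  have bij: "bij_betw f (verts ?G) (verts ?K)" using f unfolding graph_iso_def by blast
  have VK: "verts ?K = Inl ` KV \<union> Inr ` KV"
    by (simp add: tanglegram_graph_def K2_def K_verts)
  \<comment> \<open>The empty union of root paths has no vertices at all, not even a root.\<close>
  have "X \<noteq> {}"
  proof
    assume "X = {}"
    then have "verts ?G = {}"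
      by (simp add: tanglegram_graph_def induced_tanglegram_def induced_tree_def suppress_def root_path_union_def)
    then show False using bij unfolding VK bij_betw_def by (auto simp: KV_def)
  qed
  interpret L': sublabelled "left_tree T" "matching T" fst X by unfold_locales (use X \<open>X \<noteq> {}\<close> in auto)
  interpret R': sublabelled "right_tree T" "matching T" snd X by unfold_locales (use X \<open>X \<noteq> {}\<close> in auto)
  define g where "g = inv_into (verts ?G) f"
  have g: "g u \<in> verts ?G" "f (g u) = u" if "u \<in> verts ?K" for u
    using that bij unfolding g_def bij_betw_def by (auto simp: inv_into_into f_inv_into_f)
  have gf: "g (f x) = x" if "x \<in> verts ?G" for x using that bij unfolding g_def bij_betw_def by simp
  have gi: "inj_on g (verts ?K)" using g(2) by (metis inj_onI)
  have ge: "{g u, g v} \<in> edges ?G" if "{u, v} \<in> edges ?K" "u \<in> verts ?K" "v \<in> verts ?K" for u v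
    using f(1) g that unfolding graph_iso_def by metis
  have I: "left_tree ?I = induced_tree (left_tree T) (fst ` X)" "right_tree ?I = induced_tree (right_tree T) (snd ` X)"
    "matching ?I = X" by (simp_all add: induced_tanglegram_def)
  have rI: "root (left_tree ?I) = root (left_tree T)" "root (right_tree ?I) = root (right_tree T)"
    using L'.root_induced R'.root_induced I by simp_all
  have rv: "Inl (root (left_tree T)) \<in> verts ?G" "Inr (root (right_tree T)) \<in> verts ?G"
    unfolding tanglegram_graph_def graph.simps I L'.verts_induced R'.verts_induced
    by (simp_all add: L'.surv_def R'.surv_def)
  have gr: "g (Inl Root) = Inl (root (left_tree T))" "g (Inr Root) = Inr (root (right_tree T))"
    using gf[OF rv(1)] gf[OF rv(2)] f(2,3) rI by (simp_all add: K2_def K2_tree_def)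
  have Ked: "{Inl i, Inl j} \<in> edges ?K" "{Inr i, Inr j} \<in> edges ?K" "i \<in> KV" "j \<in> KV" if ij: "{i, j} \<in> edges K2_tree" for i j
  proof -
    show "{Inl i, Inl j} \<in> edges ?K" using ij unfolding left_nbr by (simp add: K2_def)
    show "{Inr i, Inr j} \<in> edges ?K" using ij unfolding right_nbr by (simp add: K2_def)
    show "i \<in> KV" "j \<in> KV" using ij K2_subsets(1) by blast+
  qed
  obtain n where n: "\<And>k. k \<in> KV \<Longrightarrow> g (Inl k) = Inl (n k)"
    "L'.cover (n Root) (n (Inner 1))" "L'.cover (n (Inner 1)) (n (Leaf 1))" "L'.cover (n (Inner 1)) (n (Inner 2))"
    "L'.cover (n (Inner 2)) (n (Leaf 2))" "L'.cover (n (Inner 2)) (n (Inner 3))"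
    "L'.cover (n (Inner 3)) (n (Leaf 3))" "L'.cover (n (Inner 3)) (n (Leaf 4))"
  proof (rule L'.K2_embedding[of Inl "\<lambda>k. g (Inl k)" "\<lambda>x y. {x, y} \<in> edges ?G" "\<lambda>v. Inr (THE w. (v, w) \<in> X)"])
    show "inj Inl" by simp
    show "inj_on (\<lambda>k. g (Inl k)) KV" using gi unfolding VK by (auto simp: inj_on_def)
    show "g (Inl Root) = Inl (root (left_tree T))" by (rule gr(1))
    show "{g (Inl i), g (Inl j)} \<in> edges ?G" if "{i, j} \<in> edges K2_tree" for i j
      using ge Ked[OF that] unfolding VK by blast
    fix v y assume "{Inl v, y} \<in> edges ?G"
    then consider w where "y = Inl w" "{v, w} \<in> edges (induced_tree (left_tree T) (fst ` X))" | w where "y = Inr w" "(v, w) \<in> X"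
      unfolding left_nbr I by blast
    then show "(\<exists>w. y = Inl w \<and> {v, w} \<in> edges (induced_tree (left_tree T) (fst ` X))) \<or> (v \<in> fst ` X \<and> y = Inr (THE w. (v, w) \<in> X))"
    proof cases
      case 2
      \<comment> \<open>The mate is well defined, since a left leaf determines its matching
        edge.\<close>
      have "w' = w" if "(v, w') \<in> X" for w'
        using L.lab_inj[of "(v, w')" "(v, w)"] that 2 X by auto
      then have "(THE w. (v, w) \<in> X) = w" using 2 by blast
      then show ?thesis using 2 by force
    qed blast
  qed blast
  obtain m where m: "\<And>k. k \<in> KV \<Longrightarrow> g (Inr k) = Inr (m k)"
    "R'.cover (m Root) (m (Inner 1))" "R'.cover (m (Inner 1)) (m (Leaf 1))" "R'.cover (m (Inner 1)) (m (Inner 2))"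
    "R'.cover (m (Inner 2)) (m (Leaf 2))" "R'.cover (m (Inner 2)) (m (Inner 3))"
    "R'.cover (m (Inner 3)) (m (Leaf 3))" "R'.cover (m (Inner 3)) (m (Leaf 4))"
  proof (rule R'.K2_embedding[of Inr "\<lambda>k. g (Inr k)" "\<lambda>x y. {x, y} \<in> edges ?G" "\<lambda>v. Inl (THE w. (w, v) \<in> X)"])
    show "inj Inr" by simp
    show "inj_on (\<lambda>k. g (Inr k)) KV" using gi unfolding VK by (auto simp: inj_on_def)
    show "g (Inr Root) = Inr (root (right_tree T))" by (rule gr(2))
    show "{g (Inr i), g (Inr j)} \<in> edges ?G" if "{i, j} \<in> edges K2_tree" for i j
      using ge Ked[OF that] unfolding VK by blast
    fix v y assume "{Inr v, y} \<in> edges ?G"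
    then consider w where "y = Inr w" "{v, w} \<in> edges (induced_tree (right_tree T) (snd ` X))" | w where "y = Inl w" "(w, v) \<in> X"
      unfolding right_nbr I by blast
    then show "(\<exists>w. y = Inr w \<and> {v, w} \<in> edges (induced_tree (right_tree T) (snd ` X))) \<or> (v \<in> snd ` X \<and> y = Inl (THE w. (w, v) \<in> X))"
    proof cases
      case 2
      have "w' = w" if "(w', v) \<in> X" for w'
        using R.lab_inj[of "(w', v)" "(w, v)"] that 2 X by auto
      then have "(THE w. (w, v) \<in> X) = w" using 2 by blast
      then show ?thesis using 2 by force
    qed blast
  qed blast
  have mem: "(n i, m j) \<in> X" if ij: "(i, j) \<in> matching K2" for i j
  proof -
    have kv: "i \<in> KV" "j \<in> KV" using ij K2_subsets by blast+
    have "{Inl i, Inr j} \<in> edges ?K" using ij unfolding left_nbr by simp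
    then have "{Inl (n i), Inr (m j)} \<in> edges ?G" using ge[of "Inl i" "Inr j"] kv n(1) m(1) unfolding VK by auto
    then show ?thesis unfolding left_nbr I by blast
  qed
  define a where "a = (n (Leaf 1), m (Leaf 4))"
  define b where "b = (n (Leaf 2), m (Leaf 2))"
  define c where "c = (n (Leaf 3), m (Leaf 3))"
  define d where "d = (n (Leaf 4), m (Leaf 1))"
  have abcd: "a \<in> X" "b \<in> X" "c \<in> X" "d \<in> X"
    unfolding a_def b_def c_def d_def by (rule mem; simp add: K2_def)+
  have "X \<subseteq> {a, b, c, d}"
  proof
    fix e assume "e \<in> X"
    then obtain x y where xy: "e = (x, y)" "(x, y) \<in> X" by (cases e) auto
    have E: "{Inl x, Inr y} \<in> edges ?G" using xy unfolding left_nbr I by simp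
    have xv: "Inl x \<in> verts ?G" "Inr y \<in> verts ?G"
      using xy unfolding tanglegram_graph_def graph.simps I L'.verts_induced R'.verts_induced
      by (force simp: L'.surv_def R'.surv_def)+
    have fe: "{f (Inl x), f (Inr y)} \<in> edges ?K" using f(1) E xv unfolding graph_iso_def by blast
    have "f (Inl x) \<in> verts ?K" "f (Inr y) \<in> verts ?K" using bij xv unfolding bij_betw_def by blast+
    moreover have "g (f (Inl x)) = Inl x" "g (f (Inr y)) = Inr y" using gf xv by blast+
    \<comment> \<open>\<open>g\<close> has been shown to keep the sides, so \<open>f\<close> keeps
      them too.\<close>
    ultimately obtain i j where ij: "f (Inl x) = Inl i" "i \<in> KV" "f (Inr y) = Inr j" "j \<in> KV"
      unfolding VK using n(1) m(1) by (metis Inl_Inr_False UnE imageE)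
    then have "x = n i" "y = m j" using gf[OF xv(1)] gf[OF xv(2)] n(1) m(1) by auto
    moreover have "(i, j) \<in> matching K2" using fe unfolding ij left_nbr by blast
    ultimately show "e \<in> {a, b, c, d}" using xy unfolding a_def b_def c_def d_def K2_def by auto
  qed
  then have Xeq: "X = {a, b, c, d}" using abcd by blast
  have ninj: "n i \<noteq> n j" if ij: "i \<in> KV" "j \<in> KV" "i \<noteq> j" for i j
  proof
    assume "n i = n j"
    then have "g (Inl i) = g (Inl j)" using n(1) ij by simp
    then show False using inj_onD[OF gi, of "Inl i" "Inl j"] ij unfolding VK by simp
  qed
  have minj: "m i \<noteq> m j" if ij: "i \<in> KV" "j \<in> KV" "i \<noteq> j" for i j
  proof
    assume "m i = m j"
    then have "g (Inr i) = g (Inr j)" using m(1) ij by simp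
    then show False using inj_onD[OF gi, of "Inr i" "Inr j"] ij unfolding VK by simp
  qed
  have M: "a \<in> matching T" "b \<in> matching T" "c \<in> matching T" "d \<in> matching T" using abcd X by blast+
  have "L.H.caterpillar a b c d"
    by (rule L'.caterpillar_of_embedding[of "n Root" "n (Inner 1)" a "n (Inner 2)" b "n (Inner 3)" c d])
      (use n(2-) M ninj in \<open>simp_all add: a_def b_def c_def d_def KV_def\<close>)
  moreover have "R.H.caterpillar d b c a"
    by (rule R'.caterpillar_of_embedding[of "m Root" "m (Inner 1)" d "m (Inner 2)" b "m (Inner 3)" c a])
      (use m(2-) M minj in \<open>simp_all add: a_def b_def c_def d_def KV_def\<close>)
  ultimately show thesis using that Xeq by blast
qed

end

section \<open>Drawing a tree from an order of its leaves\<close>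

context hierarchy
begin

text \<open>The vertices splitting \<open>x\<close>, \<open>y\<close> and \<open>y\<close>,
  \<open>z\<close> both lie above \<open>y\<close> and are different. The upper one also splits
  \<open>x\<close> from \<open>z\<close>, with the same orientation.\<close>

lemma lt_trans: "lt f x y \<Longrightarrow> lt f y z \<Longrightarrow> lt f x z"
proof -
  assume "lt f x y" "lt f y z"
  then obtain u v where u: "splits u x y" "side u x = f u" and v: "splits v y z" "side v y = f v"
    unfolding lt_def by blast
  have uv: "u \<in> V" "v \<in> V" "y \<in> C u" "y \<in> C v" using u v unfolding splits_def by blast+
  have "u \<noteq> v" using u v unfolding splits_def by blast
  then consider "below u v" | "below v u" using overlap[OF uv] by blast
  then show "lt f x z"
  proof cases
    case 1
    have "splits v x z" "side v x = f v"
      using below_const[OF 1, of x y] below_subset[OF 1, of x] u v unfolding splits_def by blast+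
    then show ?thesis unfolding lt_def by blast
  next
    case 2
    have "splits u x z"
      using below_const[OF 2, of y z] below_subset[OF 2, of z] u v unfolding splits_def by blast
    then show ?thesis using u unfolding lt_def by blast
  qed
qed

lemma lt_asym: "lt f x y \<Longrightarrow> \<not> lt f y x"
  using splits_unique splits_sym unfolding lt_def by (metis splits_def)

lemma lt_total: "x \<in> M \<Longrightarrow> y \<in> M \<Longrightarrow> x \<noteq> y \<Longrightarrow> lt f x y \<or> lt f y x"
  using splits_exists[of x y] splits_sym unfolding lt_def splits_def by blast

text \<open>The rank of a label, used as its coordinate along the leaf-line.\<close>

definition pos :: "('v \<Rightarrow> bool) \<Rightarrow> 'm \<Rightarrow> real" where
  "pos f x = real (card {y \<in> M. lt f y x})"

lemma pos_less: "lt f x y \<Longrightarrow> pos f x < pos f y"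
proof -
  assume l: "lt f x y"
  then have "x \<in> M" unfolding lt_def using splitsD by blast
  then have "{z \<in> M. lt f z x} \<subset> {z \<in> M. lt f z y}" using l lt_trans lt_asym by blast
  then show ?thesis unfolding pos_def using psubset_card_mono[of "{z \<in> M. lt f z y}"] finite_M by simp
qed

lemma pos_iff: "x \<in> M \<Longrightarrow> y \<in> M \<Longrightarrow> pos f x < pos f y \<longleftrightarrow> lt f x y"
  using pos_less[of f x y] pos_less[of f y x] lt_total[of x y f] by (metis less_asym less_irrefl)

lemma pos_inj: "inj_on (pos f) M"
proof (rule inj_onI, rule ccontr)
  fix x y assume "x \<in> M" "y \<in> M" "pos f x = pos f y" "x \<noteq> y"
  then show False using lt_total[of x y f] pos_less[of f x y] pos_less[of f y x] by auto
qed

text \<open>A label outside \<open>C v\<close> is separated from all of \<open>C v\<close> at one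
  vertex above \<open>v\<close>, hence lies on one side of the whole cluster.\<close>

lemma pos_contiguous:
  assumes "v \<in> V" "x \<in> C v" "z \<in> C v" "y \<in> M" "pos f x < pos f y" "pos f y < pos f z"
  shows "y \<in> C v"
proof (rule ccontr)
  assume n: "y \<notin> C v"
  have M: "x \<in> M" "z \<in> M" using assms C_subset by blast+
  have l: "lt f x y" "lt f y z" using pos_iff assms M by blast+
  obtain u where u: "splits u x y" "side u x = f u" using l unfolding lt_def by blast
  have b: "below v u" using splits_outside[OF u(1) assms(1,2) n] .
  have "splits u z y" "side u z = f u"
    using u below_const[OF b assms(2,3)] below_subset[OF b assms(3)] unfolding splits_def by blast+
  then have "lt f z y" unfolding lt_def by blast
  then show False using l lt_asym by blast
qed

end

lemma segment_box:
  fixes a b p :: "real \<times> real"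
  assumes "p \<in> closed_segment a b" "fst a \<le> fst b" "snd b \<le> snd a"
  shows "fst a \<le> fst p" "fst p \<le> fst b" "snd b \<le> snd p" "snd p \<le> snd a"
proof -
  have 1: "fst p \<in> closed_segment (fst a) (fst b)" "snd p \<in> closed_segment (snd a) (snd b)"
    using assms(1) closed_segment_PairD[of "fst p" "snd p" "fst a" "snd a" "fst b" "snd b"] by simp_all
  then show "fst a \<le> fst p" "fst p \<le> fst b" "snd b \<le> snd p" "snd p \<le> snd a"
    using assms(2,3) by (auto simp: closed_segment_eq_real_ivl split: if_splits)
qed

locale positioned = labelled t M lab for t :: "'v rtree" and M :: "'m set" and lab +
  fixes q :: "'m \<Rightarrow> real"
  assumes q_inj: "inj_on q M"
    and q_contiguous: "v \<in> inodes t \<Longrightarrow> x \<in> cl v \<Longrightarrow> z \<in> cl v \<Longrightarrow> y \<in> M \<Longrightarrow> q x < q y \<Longrightarrow> q y < q z \<Longrightarrow> y \<in> cl v"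
begin

text \<open>
  A point \<open>(x, y)\<close> is read as the interval from \<open>x\<close> to \<open>y\<close>, and a vertex is drawn at the interval
  spanned by the leaves below it; the root gets a slightly larger one.  The leaf-line is the
  diagonal, the distance to it is proportional to the length of the interval, inclusion of intervals
  is the ancestor order, and every edge is axis-parallel.
\<close>

definition lo :: "'v \<Rightarrow> real" where "lo v = Min (q ` cl v)"
definition hi :: "'v \<Rightarrow> real" where "hi v = Max (q ` cl v)"
definition dpos :: "'v \<Rightarrow> point" where
  "dpos v = (if v = root t then lo v - 1 else lo v, hi v)"

lemma cl_finite: "finite (cl v)" using finite_labels by (simp add: cl_def)

lemma cl_sub: "cl v \<subseteq> M" by (auto simp: cl_def)

lemma lab_surj: "l \<in> leaves t \<Longrightarrow> \<exists>m. m \<in> M \<and> l = lab m"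
proof -
  assume "l \<in> leaves t"
  then have "l \<in> lab ` M" using lab by (simp add: bij_betw_def)
  then show ?thesis by auto
qed

lemma cl_nonempty: "v \<in> verts t \<Longrightarrow> cl v \<noteq> {}"
proof -
  assume "v \<in> verts t"
  then obtain l where l: "l \<in> leaves t" "anc t v l" using leaf_below by blast
  obtain m where "m \<in> M" "l = lab m" using lab_surj[OF l(1)] by blast
  then show ?thesis using l(2) unfolding cl_def by blast
qed

lemma cl_mono: "anc t u v \<Longrightarrow> cl v \<subseteq> cl u"
  using anc_trans by (auto simp: cl_def)

lemma cl_root: "cl (root t) = M"
  using anc_root[OF leaf_verts[OF lab_leaf]] by (auto simp: cl_def)

lemma cl_leaf: "m \<in> M \<Longrightarrow> cl (lab m) = {m}"
proof -
  assume m: "m \<in> M"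
  have "x = m" if "x \<in> M" "anc t (lab m) (lab x)" for x
    using leaf_anc[OF lab_leaf[OF m] that(2)] lab_inj that(1) m by blast
  moreover have "anc t (lab m) (lab m)" using anc_refl leaf_verts lab_leaf m by blast
  ultimately show ?thesis using m unfolding cl_def by blast
qed

lemma contiguous:
  assumes "v \<in> verts t" "x \<in> cl v" "z \<in> cl v" "y \<in> M" "q x < q y" "q y < q z"
  shows "y \<in> cl v"
proof -
  consider "v = root t" | "v \<in> leaves t" | "v \<in> inodes t" using assms(1) by (auto simp: inodes_def)
  then show ?thesis
  proof cases
    case 1 then show ?thesis using cl_root assms by simp
  next
    case 2
    then obtain m where "m \<in> M" "v = lab m" using lab_surj by blast
    then show ?thesis using assms cl_leaf by simp
  next
    case 3 then show ?thesis using q_contiguous assms by blast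
  qed
qed

lemma lo_hi:
  assumes "v \<in> verts t"
  shows "\<exists>x\<in>cl v. q x = lo v" "\<exists>x\<in>cl v. q x = hi v" "\<And>x. x \<in> cl v \<Longrightarrow> lo v \<le> q x" "\<And>x. x \<in> cl v \<Longrightarrow> q x \<le> hi v"
    "lo v \<le> hi v"
proof -
  have f: "finite (q ` cl v)" "q ` cl v \<noteq> {}" using cl_finite cl_nonempty[OF assms] by auto
  show 1: "\<exists>x\<in>cl v. q x = lo v" using Min_in[OF f] unfolding lo_def by (metis imageE)
  show "\<exists>x\<in>cl v. q x = hi v" using Max_in[OF f] unfolding hi_def by (metis imageE)
  show "\<And>x. x \<in> cl v \<Longrightarrow> lo v \<le> q x" "\<And>x. x \<in> cl v \<Longrightarrow> q x \<le> hi v"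
    using Min_le[OF f(1)] Max_ge[OF f(1)] unfolding lo_def hi_def by blast+
  then show "lo v \<le> hi v" using 1 by force
qed

lemma interval_in: "v \<in> verts t \<Longrightarrow> y \<in> M \<Longrightarrow> lo v \<le> q y \<Longrightarrow> q y \<le> hi v \<Longrightarrow> y \<in> cl v"
proof -
  assume a: "v \<in> verts t" "y \<in> M" "lo v \<le> q y" "q y \<le> hi v"
  obtain x z where x: "x \<in> cl v" "q x = lo v" and z: "z \<in> cl v" "q z = hi v" using lo_hi[OF a(1)] by blast
  show "y \<in> cl v"
  proof (cases "y = x \<or> y = z")
    case True then show ?thesis using x z by blast
  next
    case False
    then have "q y \<noteq> q x" "q y \<noteq> q z" using q_inj x z a(2) cl_sub by (metis inj_onD subsetD)+
    then show ?thesis using contiguous[OF a(1) x(1) z(1) a(2)] a x z by simp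
  qed
qed

lemma anc_imp_sub:
  assumes "anc t u v"
  shows "fst (dpos u) \<le> fst (dpos v) \<and> snd (dpos v) \<le> snd (dpos u)"
proof -
  have uv: "u \<in> verts t" "v \<in> verts t" using anc_verts assms by blast+
  obtain x z where x: "x \<in> cl v" "q x = lo v" and z: "z \<in> cl v" "q z = hi v" using lo_hi[OF uv(2)] by blast
  have "lo u \<le> lo v" "hi v \<le> hi u" using lo_hi(3,4)[OF uv(1)] x z cl_mono[OF assms] by (metis subsetD)+
  moreover have "v = root t \<Longrightarrow> u = root t" using assms unfolding anc_iff using rpath_root by auto
  ultimately show ?thesis by (auto simp: dpos_def)
qed

text \<open>If \<open>v\<close> lay strictly above \<open>u\<close> and its interval still fitted
  into that of \<open>u\<close>, contiguity would put all labels of \<open>v\<close> below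
  \<open>u\<close>, also those of the child of \<open>v\<close> that does not lead to
  \<open>u\<close>.\<close>

lemma anc_dpos:
  assumes uv: "u \<in> verts t" "v \<in> verts t"
  shows "anc t u v \<longleftrightarrow> fst (dpos u) \<le> fst (dpos v) \<and> snd (dpos v) \<le> snd (dpos u)"
proof
  assume s: "fst (dpos u) \<le> fst (dpos v) \<and> snd (dpos v) \<le> snd (dpos u)"
  show "anc t u v"
  proof (cases "u = root t")
    case True then show ?thesis using anc_root uv by blast
  next
    case u: False
    have "v \<noteq> root t"
    proof
      assume v: "v = root t"
      then have "fst (dpos v) = lo v - 1" "fst (dpos u) = lo u" using u by (simp_all add: dpos_def)
      moreover obtain x where "x \<in> cl u" "q x = lo u" using lo_hi(1)[OF uv(1)] by blast
      moreover then have "lo v \<le> lo u" using lo_hi(3)[OF uv(2), of x] v cl_root cl_sub by auto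
      ultimately show False using s by simp
    qed
    then have s: "lo u \<le> lo v" "hi v \<le> hi u" using s u by (simp_all add: dpos_def)
    obtain x where x: "x \<in> cl v" "q x = lo v" using lo_hi(1)[OF uv(2)] by blast
    have "x \<in> cl u" using interval_in[OF uv(1), of x] x s lo_hi(5)[OF uv(2)] cl_sub by auto
    then consider "anc t u v" | "anc t v u" "u \<noteq> v" using x anc_chain[of u "lab x" v] unfolding cl_def by blast
    then show ?thesis
    proof cases
      case 2
      have vi: "v \<in> inodes t" using 2 leaf_anc \<open>v \<noteq> root t\<close> uv by (auto simp: inodes_def)
      obtain c where c: "c \<in> children t v" "anc t c u" using child_towards 2 by blast
      obtain c' where c': "c' \<in> children t v" "c' \<noteq> c" using right_child[OF vi] by (metis insertI1 insertCI)
      have cv: "c' \<in> verts t" "anc t v c'" using childD[OF c'(1) uv(2)] by blast+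
      obtain y where y: "y \<in> cl c'" using cl_nonempty[OF cv(1)] by blast
      have yv: "y \<in> cl v" using cl_mono[OF cv(2)] y by blast
      then have "y \<in> cl u" using interval_in[OF uv(1), of y] s lo_hi(3,4)[OF uv(2)] cl_sub by force
      then have "anc t c (lab y)" "anc t c' (lab y)" using c y anc_trans unfolding cl_def by blast+
      then show ?thesis using child_unique c c' by blast
    qed
  qed
qed (rule anc_imp_sub)

lemma dpos_inj: "u \<in> verts t \<Longrightarrow> v \<in> verts t \<Longrightarrow> dpos u = dpos v \<Longrightarrow> u = v"
  using anc_dpos[of u v] anc_dpos[of v u] anc_antisym by simp

text \<open>The children occupy disjoint intervals. One shares its lower end with \<open>u\<close>
  and the other its upper end, so one edge is vertical, the other horizontal, and they meet only at
  \<open>u\<close>.\<close>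

lemma sibling_segments:
  assumes u: "u \<in> inodes t" and c: "c \<in> children t u" "c' \<in> children t u" "c \<noteq> c'"
    and p: "p \<in> closed_segment (dpos u) (dpos c)" "p \<in> closed_segment (dpos u) (dpos c')"
  shows "p = dpos u"
proof -
  have main: "p = dpos u" if c: "c \<in> children t u" "c' \<in> children t u" "c \<noteq> c'"
    and p: "p \<in> closed_segment (dpos u) (dpos c)" "p \<in> closed_segment (dpos u) (dpos c')" 
    and lt: "hi c < lo c'" for c c'
  proof -
    have uv: "u \<in> verts t" "u \<noteq> root t" using u inodes_verts by blast+
    have cv: "c \<in> verts t" "c' \<in> verts t" "c \<noteq> root t" "c' \<noteq> root t" "anc t u c" "anc t u c'"
      using childD uv c by blast+
    obtain y where y: "children t u = {left u, y}" using right_child[OF u] by blast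
    have ch: "children t u = {c, c'}" using y c by auto
    have "cl u = cl c \<union> cl c'"
    proof
      show "cl c \<union> cl c' \<subseteq> cl u" using cl_mono cv by blast
      show "cl u \<subseteq> cl c \<union> cl c'"
      proof
        fix x assume x: "x \<in> cl u"
        then have "u \<noteq> lab x" using inodes_verts[OF u] lab_leaf unfolding cl_def by auto
        then show "x \<in> cl c \<union> cl c'" using child_towards[of u "lab x"] x ch unfolding cl_def by auto
      qed
    qed
    then have "lo u = min (lo c) (lo c')" "hi u = max (hi c) (hi c')"
      unfolding lo_def hi_def using cl_finite cl_nonempty[OF cv(1)] cl_nonempty[OF cv(2)]
      by (simp_all add: image_Un Min_Un Max_Un)
    then have "lo u = lo c" "hi u = hi c'" using lt lo_hi(5)[OF cv(1)] lo_hi(5)[OF cv(2)] by auto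
    then have "fst (dpos c) = fst (dpos u)" "snd (dpos c') = snd (dpos u)" using uv cv by (simp_all add: dpos_def)
    then have "fst p = fst (dpos u)" "snd p = snd (dpos u)"
      using segment_box[OF p(1)] segment_box[OF p(2)] anc_imp_sub cv by force+
    then show ?thesis by (simp add: prod_eq_iff)
  qed
  have uv: "u \<in> verts t" using u inodes_verts by blast
  have cv: "c \<in> verts t" "c' \<in> verts t" using childD uv c by blast+
  have dis: "cl c \<inter> cl c' = {}" using child_unique[OF c(1,2)] c(3) unfolding cl_def by blast
  have "hi c < lo c' \<or> hi c' < lo c"
  proof (rule ccontr)
    assume "\<not> ?thesis"
    then have n: "lo c' \<le> hi c" "lo c \<le> hi c'" by auto
    obtain x where x: "x \<in> cl c" "q x = lo c" using lo_hi(1)[OF cv(1)] by blast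
    obtain y where y: "y \<in> cl c'" "q y = lo c'" using lo_hi(1)[OF cv(2)] by blast
    show False
    proof (cases "lo c \<le> lo c'")
      case True
      then have "y \<in> cl c" using interval_in[OF cv(1), of y] y n cl_sub by auto
      then show False using dis y by blast
    next
      case False
      then have "x \<in> cl c'" using interval_in[OF cv(2), of x] x n cl_sub by auto
      then show False using dis x by blast
    qed
  qed
  then show ?thesis using main[OF c p] main[OF c(2,1) c(3)[symmetric] p(2,1)] by blast
qed

lemma anc_parent: "anc t u c \<Longrightarrow> c \<in> children t v \<Longrightarrow> v \<in> verts t \<Longrightarrow> u \<noteq> c \<Longrightarrow> anc t u v"
  unfolding anc_iff children_def by auto

text \<open>A point on the edge from \<open>u\<close> to \<open>c\<close> is an interval between
  those of \<open>c\<close> and \<open>u\<close>. If \<open>c\<close> is an ancestor of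
  \<open>c'\<close>, this squeezes a common point to the interval of \<open>c\<close>, which must
  also be that of \<open>u'\<close>.\<close>

lemma crossing_free_dpos: "crossing_free t dpos"
  unfolding crossing_free_def
proof (intro conjI ballI impI)
  show "inj_on dpos (verts t)" using dpos_inj by (auto intro: inj_onI)
  fix e f assume ef: "e \<in> edges t" "f \<in> edges t" "e \<noteq> f"
  obtain u c where e: "e = {u, c}" "u \<in> verts t" "c \<in> children t u" using ef(1) edges_eq by blast
  obtain u' c' where f: "f = {u', c'}" "u' \<in> verts t" "c' \<in> children t u'" using ef(2) edges_eq by blast
  have cv: "c \<in> verts t" "anc t u c" "c' \<in> verts t" "anc t u' c'" using childD e f by blast+
  have hull: "convex hull (dpos ` e) = closed_segment (dpos u) (dpos c)"
    "convex hull (dpos ` f) = closed_segment (dpos u') (dpos c')"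
    using e f by (simp_all add: segment_convex_hull)
  show "convex hull (dpos ` e) \<inter> convex hull (dpos ` f) \<subseteq> dpos ` (e \<inter> f)"
  proof
    fix p assume "p \<in> convex hull (dpos ` e) \<inter> convex hull (dpos ` f)"
    then have p: "p \<in> closed_segment (dpos u) (dpos c)" "p \<in> closed_segment (dpos u') (dpos c')"
      using hull by auto
    have b: "fst (dpos u) \<le> fst p" "fst p \<le> fst (dpos c)" "snd (dpos c) \<le> snd p" "snd p \<le> snd (dpos u)"
      using segment_box[OF p(1)] anc_imp_sub[OF cv(2)] by blast+
    have b': "fst (dpos u') \<le> fst p" "fst p \<le> fst (dpos c')" "snd (dpos c') \<le> snd p" "snd p \<le> snd (dpos u')"
      using segment_box[OF p(2)] anc_imp_sub[OF cv(4)] by blast+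
    have ne: "c \<noteq> c'" using child_unique_parent e f ef(3) by blast
    consider "anc t c c'" | "anc t c' c" | "\<not> anc t c c'" "\<not> anc t c' c" by blast
    then show "p \<in> dpos ` (e \<inter> f)"
    proof cases
      case 1
      then have "anc t c u'" using anc_parent f ne by blast
      then have "fst (dpos c) \<le> fst (dpos u')" "snd (dpos u') \<le> snd (dpos c)" using anc_imp_sub by blast+
      then have "p = dpos c" "p = dpos u'" using b b' by (auto simp: prod_eq_iff)
      moreover then have "c = u'" using dpos_inj cv f by metis
      ultimately show ?thesis using e f by blast
    next
      case 2
      then have "anc t c' u" using anc_parent e ne by blast
      then have "fst (dpos c') \<le> fst (dpos u)" "snd (dpos u) \<le> snd (dpos c')" using anc_imp_sub by blast+
      then have "p = dpos c'" "p = dpos u" using b b' by (auto simp: prod_eq_iff)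
      moreover then have "c' = u" using dpos_inj cv e by metis
      ultimately show ?thesis using e f by blast
    next
      case 3
      \<comment> \<open>The common point is an interval inside that of \<open>u\<close> that
        contains that of \<open>c'\<close>. So each upper end point is an ancestor of both lower
        ones, and the edges start at the same vertex.\<close>
      have "anc t u c'" using anc_dpos[of u c'] b b' e cv by auto
      then have a1: "anc t u u'" using anc_parent[of u c' u'] f 3 cv by blast
      have "anc t u' c" using anc_dpos[of u' c] b b' f cv by auto
      then have a2: "anc t u' u" using anc_parent[of u' c u] e 3 cv by blast
      have uu: "u = u'" using a1 a2 anc_antisym by blast
      have "u \<noteq> root t"
      proof
        assume "u = root t"
        then have "card {c, c'} \<le> 1" using card_mono[OF finite_children, of "{c, c'}" u] e f uu root_child by simp
        then show False using ne by simp
      qed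
      then have "u \<in> inodes t" using e leaf_iff by (auto simp: inodes_def)
      then have "p = dpos u" using sibling_segments[of u c c' p] e f uu p ne by blast
      then show ?thesis using e f uu by blast
    qed
  qed
qed

lemma height:
  shows "anc t u v \<Longrightarrow> u \<noteq> v \<Longrightarrow> snd (dpos v) - fst (dpos v) < snd (dpos u) - fst (dpos u)"
    and "m \<in> M \<Longrightarrow> dpos (lab m) = (q m, q m)"
    and "l \<in> leaves t \<Longrightarrow> snd (dpos l) = fst (dpos l)"
    and "v \<in> verts t - leaves t \<Longrightarrow> fst (dpos v) < snd (dpos v)"
proof -
  show 1: "anc t u v \<Longrightarrow> u \<noteq> v \<Longrightarrow> snd (dpos v) - fst (dpos v) < snd (dpos u) - fst (dpos u)" for u v
  proof -
    assume a: "anc t u v" "u \<noteq> v"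
    have "fst (dpos u) \<noteq> fst (dpos v) \<or> snd (dpos u) \<noteq> snd (dpos v)"
      using dpos_inj[of u v] anc_verts[OF a(1)] a(2) prod_eqI by blast
    then show ?thesis using anc_imp_sub[OF a(1)] by (elim disjE) linarith+
  qed
  show 2: "m \<in> M \<Longrightarrow> dpos (lab m) = (q m, q m)" for m
    using cl_leaf lab_leaf leaf_iff by (auto simp: dpos_def lo_def hi_def)
  show 3: "l \<in> leaves t \<Longrightarrow> snd (dpos l) = fst (dpos l)" for l
    using 2 lab_surj by fastforce
  assume v: "v \<in> verts t - leaves t"
  then obtain l where l: "l \<in> leaves t" "anc t v l" "v \<noteq> l" using leaf_below by blast
  then show "fst (dpos v) < snd (dpos v)" using 1[OF l(2,3)] 3[OF l(1)] by simp
qed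

lemma plane_drawing_left: "plane_drawing t dpos (- (1 / sqrt 2, - 1 / sqrt 2)) (- 0)"
  unfolding plane_drawing_def
proof (intro conjI ballI impI)
  have i: "(- (1 / sqrt 2, - 1 / sqrt 2)) \<bullet> x = (snd x - fst x) / sqrt 2" for x :: point
    by (cases x) (simp add: field_simps)
  show "norm (- (1 / sqrt 2, - 1 / sqrt 2) :: point) = 1" by (simp add: norm_Pair power_divide)
  show "crossing_free t dpos" by (rule crossing_free_dpos)
  show "(- (1 / sqrt 2, - 1 / sqrt 2)) \<bullet> dpos v = - 0" if "v \<in> leaves t" for v
    using height(3)[OF that] by (simp only: i) simp
  show "- 0 < (- (1 / sqrt 2, - 1 / sqrt 2)) \<bullet> dpos v" if "v \<in> verts t - leaves t" for v
    using height(4)[OF that] by (simp only: i) simp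
  show "(- (1 / sqrt 2, - 1 / sqrt 2)) \<bullet> dpos v - - 0 < (- (1 / sqrt 2, - 1 / sqrt 2)) \<bullet> dpos u - - 0"
    if "proper_ancestor t u v" for u v
  proof -
    have "snd (dpos v) - fst (dpos v) < snd (dpos u) - fst (dpos u)"
      using that height(1) unfolding proper_ancestor_anc by blast
    then show ?thesis by (simp only: i) (simp add: divide_strict_right_mono)
  qed
qed

text \<open>Reflection in the diagonal, which turns the tree to the other side of its leaf-line,
  followed by a shift by \<open>(1, -1)\<close>. The shift is normal to the diagonal: it opens a
  strip of width \<open>2 / sqrt 2\<close> and preserves positions along the line.\<close>

definition flip :: "point \<Rightarrow> point" where "flip x = (snd x + 1, fst x - 1)"

lemma crossing_free_flip: "crossing_free t (flip \<circ> dpos)"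
proof -
  have lin: "linear (prod.swap :: point \<Rightarrow> point)" by (rule linearI) auto
  have hull: "convex hull (flip ` S) = flip ` (convex hull S)" for S
  proof -
    have f: "flip ` A = (\<lambda>x. (1, - 1) + x) ` (prod.swap ` A)" for A
      unfolding image_image by (rule image_cong) (auto simp: flip_def)
    show ?thesis unfolding f convex_hull_translation convex_hull_linear_image[OF lin] ..
  qed
  have inj: "inj flip" by (rule injI) (auto simp: flip_def prod_eq_iff)
  show ?thesis
    unfolding crossing_free_def
  proof (intro conjI ballI impI)
    show "inj_on (flip \<circ> dpos) (verts t)"
      using inj crossing_free_dpos unfolding crossing_free_def by (meson comp_inj_on inj_on_subset subset_UNIV)
    fix e f assume "e \<in> edges t" "f \<in> edges t" "e \<noteq> f"
    then have "convex hull (dpos ` e) \<inter> convex hull (dpos ` f) \<subseteq> dpos ` (e \<inter> f)"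
      using crossing_free_dpos unfolding crossing_free_def by blast
    then have "flip ` (convex hull (dpos ` e) \<inter> convex hull (dpos ` f)) \<subseteq> flip ` dpos ` (e \<inter> f)" by blast
    then show "convex hull ((flip \<circ> dpos) ` e) \<inter> convex hull ((flip \<circ> dpos) ` f) \<subseteq> (flip \<circ> dpos) ` (e \<inter> f)"
      unfolding image_comp[symmetric] hull image_Int[OF inj] .
  qed
qed

lemma plane_drawing_right: "plane_drawing t (flip \<circ> dpos) (1 / sqrt 2, - 1 / sqrt 2) (2 / sqrt 2)"
  unfolding plane_drawing_def
proof (intro conjI ballI impI)
  have i: "((1 / sqrt 2, - 1 / sqrt 2)) \<bullet> (flip \<circ> dpos) x = (snd (dpos x) - fst (dpos x)) / sqrt 2 + 2 / sqrt 2" for x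
  proof -
    have "((1 / sqrt 2, - 1 / sqrt 2)) \<bullet> (flip \<circ> dpos) x = (snd (dpos x) + 1) / sqrt 2 - (fst (dpos x) - 1) / sqrt 2"
      by (simp add: flip_def)
    also have "\<dots> = ((snd (dpos x) + 1) - (fst (dpos x) - 1)) / sqrt 2" by (simp only: diff_divide_distrib)
    also have "(snd (dpos x) + 1) - (fst (dpos x) - 1) = (snd (dpos x) - fst (dpos x)) + 2" by simp
    finally show ?thesis by (simp only: add_divide_distrib)
  qed
  show "norm ((1 / sqrt 2, - 1 / sqrt 2) :: point) = 1" by (simp add: norm_Pair power_divide)
  show "crossing_free t (flip \<circ> dpos)" by (rule crossing_free_flip)
  show "(1 / sqrt 2, - 1 / sqrt 2) \<bullet> (flip \<circ> dpos) v = 2 / sqrt 2" if "v \<in> leaves t" for v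
    using height(3)[OF that] by (simp only: i) simp
  show "2 / sqrt 2 < (1 / sqrt 2, - 1 / sqrt 2) \<bullet> (flip \<circ> dpos) v" if "v \<in> verts t - leaves t" for v
    using height(4)[OF that] by (simp only: i) simp
  show "(1 / sqrt 2, - 1 / sqrt 2) \<bullet> (flip \<circ> dpos) v - 2 / sqrt 2 < (1 / sqrt 2, - 1 / sqrt 2) \<bullet> (flip \<circ> dpos) u - 2 / sqrt 2"
    if "proper_ancestor t u v" for u v
  proof -
    have "snd (dpos v) - fst (dpos v) < snd (dpos u) - fst (dpos u)"
      using that height(1) unfolding proper_ancestor_anc by blast
    then show ?thesis by (simp only: i) (simp add: divide_strict_right_mono)
  qed
qed

end

text \<open>The difference of the coordinates of a point is twice its parameter on either segment,
  so a common point has equal parameters; at equal parameters the order of the end points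
  persists.\<close>

lemma segments_disjoint:
  fixes p p' r r' :: real
  assumes "p < p'" "r < r'"
  shows "closed_segment (p, p) (r + 1, r - 1) \<inter> closed_segment (p', p') (r' + 1, r' - 1) = {}"
proof (rule ccontr)
  assume "\<not> ?thesis"
  then obtain x where x: "x \<in> closed_segment (p, p) (r + 1, r - 1)" "x \<in> closed_segment (p', p') (r' + 1, r' - 1)" by blast
  obtain s where s: "0 \<le> s" "s \<le> 1" "x = (1 - s) *\<^sub>R (p, p) + s *\<^sub>R (r + 1, r - 1)" using x(1) unfolding in_segment by blast
  obtain s' where s': "x = (1 - s') *\<^sub>R (p', p') + s' *\<^sub>R (r' + 1, r' - 1)" using x(2) unfolding in_segment by blast
  have "fst x - snd x = 2 * s" unfolding s(3) by (simp add: algebra_simps)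
  moreover have "fst x - snd x = 2 * s'" unfolding s' by (simp add: algebra_simps)
  ultimately have "s' = s" by simp
  then have "(1 - s) * p + s * (r + 1) = (1 - s) * p' + s * (r' + 1)" using s(3) s' by simp
  then have "(1 - s) * (p' - p) + s * (r' - r) = 0" by (simp add: algebra_simps)
  moreover have "(1 - s) * (p' - p) \<ge> 0" "s * (r' - r) \<ge> 0" using s assms by simp_all
  ultimately have "(1 - s) * (p' - p) = 0" "s * (r' - r) = 0" by linarith+
  then show False using assms by auto
qed

context valid_tanglegram
begin

lemma layout_of_orders:
  assumes "\<forall>x'\<in>matching T. \<forall>y'\<in>matching T. x' \<noteq> y' \<longrightarrow> {x', y'} \<noteq> {x, y} \<longrightarrow> L.H.lt f x' y' = R.H.lt g x' y'"
  obtains dL dR where "is_layout T dL dR" "crossings T dL dR \<subseteq> {{x, y}}"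
proof -
  interpret L: positioned "left_tree T" "matching T" fst "L.H.pos f"
    by unfold_locales (use L.H.pos_inj L.H.pos_contiguous in blast)+
  interpret R: positioned "right_tree T" "matching T" snd "R.H.pos g"
    by unfold_locales (use R.H.pos_inj R.H.pos_contiguous in blast)+
  have "is_layout T L.dpos (R.flip \<circ> R.dpos)"
    unfolding is_layout_def
    by (rule exI[of _ "(1 / sqrt 2, - 1 / sqrt 2)"], rule exI[of _ 0], rule exI[of _ "2 / sqrt 2"])
      (use L.plane_drawing_left R.plane_drawing_right in simp)
  moreover have "crossings T L.dpos (R.flip \<circ> R.dpos) \<subseteq> {{x, y}}"
  proof
    fix e assume "e \<in> crossings T L.dpos (R.flip \<circ> R.dpos)"
    then obtain a b where ab: "e = {a, b}" "a \<in> matching T" "b \<in> matching T" "a \<noteq> b"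
      "closed_segment (L.dpos (fst a)) ((R.flip \<circ> R.dpos) (snd a)) \<inter>
        closed_segment (L.dpos (fst b)) ((R.flip \<circ> R.dpos) (snd b)) \<noteq> {}"
      unfolding crossings_def by fastforce
    have d: "L.dpos (fst m) = (L.H.pos f m, L.H.pos f m)"
      "(R.flip \<circ> R.dpos) (snd m) = (R.H.pos g m + 1, R.H.pos g m - 1)" if "m \<in> matching T" for m
      using L.height(2)[OF that] R.height(2)[OF that] by (simp_all add: R.flip_def)
    note ne = ab(5)[unfolded d[OF ab(2)] d[OF ab(3)]]
    have no: "\<not> (L.H.lt f a b \<and> R.H.lt g a b)" "\<not> (L.H.lt f b a \<and> R.H.lt g b a)"
      using segments_disjoint[OF L.H.pos_less R.H.pos_less, of f a b g a b]
        segments_disjoint[OF L.H.pos_less R.H.pos_less, of f b a g b a] ne by blast+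
    have "{a, b} = {x, y}"
    proof (rule ccontr)
      assume n: "{a, b} \<noteq> {x, y}"
      then have "L.H.lt f a b = R.H.lt g a b" "L.H.lt f b a = R.H.lt g b a"
        using assms[rule_format, of a b] assms[rule_format, of b a] ab(2-4) by (simp_all add: insert_commute)
      then show False using no L.H.lt_total[OF ab(2-4), of f] by blast
    qed
    then show "e \<in> {{x, y}}" using ab(1) by simp
  qed
  ultimately show thesis using that by blast
qed

end

section \<open>Leaves of a subtree are contiguous\<close>

definition perp :: "point \<Rightarrow> point \<Rightarrow> real" where
  "perp n x = fst n * snd x - snd n * fst x"

lemma coordinates_inj:
  assumes "norm (n :: point) = 1" "n \<bullet> x = n \<bullet> y" "perp n x = perp n y"
  shows "x = y"
proof -
  have n: "fst n * fst n + snd n * snd n = 1"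
    using assms(1) by (cases n) (simp add: norm_Pair power2_eq_square)
  define u where "u = fst x - fst y"
  define w where "w = snd x - snd y"
  have 1: "fst n * u + snd n * w = 0" and 2: "fst n * w - snd n * u = 0"
    using assms(2,3) unfolding u_def w_def by (simp_all add: inner_prod_def perp_def algebra_simps)
  have "u = (fst n * fst n + snd n * snd n) * u" using n by simp
  also have "\<dots> = fst n * (fst n * u + snd n * w) - snd n * (fst n * w - snd n * u)" by (simp add: algebra_simps)
  finally have "u = 0" using 1 2 by simp
  have "w = (fst n * fst n + snd n * snd n) * w" using n by simp
  also have "\<dots> = snd n * (fst n * u + snd n * w) + fst n * (fst n * w - snd n * u)" by (simp add: algebra_simps)
  finally have "w = 0" using 1 2 by simp
  then show ?thesis using \<open>u = 0\<close> unfolding u_def w_def by (simp add: prod_eq_iff)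
qed

lemma perp_linear: "perp n (x + y) = perp n x + perp n y" "perp n (r *\<^sub>R x) = r * perp n x"
  by (simp_all add: perp_def algebra_simps)

lemma perp_minus: "perp (- n) x = - perp n x"
  by (simp add: perp_def)

text \<open>An arbitrary half-plane in the coordinates normal and parallel to the leaf-line; its
  instances bound edges from all four directions.\<close>

lemma hull_bound:
  assumes "x \<in> convex hull S" "\<And>y. y \<in> S \<Longrightarrow> \<alpha> * (n \<bullet> y) + \<beta> * perp n y \<le> k"
  shows "\<alpha> * (n \<bullet> x) + \<beta> * perp n x \<le> k"
proof -
  have "convex {y. \<alpha> * (n \<bullet> y) + \<beta> * perp n y \<le> k}"
  proof -
    have "{y. \<alpha> * (n \<bullet> y) + \<beta> * perp n y \<le> k} = {y. (\<alpha> *\<^sub>R n + \<beta> *\<^sub>R (- snd n, fst n)) \<bullet> y \<le> k}"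
      by (auto simp: inner_add_left perp_def inner_prod_def algebra_simps)
    then show ?thesis by (simp add: convex_halfspace_le)
  qed
  then have "convex hull S \<subseteq> {y. \<alpha> * (n \<bullet> y) + \<beta> * perp n y \<le> k}"
    using assms(2) by (intro hull_minimal) auto
  then show ?thesis using assms(1) by blast
qed

definition edge_points :: "('v, 'z) graph_scheme \<Rightarrow> ('v \<Rightarrow> point) \<Rightarrow> 'v set \<Rightarrow> point set" where
  "edge_points G d A = \<Union> {convex hull (d ` e) | e. e \<in> edges G \<and> e \<subseteq> A}"

lemma edge_points_mono: "A \<subseteq> B \<Longrightarrow> edge_points G d A \<subseteq> edge_points G d B"
  unfolding edge_points_def by blast

lemma path_along_list:
  assumes "successively (\<lambda>x y. {x, y} \<in> edges G) (x # y # xs)"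
  shows "\<exists>g. path g \<and> pathstart g = d x \<and> pathfinish g = d (last (y # xs)) \<and>
    path_image g \<subseteq> edge_points G d (set (x # y # xs))"
  using assms
proof (induction xs arbitrary: x y)
  case Nil
  have "path_image (linepath (d x) (d y)) = convex hull (d ` {x, y})" by (simp add: segment_convex_hull)
  moreover have "{x, y} \<in> edges G" using Nil by simp
  ultimately have "path_image (linepath (d x) (d y)) \<subseteq> edge_points G d {x, y}" unfolding edge_points_def by blast
  then show ?case by (intro exI[of _ "linepath (d x) (d y)"]) simp
next
  case (Cons z zs)
  have e: "{x, y} \<in> edges G" and s: "successively (\<lambda>x y. {x, y} \<in> edges G) (y # z # zs)" using Cons.prems by auto
  obtain g where g: "path g" "pathstart g = d y" "pathfinish g = d (last (z # zs))"
    "path_image g \<subseteq> edge_points G d (set (y # z # zs))" using Cons.IH[OF s] by blast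
  have "path_image (linepath (d x) (d y)) = convex hull (d ` {x, y})" by (simp add: segment_convex_hull)
  then have 1: "path_image (linepath (d x) (d y)) \<subseteq> edge_points G d (set (x # y # z # zs))"
    using e unfolding edge_points_def by fastforce
  have 2: "path_image g \<subseteq> edge_points G d (set (x # y # z # zs))"
    using g(4) edge_points_mono[of "set (y # z # zs)" "set (x # y # z # zs)" G d] by auto
  show ?case
    using g 1 2 by (intro exI[of _ "linepath (d x) (d y) +++ g"]) (simp add: path_image_join)
qed

lemma edge_points_disjoint:
  assumes "crossing_free G d" "A \<inter> B = {}" "{} \<notin> edges G"
  shows "edge_points G d A \<inter> edge_points G d B = {}"
proof (rule ccontr)
  assume "\<not> ?thesis"
  then obtain x e f where x: "e \<in> edges G" "e \<subseteq> A" "x \<in> convex hull (d ` e)" "f \<in> edges G" "f \<subseteq> B" "x \<in> convex hull (d ` f)"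
    unfolding edge_points_def by blast
  have ef: "e \<inter> f = {}" using x assms(2) by blast
  have "e \<noteq> f"
  proof
    assume "e = f"
    then have "e = {}" using ef by simp
    then show False using x(1) assms(3) by simp
  qed
  then have "convex hull (d ` e) \<inter> convex hull (d ` f) \<subseteq> d ` (e \<inter> f)"
    using assms(1) x unfolding crossing_free_def by blast
  then show False using x ef by blast
qed

lemma (in hierarchy) balanced_not_caterpillar:
  assumes "balanced p q r s" "caterpillar a b c d" "{p, q, r, s} = {a, b, c, d}" "p \<noteq> q" "r \<noteq> s"
  shows False
proof -
  obtain u where u: "splits u p r" "splits u p s" "splits u q r" "splits u q s"
    using assms(1) unfolding balanced_def by blast
  obtain v where v: "splits v a b" "splits v a c" "splits v a d" using assms(2) unfolding caterpillar_def by blast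
  have mem: "p \<in> {a, b, c, d}" "q \<in> {a, b, c, d}" "r \<in> {a, b, c, d}" "s \<in> {a, b, c, d}"
    by (simp_all add: assms(3)[symmetric])
  have "a \<in> {p, q, r, s}" by (simp add: assms(3))
  then obtain x where x: "splits u a x" "x \<noteq> a" "x \<in> {a, b, c, d}"
    using u mem splits_sym splitsD by (metis empty_iff insert_iff)
  then have "splits v a x" using v by auto
  then have uv: "u = v" using splits_unique x(1) by blast
  have side: "side u y \<noteq> side u a" if "y \<in> {a, b, c, d}" "y \<noteq> a" for y
    using v that uv unfolding splits_def by auto
  have "side u p = side u q" "side u r = side u s" "side u p \<noteq> side u r" using u unfolding splits_def by blast+
  then show False using side[OF mem(1)] side[OF mem(2)] side[OF mem(3)] side[OF mem(4)] \<open>a \<in> {p, q, r, s}\<close> assms(4,5)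
    by auto
qed

context leaf_set
begin

lemma subtree_path:
  assumes "anc t v p" "v \<noteq> p"
  shows "\<exists>g. path g \<and> pathstart g = d v \<and> pathfinish g = d p \<and>
    path_image g \<subseteq> edge_points t d {w. anc t v w \<and> anc t w p}"
proof -
  obtain xs ys where ys: "path_between t v (v # ys) p" "set (v # ys) = {w. anc t v w \<and> anc t w p}"
    using path_down[OF assms(1)] by blast
  obtain y zs where y: "ys = y # zs" using ys(1) assms(2) by (cases ys) (auto simp: path_between_def)
  have "successively (\<lambda>x y. {x, y} \<in> edges t) (v # y # zs)" "last (y # zs) = p"
    using ys(1) y unfolding path_between_def by simp_all
  then show ?thesis using path_along_list[of t v y zs d] ys(2) y by simp
qed

text \<open>
  In the coordinates given by \<open>perp n\<close> and the distance to the leaf-line, the path from \<open>r\<close> to the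
  root is continued upwards, then far to the right and down to the leaf-line.  It interlaces with the
  path from \<open>p\<close> to \<open>q\<close> through \<open>v\<close>, so the Fashoda theorem yields a common point.
\<close>

lemma not_between:
  assumes pd: "plane_drawing t d n c" and l: "p \<in> leaves t" "q \<in> leaves t" "r \<in> leaves t"
    and v: "anc t v p" "anc t v q" "\<not> anc t v r"
  shows "\<not> (perp n (d p) < perp n (d r) \<and> perp n (d r) < perp n (d q))"
proof
  assume lt: "perp n (d p) < perp n (d r) \<and> perp n (d r) < perp n (d q)"
  have n1: "norm n = 1" and cf: "crossing_free t d" using pd unfolding plane_drawing_def by blast+
  define h where "h = (\<lambda>x. n \<bullet> x - c)"
  have hl: "h (d w) = 0" if "w \<in> leaves t" for w using pd that unfolding plane_drawing_def h_def by simp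
  have h0: "h (d w) \<ge> 0" if "w \<in> verts t" for w
    using pd that hl[of w] unfolding plane_drawing_def h_def by (cases "w \<in> leaves t") force+
  have hm: "h (d y) < h (d x)" if "anc t x y" "x \<noteq> y" for x y
    using pd anc_verts[OF that(1)] that unfolding plane_drawing_def proper_ancestor_anc h_def by blast
  have vv: "v \<in> verts t" "r \<in> verts t" using anc_verts v leaf_verts l by blast+
  have vr: "v \<noteq> root t" using v(3) anc_root vv by blast
  have "p \<noteq> q" using lt by auto
  then have vp: "v \<noteq> p" "v \<noteq> q" using v leaf_anc l by blast+
  have rr: "root t \<noteq> r" using l leaf_iff by blast
  define R where "R = root t"
  define H where "H = h (d R)"
  \<comment> \<open>\<open>A\<close> holds the two lower paths and \<open>B\<close> the path to the
    root. They have no vertex in common because \<open>v\<close> is not above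
    \<open>r\<close>.\<close>
  define A where "A = {w. anc t v w}"
  define B where "B = {w. anc t w r}"
  have "finite (verts t)" using basics by blast
  \<comment> \<open>\<open>K\<close> bounds the lateral extent of the drawing, as the root height
    \<open>H\<close> bounds its height.\<close>
  define K where "K = Max ((\<lambda>w. \<bar>perp n (d w)\<bar>) ` verts t)"
  have K: "\<bar>perp n (d w)\<bar> \<le> K" if "w \<in> verts t" for w
    unfolding K_def using that \<open>finite (verts t)\<close> by (intro Max_ge) auto
  have HR: "h (d w) \<le> H" if "w \<in> verts t" for w
    using hm[of R w] anc_root[OF that] unfolding R_def H_def by (cases "root t = w") auto
  have Hv: "h (d v) < H" using hm[of R v] anc_root[OF vv(1)] vr unfolding R_def H_def by blast
  have AB: "A \<subseteq> verts t" "B \<subseteq> verts t" "A \<inter> B = {}"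
    using anc_verts v(3) anc_trans unfolding A_def B_def by blast+
  have "{} \<notin> edges t" unfolding edges_eq by blast
  then have disj: "edge_points t d A \<inter> edge_points t d B = {}" using edge_points_disjoint[OF cf AB(3)] by blast
  have bound: "0 \<le> h x \<and> h x \<le> H \<and> \<bar>perp n x\<bar> \<le> K" if C: "C \<subseteq> verts t" "x \<in> edge_points t d C" for x C
  proof -
    obtain e where e: "e \<subseteq> C" "x \<in> convex hull (d ` e)" using C(2) unfolding edge_points_def by blast
    have y: "0 \<le> h y \<and> h y \<le> H \<and> \<bar>perp n y\<bar> \<le> K" if "y \<in> d ` e" for y
      using that e(1) C(1) h0 HR K by blast
    have "0 \<le> h x" using hull_bound[OF e(2), of "-1" n 0 "-c"] y unfolding h_def by force
    moreover have "h x \<le> H" using hull_bound[OF e(2), of 1 n 0 "c + H"] y unfolding h_def by force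
    moreover have "perp n x \<le> K" using hull_bound[OF e(2), of 0 n 1 K] y by force
    moreover have "- perp n x \<le> K" using hull_bound[OF e(2), of 0 n "-1" K] y by force
    ultimately show ?thesis by simp
  qed
  have boundA: "h x \<le> h (d v)" if x: "x \<in> edge_points t d A" for x
  proof -
    obtain e where e: "e \<subseteq> A" "x \<in> convex hull (d ` e)" using x unfolding edge_points_def by blast
    have "h y \<le> h (d v)" if y: "y \<in> d ` e" for y
    proof -
      obtain w where w: "y = d w" "anc t v w" using y e(1) unfolding A_def by blast
      then show ?thesis using hm[of v w] by (cases "v = w") auto
    qed
    then show ?thesis using hull_bound[OF e(2), of 1 n 0 "n \<bullet> d v"] unfolding h_def by force
  qed
  obtain g1 where g1: "path g1" "pathstart g1 = d v" "pathfinish g1 = d p"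
    "path_image g1 \<subseteq> edge_points t d {w. anc t v w \<and> anc t w p}" using subtree_path[OF v(1) vp(1)] by blast
  obtain g2 where g2: "path g2" "pathstart g2 = d v" "pathfinish g2 = d q"
    "path_image g2 \<subseteq> edge_points t d {w. anc t v w \<and> anc t w q}" using subtree_path[OF v(2) vp(2)] by blast
  obtain g3 where g3: "path g3" "pathstart g3 = d R" "pathfinish g3 = d r"
    "path_image g3 \<subseteq> edge_points t d {w. anc t R w \<and> anc t w r}"
    using subtree_path[OF anc_root[OF vv(2)] rr] unfolding R_def by blast
  have i1: "path_image g1 \<subseteq> edge_points t d A" "path_image g2 \<subseteq> edge_points t d A" "path_image g3 \<subseteq> edge_points t d B"
    unfolding A_def B_def
    by (rule order_trans[OF g1(4) edge_points_mono] order_trans[OF g2(4) edge_points_mono]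
        order_trans[OF g3(4) edge_points_mono], blast)+
  define \<phi> :: "point \<Rightarrow> real^2" where "\<phi> = (\<lambda>x. \<chi> i. if i = 1 then perp n x else h x)"
  have \<phi>: "\<phi> x $ 1 = perp n x" "\<phi> x $ 2 = h x" for x by (simp_all add: \<phi>_def)
  have \<phi>c: "continuous_on S \<phi>" for S
    unfolding \<phi>_def
  proof (rule continuous_on_vec_lambda)
    show "continuous_on S (\<lambda>x. if i = 1 then perp n x else h x)" for i :: 2
      unfolding h_def perp_def by (cases "i = 1") (auto intro!: continuous_intros)
  qed
  have \<phi>i: "x = y" if "\<phi> x = \<phi> y" for x y
  proof -
    have "perp n x = perp n y" "h x = h y" using that \<phi> by metis+
    then show ?thesis using coordinates_inj[OF n1] unfolding h_def by simp
  qed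
  define F where "F = \<phi> \<circ> (reversepath g1 +++ g2)"
  \<comment> \<open>The detour runs one unit above the root and one unit to the right of the whole
    drawing, so it meets the drawing only on the way up from the root.\<close>
  define P1 :: "real^2" where "P1 = vector [perp n (d R), H + 1]"
  define P2 :: "real^2" where "P2 = vector [K + 1, H + 1]"
  define P3 :: "real^2" where "P3 = vector [K + 1, 0]"
  define G where "G = (\<phi> \<circ> reversepath g3) +++ linepath (\<phi> (d R)) P1 +++ linepath P1 P2 +++ linepath P2 P3"
  have Fp: "path F" "pathstart F = \<phi> (d p)" "pathfinish F = \<phi> (d q)"
    unfolding F_def using g1 g2 by (auto intro!: path_continuous_image \<phi>c simp: pathstart_compose pathfinish_compose)
  have Fi: "path_image F \<subseteq> \<phi> ` edge_points t d A"
    unfolding F_def path_image_compose using g1 g2 i1 by (simp add: path_image_join image_mono)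
  have Gp: "path G" "pathstart G = \<phi> (d r)" "pathfinish G = P3"
    unfolding G_def using g3 by (auto intro!: path_continuous_image \<phi>c simp: pathstart_compose pathfinish_compose)
  have Gi: "path_image G \<subseteq> \<phi> ` edge_points t d B \<union> closed_segment (\<phi> (d R)) P1 \<union> closed_segment P1 P2 \<union> closed_segment P2 P3"
  proof -
    have "path_image (\<phi> \<circ> reversepath g3) \<subseteq> \<phi> ` edge_points t d B"
      unfolding path_image_compose using i1(3) by (simp add: image_mono)
    then show ?thesis unfolding G_def using g3
      by (subst path_image_join; simp add: pathfinish_compose) (auto simp: path_image_join)
  qed
  have RV: "R \<in> verts t" using basics unfolding R_def by blast
  have comp: "z $ i \<in> closed_segment (x $ i) (y $ i)" if "z \<in> closed_segment x y" for x y z :: "real^2" and i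
    using that by (auto simp: closed_segment_def)
  have s1: "z $ 1 = perp n (d R) \<and> H \<le> z $ 2 \<and> z $ 2 \<le> H + 1" if "z \<in> closed_segment (\<phi> (d R)) P1" for z
    using comp[OF that, of 1] comp[OF that, of 2] unfolding P1_def by (auto simp: \<phi> H_def closed_segment_eq_real_ivl split: if_splits)
  have s2: "z $ 2 = H + 1 \<and> - K \<le> z $ 1 \<and> z $ 1 \<le> K + 1" if "z \<in> closed_segment P1 P2" for z
    using comp[OF that, of 1] comp[OF that, of 2] K[OF RV] unfolding P1_def P2_def by (auto simp: closed_segment_eq_real_ivl split: if_splits)
  have H0: "0 \<le> H" using h0[OF RV] unfolding H_def .
  have s3: "z $ 1 = K + 1 \<and> 0 \<le> z $ 2 \<and> z $ 2 \<le> H + 1" if "z \<in> closed_segment P2 P3" for z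
    using comp[OF that, of 1] comp[OF that, of 2] H0 unfolding P3_def P2_def by (auto simp: closed_segment_eq_real_ivl split: if_splits)
  have K0: "0 \<le> K" using K[OF RV] by linarith
  define lo :: "real^2" where "lo = vector [- K - 1, 0]"
  define hi :: "real^2" where "hi = vector [K + 1, H + 1]"
  have box: "z \<in> cbox lo hi \<longleftrightarrow> - K - 1 \<le> z $ 1 \<and> z $ 1 \<le> K + 1 \<and> 0 \<le> z $ 2 \<and> z $ 2 \<le> H + 1" for z
    unfolding lo_def hi_def mem_box_cart forall_2 by auto
  have inbox: "\<phi> x \<in> cbox lo hi" if "x \<in> edge_points t d C" "C \<subseteq> verts t" for x C
    using bound[OF that(2,1)] unfolding box \<phi> by auto
  have Fb: "path_image F \<subseteq> cbox lo hi" using Fi inbox AB by blast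
  have Gb: "path_image G \<subseteq> cbox lo hi"
  proof
    fix z assume "z \<in> path_image G"
    then consider "z \<in> \<phi> ` edge_points t d B" | "z \<in> closed_segment (\<phi> (d R)) P1" | "z \<in> closed_segment P1 P2" | "z \<in> closed_segment P2 P3"
      using Gi by blast
    then show "z \<in> cbox lo hi"
    proof cases
      case 1 then show ?thesis using inbox AB by blast
    next
      case 2 then show ?thesis using s1 K[OF RV] H0 unfolding box by force
    next
      case 3 then show ?thesis using s2 H0 K0 unfolding box by force
    next
      case 4 then show ?thesis using s3 H0 K0 unfolding box by force
    qed
  qed
  obtain z where z: "z \<in> path_image F" "z \<in> path_image G"
  proof (rule fashoda_interlace[of F G lo hi])
    show "pathstart F $ 2 = lo $ 2" "pathfinish F $ 2 = lo $ 2" "pathstart G $ 2 = lo $ 2" "pathfinish G $ 2 = lo $ 2"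
      using Fp Gp hl l unfolding lo_def P3_def by (simp_all add: \<phi>)
    show "pathstart F $ 1 < pathstart G $ 1" "pathstart G $ 1 < pathfinish F $ 1"
      using Fp Gp lt by (simp_all add: \<phi>)
    show "pathfinish F $ 1 < pathfinish G $ 1"
      using Fp Gp K[of q] leaf_verts l unfolding P3_def by (force simp: \<phi>)
  qed (use Fp Gp Fb Gb in auto)
  obtain x where x: "z = \<phi> x" "x \<in> edge_points t d A" using z(1) Fi by blast
  have zx: "z $ 1 = perp n x" "z $ 2 = h x" using x \<phi> by auto
  \<comment> \<open>\<open>v\<close> is not the root, so the lower paths stay strictly below height
    \<open>H\<close> and within lateral distance \<open>K\<close>. They miss the detour, and a
    common point must lie on the drawn path from the root to \<open>r\<close>.\<close>
  have bx: "\<bar>perp n x\<bar> \<le> K" "h x < H" using bound[OF AB(1) x(2)] boundA[OF x(2)] Hv by auto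
  have "z \<in> \<phi> ` edge_points t d B \<or> z \<in> closed_segment (\<phi> (d R)) P1 \<or> z \<in> closed_segment P1 P2 \<or> z \<in> closed_segment P2 P3"
    using z(2) Gi by blast
  then show False
  proof (elim disjE)
    assume "z \<in> \<phi> ` edge_points t d B"
    then obtain y where "z = \<phi> y" "y \<in> edge_points t d B" by blast
    then show False using \<phi>i[of x y] x disj by auto
  next
    assume "z \<in> closed_segment (\<phi> (d R)) P1" then show False using s1 zx bx by force
  next
    assume "z \<in> closed_segment P1 P2" then show False using s2 zx bx by force
  next
    assume "z \<in> closed_segment P2 P3" then show False using s3 zx bx by force
  qed
qed

end

section \<open>A crossing in every layout, and the crossing number\<close>

context valid_tanglegram
begin

lemma crossing_exists:
  assumes L: "L.H.caterpillar a b c e" and R: "R.H.caterpillar e b c a" and lay: "is_layout T dL dR"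
  shows "crossings T dL dR \<noteq> {}"
proof
  assume none: "crossings T dL dR = {}"
  obtain n s s' where s: "s < s'" and pl: "plane_drawing (left_tree T) dL (- n) (- s)" and pr: "plane_drawing (right_tree T) dR n s'"
    using lay unfolding is_layout_def by blast
  have n1: "norm n = 1" using pr unfolding plane_drawing_def by blast
  define \<mu> :: "'a \<times> 'b \<Rightarrow> real" where "\<mu> = (\<lambda>m. perp n (dL (fst m)))"
  define \<rho> :: "'a \<times> 'b \<Rightarrow> real" where "\<rho> = (\<lambda>m. perp n (dR (snd m)))"
  have nL: "n \<bullet> dL (fst m) = s" if "m \<in> matching T" for m
  proof -
    have "(- n) \<bullet> dL (fst m) = - s" using pl L.lab_leaf[OF that] unfolding plane_drawing_def by blast
    then show ?thesis by simp
  qed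
  have nR: "n \<bullet> dR (snd m) = s'" if "m \<in> matching T" for m
    using pr R.lab_leaf[OF that] unfolding plane_drawing_def by blast
  have order: "\<rho> x < \<rho> y" if xy: "x \<in> matching T" "y \<in> matching T" "\<mu> x < \<mu> y" for x y
  proof (rule ccontr)
    assume n: "\<not> \<rho> x < \<rho> y"
    define D where "D = (\<mu> y - \<mu> x) + (\<rho> x - \<rho> y)"
    \<comment> \<open>The parameter at which the linear interpolations from \<open>\<mu>\<close> to
      \<open>\<rho>\<close> of the two edges coincide. Both points have the same height in the
      strip, so they are equal.\<close>
    define k where "k = (\<mu> y - \<mu> x) / D"
    have D: "D > 0" "\<mu> y - \<mu> x \<le> D" using xy n unfolding D_def by auto
    have k: "0 \<le> k" "k \<le> 1" using D xy unfolding k_def by auto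
    have kD: "k * D = \<mu> y - \<mu> x" using D unfolding k_def by simp
    define P where "P = (\<lambda>m. (1 - k) *\<^sub>R dL (fst m) + k *\<^sub>R dR (snd m))"
    have pp: "perp n (P m) = (1 - k) * \<mu> m + k * \<rho> m" for m
      unfolding P_def \<mu>_def \<rho>_def perp_linear ..
    have "perp n (P y) - perp n (P x) = (\<mu> y - \<mu> x) - k * D"
      unfolding D_def pp by (simp add: algebra_simps)
    then have "perp n (P x) = perp n (P y)" using kD by simp
    moreover have "n \<bullet> P x = n \<bullet> P y"
      unfolding P_def inner_add_right inner_scaleR_right nL[OF xy(1)] nL[OF xy(2)] nR[OF xy(1)] nR[OF xy(2)] ..
    ultimately have "P x = P y" using coordinates_inj[OF n1] by blast
    moreover have "P m \<in> closed_segment (dL (fst m)) (dR (snd m))" for m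
      unfolding P_def in_segment using k by blast
    ultimately have "closed_segment (dL (fst x)) (dR (snd x)) \<inter> closed_segment (dL (fst y)) (dR (snd y)) \<noteq> {}"
      by (metis IntI empty_iff)
    moreover have "x \<noteq> y" using xy(3) by auto
    ultimately have "{x, y} \<in> crossings T dL dR"
      unfolding crossings_def using xy(1,2)
      by (intro CollectI exI[of _ "fst x"] exI[of _ "snd x"] exI[of _ "fst y"] exI[of _ "snd y"]) simp
    then show False using none by blast
  qed
  have distinct: "\<mu> x \<noteq> \<mu> y" if xy: "x \<in> matching T" "y \<in> matching T" "x \<noteq> y" for x y
  proof
    assume "\<mu> x = \<mu> y"
    then have "dL (fst x) = dL (fst y)" using coordinates_inj[OF n1] nL xy unfolding \<mu>_def by metis
    moreover have "inj_on dL (verts (left_tree T))" using pl unfolding plane_drawing_def crossing_free_def by blast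
    ultimately have "fst x = fst y" using inj_onD L.leaf_verts L.lab_leaf xy by metis
    then show False using L.lab_inj xy by blast
  qed
  have order2: "\<mu> x < \<mu> y \<longleftrightarrow> \<rho> x < \<rho> y" if "x \<in> matching T" "y \<in> matching T" "x \<noteq> y" for x y
    using order[of x y] order[of y x] distinct[of x y] that by (metis less_asym neqE)
  \<comment> \<open>\<open>not_between\<close> requires a nonempty leaf set. All leaves are taken,
    and the caterpillar shows that there are some.\<close>
  interpret L': sublabelled "left_tree T" "matching T" fst "matching T"
    by unfold_locales (use L L.H.splitsD in \<open>unfold L.H.caterpillar_def, blast+\<close>)
  interpret R': sublabelled "right_tree T" "matching T" snd "matching T"
    by unfold_locales (use L L.H.splitsD in \<open>unfold L.H.caterpillar_def, blast+\<close>)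
  have betL: "\<not> (\<mu> x < \<mu> z \<and> \<mu> z < \<mu> y)" if "x \<in> L.cl v" "y \<in> L.cl v" "z \<notin> L.cl v" "z \<in> matching T" for x y z v
  proof -
    have "anc (left_tree T) v (fst x)" "anc (left_tree T) v (fst y)" "\<not> anc (left_tree T) v (fst z)" "x \<in> matching T" "y \<in> matching T"
      using that unfolding L.cl_def by blast+
    then show ?thesis
      using L'.not_between[OF pl, of "fst y" "fst x" "fst z" v] L.lab_leaf that(4) unfolding perp_minus \<mu>_def by auto
  qed
  have betR: "\<not> (\<rho> x < \<rho> z \<and> \<rho> z < \<rho> y)" if "x \<in> R.cl v" "y \<in> R.cl v" "z \<notin> R.cl v" "z \<in> matching T" for x y z v
  proof -
    have "anc (right_tree T) v (snd x)" "anc (right_tree T) v (snd y)" "\<not> anc (right_tree T) v (snd z)" "x \<in> matching T" "y \<in> matching T"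
      using that unfolding R.cl_def by blast+
    then show ?thesis
      using R'.not_between[OF pr, of "snd x" "snd y" "snd z" v] R.lab_leaf that(4) unfolding \<rho>_def by auto
  qed
  obtain u1 u2 where u1: "L.H.splits u1 a b" "L.H.splits u1 a c" "L.H.splits u1 a e"
    and u2: "L.H.splits u2 b c" "L.H.splits u2 b e" using L unfolding L.H.caterpillar_def by blast
  obtain w1 w2 where w1: "R.H.splits w1 e b" "R.H.splits w1 e c" "R.H.splits w1 e a"
    and w2: "R.H.splits w2 b c" "R.H.splits w2 b a" using R unfolding R.H.caterpillar_def by blast
  have M: "a \<in> matching T" "b \<in> matching T" "c \<in> matching T" "e \<in> matching T"
    and ne: "a \<noteq> b" "a \<noteq> c" "a \<noteq> e" "b \<noteq> c" "b \<noteq> e" "c \<noteq> e"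
    using u1 u2 w1 L.H.splitsD R.H.splitsD by blast+
  obtain u3 where u3: "L.H.splits u3 c e" using L.H.splits_exists M ne by blast
  obtain w3 where w3: "R.H.splits w3 c a" using R.H.splits_exists M ne by blast
  have out: "a \<notin> L.cl u2" "b \<notin> L.cl u3" "e \<notin> R.cl w2" "b \<notin> R.cl w3"
    using L.H.excluded[OF u1(1,2) u2(1)] L.H.excluded[OF u2 u3] R.H.excluded[OF w1(1,2) w2(1)] R.H.excluded[OF w2 w3] by blast+
  have ins: "b \<in> L.cl u2" "c \<in> L.cl u2" "e \<in> L.cl u2" "c \<in> L.cl u3" "e \<in> L.cl u3"
    "b \<in> R.cl w2" "c \<in> R.cl w2" "a \<in> R.cl w2" "c \<in> R.cl w3" "a \<in> R.cl w3"
    using u2 u3 w2 w3 unfolding L.H.splits_def R.H.splits_def by blast+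
  \<comment> \<open>Contiguity of the clusters of \<open>u2\<close>, \<open>u3\<close> on the left
    and \<open>w2\<close>, \<open>w3\<close> on the right, all expressed in the common order
    \<open>\<mu>\<close>.\<close>
  have A: "\<not> (\<mu> x < \<mu> a \<and> \<mu> a < \<mu> y)" if "x \<in> {b, c, e}" "y \<in> {b, c, e}" for x y
    using betL[of x u2 y a] that ins out M by blast
  have B: "\<not> (\<mu> c < \<mu> b \<and> \<mu> b < \<mu> e)" "\<not> (\<mu> e < \<mu> b \<and> \<mu> b < \<mu> c)"
    using betL[of c u3 e b] betL[of e u3 c b] ins out M by blast+
  have E: "\<not> (\<mu> x < \<mu> e \<and> \<mu> e < \<mu> y)" if "x \<in> {b, c, a}" "y \<in> {b, c, a}" for x y
  proof -
    have "x \<in> R.cl w2" "y \<in> R.cl w2" "x \<in> matching T" "y \<in> matching T" "x \<noteq> e" "y \<noteq> e" using that ins M ne by auto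
    then show ?thesis using betR[of x w2 y e] out M order2[of x e] order2[of e y] by auto
  qed
  have F: "\<not> (\<mu> c < \<mu> b \<and> \<mu> b < \<mu> a)" "\<not> (\<mu> a < \<mu> b \<and> \<mu> b < \<mu> c)"
    using betR[of c w3 a b] betR[of a w3 c b] ins out M ne order2[of c b] order2[of b a] order2[of a b] order2[of b c] by auto
  have "\<mu> a \<noteq> \<mu> b" "\<mu> a \<noteq> \<mu> c" "\<mu> a \<noteq> \<mu> e" "\<mu> b \<noteq> \<mu> c" "\<mu> b \<noteq> \<mu> e" "\<mu> c \<noteq> \<mu> e"
    using distinct M ne by blast+
  note ds = this
  \<comment> \<open>\<open>a\<close> and \<open>e\<close> are extremal on opposite ends, so
    \<open>b\<close> lies between \<open>c\<close> and one of them; both cases are excluded.\<close>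
  consider "\<mu> a < \<mu> b" | "\<mu> b < \<mu> a" using ds(1) by linarith
  then show False
  proof cases
    case 1
    then have "\<mu> a < \<mu> c" "\<mu> a < \<mu> e" using A[of c b] A[of e b] ds(2,3) by auto
    then have "\<mu> b < \<mu> e" using E[of a b] 1 ds(5) by auto
    then have "\<mu> b < \<mu> c" using B(1) ds(4) by auto
    then show False using F(2) 1 by blast
  next
    case 2
    then have "\<mu> c < \<mu> a" "\<mu> e < \<mu> a" using A[of b c] A[of b e] ds(2,3) by auto
    then have "\<mu> e < \<mu> b" using E[of b a] 2 ds(5) by auto
    then have "\<mu> c < \<mu> b" using B(2) ds(4) by auto
    then show False using F(1) 2 by blast
  qed
qed

end

theorem theorem4:
  fixes T :: "('a, 'b) tanglegram" and X :: "('a \<times> 'b) set"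
  assumes "is_tanglegram T"
    and "{Y. cross_responsible T Y} = {X}"
    and "tanglegram_isomorphic (induced_tanglegram T X) K2"
  shows "crt T = 1"
proof -
  interpret valid_tanglegram T by unfold_locales (rule assms(1))
  have unique: "Y = X" if "cross_responsible T Y" for Y using that assms(2) by blast
  have "cross_responsible T X" using assms(2) by blast
  then have X: "X \<subseteq> matching T" by (simp add: cross_responsible_def)
  obtain a b c d where abcd: "X = {a, b, c, d}" "L.H.caterpillar a b c d" "R.H.caterpillar d b c a"
    using caterpillars_of_K2[OF X assms(3)] by blast
  obtain v1 v2 where v: "L.H.splits v1 a b" "L.H.splits v1 a c" "L.H.splits v1 a d" "L.H.splits v2 b c" "L.H.splits v2 b d"
    using abcd(2) unfolding L.H.caterpillar_def by blast
  obtain w1 w2 where w: "R.H.splits w1 d b" "R.H.splits w1 d c" "R.H.splits w1 d a" "R.H.splits w2 b c" "R.H.splits w2 b a"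
    using abcd(3) unfolding R.H.caterpillar_def by blast
  \<comment> \<open>A copy of \<open>K1\<close> would have to use the same four labels, which
    already form a caterpillar on the left.\<close>
  have no_K1: False if K1: "L.H.balanced p q r s" "R.H.balanced p r q s" for p q r s
  proof -
    have eq: "{p, q, r, s} = {a, b, c, d}" using unique[OF cross_responsible_K1[OF K1]] abcd(1) by simp
    show False using L.H.balanced_not_caterpillar[OF K1(1) abcd(2) eq] K1 R.H.splitsD unfolding R.H.balanced_def by blast
  qed
  interpret Q: unique_K2 "inodes (left_tree T)" L.cl L.sd "inodes (right_tree T)" R.cl R.sd "matching T" a b c d v1 v2 w1 w2
  proof unfold_locales
    show "\<not> R.H.balanced p r q s" if "L.H.balanced p q r s" for p q r s using no_K1 that by blast
    show "{p, q, r, s} = {a, b, c, d}" if "L.H.caterpillar p q r s" "R.H.caterpillar s q r p" for p q r s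
      using unique[OF cross_responsible_K2[OF that]] abcd(1) by simp
  qed (use v w in blast)+
  obtain f g x y where fg: "\<forall>x'\<in>matching T. \<forall>y'\<in>matching T. x' \<noteq> y' \<longrightarrow> {x', y'} \<noteq> {x, y} \<longrightarrow> L.H.lt f x' y' = R.H.lt g x' y'"
    using Q.orders_exist by (elim exE) (rule that)
  obtain dL dR where lay: "is_layout T dL dR" "crossings T dL dR \<subseteq> {{x, y}}" using layout_of_orders[OF fg] by blast
  have ne: "crossings T dL dR \<noteq> {}" if "is_layout T dL dR" for dL dR
    using crossing_exists[OF abcd(2,3) that] .
  have fin: "finite (crossings T dL dR)" for dL dR
  proof -
    have "crossings T dL dR \<subseteq> Pow (matching T)" unfolding crossings_def by auto
    then show ?thesis using matching_finite[OF assms(1)] by (meson finite_Pow_iff finite_subset)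
  qed
  \<comment> \<open>The two halves meet: the constructed layout allows only this crossing, and no
    layout is without one.\<close>
  have "crossings T dL dR = {{x, y}}" using lay ne[OF lay(1)] by blast
  then have "\<exists>dL dR. is_layout T dL dR \<and> card (crossings T dL dR) = 1" using lay(1) by (metis card_1_singleton_iff One_nat_def)
  moreover have "1 \<le> k" if "\<exists>dL dR. is_layout T dL dR \<and> card (crossings T dL dR) = k" for k
    using that ne fin by (metis card_gt_0_iff One_nat_def Suc_leI)
  ultimately show ?thesis unfolding crt_def by (rule Least_equality)
qed

end
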